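(* Let $(\theta_k)_{k\ge1}$ be non-negative reals with associated normalizations $h_n$ and random permutations $\sigma_n$ of $[n]=\{1,\ldots,n\}$ with cycle weights, and suppose that the stability condition $\lim_{n\to\infty} h_{n-1}/h_n=1$ holds. Let $\Psi_n$ be the random point measure on $\mathbb X$ encoding the cycles of $\sigma_n$, and let $\Psi$ be the Poisson random measure on $\mathbb X$ with intensity measure $\lambda$ (all defined in the context). Then $\Psi_n\xrightarrow{vd}\Psi$ as $n\to\infty$, i.e. $\Psi_n$ converges to $\Psi$ in distribution as random elements of the space of locally finite measures on $\mathbb X$ endowed with the vague topology.
   Context: Weighted permutations: let $\theta_k\ge 0$, $k\ge1$. For $\pi$ in the symmetric group $\mathcal S_n$ let $C_k(\pi)$ be the number of $k$-cycles of $\pi$. The random permutation $\sigma_n$ has distribution $\mathbb P\{\sigma_n=\pi\}=\frac{1}{h_n n!}\prod_{k=1}^\infty\theta_k^{C_k(\pi)}$, $\pi\in\mathcal S_n$, where $h_n=\frac1{n!}\sum_{\pi\in\mathcal S_n}\prod_{k=1}^\infty\theta_k^{C_k(\pi)}$ is the normalization making this a probability distribution (the stability condition presupposes $h_n>0$ for all large $n$, which are the $n$ considered). State space: for $k\ge1$ let $\mathbb X_k=\{\boldsymbol x=(x_1,\ldots,x_k)\in[0,1]^k:\min\{x_1,\ldots,x_k\}=x_1\}$ with Euclidean metric $\rho_k$. Let $\mathbb X=\bigcup_{k=1}^\infty\mathbb X_k$ (disjoint union) with metric $\rho(\boldsymbol x_1,\boldsymbol x_2)=\rho_k(\boldsymbol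 x_1,\boldsymbol x_2)$ if $\boldsymbol x_1,\boldsymbol x_2\in\mathbb X_k$, and $\rho(\boldsymbol x_1,\boldsymbol x_2)=\sqrt{\max\{k_1,k_2\}}$ if $\boldsymbol x_1\in\mathbb X_{k_1}$, $\boldsymbol x_2\in\mathbb X_{k_2}$, $k_1\ne k_2$. This is a Polish space with Borel $\sigma$-algebra $\mathcal B(\mathbb X)$. Intensity measure: $\lambda(B)=\sum_{k=1}^\infty\theta_k\,\lambda_k(B\cap\mathbb X_k)$ for $B\in\mathcal B(\mathbb X)$, where $\lambda_k$ is $k$-dimensional Lebesgue measure. Point measures: $\Psi_n=\sum_{k=1}^\infty\sum_{(i_1,\ldots,i_k)}\delta_{(i_1/n,\ldots,i_k/n)}\,\mathbf 1\{\sigma_n(i_1)=i_2,\ldots,\sigma_n(i_{k-1})=i_k,\sigma_n(i_k)=i_1\}$, where the inner sum is over all $k$-tuples of pairwise distinct elements of $[n]$ whose minimum entry comes first (so each cycle of $\sigma_n$ contributes exactly one atom), and $\delta_{\boldsymbol x}$ is the Dirac measure at $\boldsymbol x$. Vague topology: a measure on $\mathbb X$ is locally finite if it is finite on $\rho$-bounded Borel sets; the vague topology on the space of locally finite measures is generated by the maps $\nu\mapsto\int_{\mathbb X}f\,d\nu$ for all continuous functions $f$ on $\mathbb X$ with ($\rho$-)bounded support. *)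

theory Defs
  imports "HOL-Probability.Probability" "HOL-Combinatorics.Orbits"
begin

definition cycle_count :: "nat \<Rightarrow> nat \<Rightarrow> (nat \<Rightarrow> nat) \<Rightarrow> nat" where
  "cycle_count n k \<pi> = card {c \<in> orbit \<pi> ` {1..n}. card c = k}"

text \<open>A permutation of \<open>{1..n}\<close> has no cycle longer than \<open>n\<close>, so the product over all
  \<open>k \<ge> 1\<close> has trivial factors for \<open>k > n\<close>.\<close>

definition cycle_weight :: "(nat \<Rightarrow> real) \<Rightarrow> nat \<Rightarrow> (nat \<Rightarrow> nat) \<Rightarrow> real" where
  "cycle_weight \<theta> n \<pi> = (\<Prod>k=1..n. \<theta> k ^ cycle_count n k \<pi>)"

definition cycle_norm :: "(nat \<Rightarrow> real) \<Rightarrow> nat \<Rightarrow> real" where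
  "cycle_norm \<theta> n = (\<Sum>\<pi> | \<pi> permutes {1..n}. cycle_weight \<theta> n \<pi>) / fact n"

definition weighted_random_permutation ::
    "(nat \<Rightarrow> real) \<Rightarrow> nat \<Rightarrow> 'a measure \<Rightarrow> ('a \<Rightarrow> nat \<Rightarrow> nat) \<Rightarrow> bool" where
  "weighted_random_permutation \<theta> n M \<sigma> \<longleftrightarrow>
     prob_space M \<and>
     \<sigma> \<in> M \<rightarrow>\<^sub>M count_space {\<pi>. \<pi> permutes {1..n}} \<and>
     (\<forall>\<pi>. \<pi> permutes {1..n} \<longrightarrow>
        measure M {\<omega> \<in> space M. \<sigma> \<omega> = \<pi>} = cycle_weight \<theta> n \<pi> / (cycle_norm \<theta> n * fact n))"

text \<open>A point \<open>(x\<^sub>1, \<dots>, x\<^sub>k)\<close> is represented by the list of its coordinates; the disjoint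
  union over \<open>k\<close> is then a union of sets of lists of different lengths.\<close>

definition cycle_cell :: "nat \<Rightarrow> real list set" where
  "cycle_cell k = {xs. length xs = k \<and> set xs \<subseteq> {0..1} \<and> Min (set xs) = hd xs}"

definition cycle_space :: "real list set" where
  "cycle_space = (\<Union>k\<in>{1..}. cycle_cell k)"

definition cycle_dist :: "real list \<Rightarrow> real list \<Rightarrow> real" where
  "cycle_dist xs ys =
     (if length xs = length ys then L2_set (\<lambda>i. xs ! i - ys ! i) {..<length xs}
      else sqrt (max (real (length xs)) (real (length ys))))"

abbreviation cycle_topology :: "real list topology" where
  "cycle_topology \<equiv> Metric_space.mtopology cycle_space cycle_dist"

abbreviation cycle_bounded :: "real list set \<Rightarrow> bool" where
  "cycle_bounded \<equiv> Metric_space.mbounded cycle_space cycle_dist"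

definition borel_measure_of :: "'a topology \<Rightarrow> 'a measure" where
  "borel_measure_of T = sigma (topspace T) {U. openin T U}"

abbreviation cycle_borel :: "real list measure" where
  "cycle_borel \<equiv> borel_measure_of cycle_topology"

definition cell_lebesgue :: "nat \<Rightarrow> real list set \<Rightarrow> ennreal" where
  "cell_lebesgue k A =
     (let L = \<Pi>\<^sub>M i\<in>{..<k}. (lborel :: real measure)
      in emeasure L {x \<in> space L. map x [0..<k] \<in> A})"

definition cycle_intensity :: "(nat \<Rightarrow> real) \<Rightarrow> real list measure" where
  "cycle_intensity \<theta> = measure_of (space cycle_borel) (sets cycle_borel)
     (\<lambda>B. \<Sum>j. ennreal (\<theta> (Suc j)) * cell_lebesgue (Suc j) (B \<inter> cycle_cell (Suc j)))"

definition cycle_tuples :: "nat \<Rightarrow> (nat \<Rightarrow> nat) \<Rightarrow> nat list set" where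
  "cycle_tuples n \<pi> = {is. is \<noteq> [] \<and> distinct is \<and> set is \<subseteq> {1..n} \<and> Min (set is) = hd is \<and>
     (\<forall>j<length is. \<pi> (is ! j) = is ! (Suc j mod length is))}"

text \<open>The push-forward of counting measure is the sum of the Dirac measures at the images.\<close>

definition cycle_point_measure :: "nat \<Rightarrow> (nat \<Rightarrow> nat) \<Rightarrow> real list measure" where
  "cycle_point_measure n \<pi> =
     distr (count_space (cycle_tuples n \<pi>)) cycle_borel (map (\<lambda>i. real i / real n))"

definition locally_finite_measures :: "real list measure set" where
  "locally_finite_measures = {\<nu>. sets \<nu> = sets cycle_borel \<and>
     (\<forall>B \<in> sets cycle_borel. cycle_bounded B \<longrightarrow> emeasure \<nu> B < \<infinity>)}"

definition vague_test_functions :: "(real list \<Rightarrow> real) set" where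
  "vague_test_functions = {f. continuous_map cycle_topology euclideanreal f \<and>
     cycle_bounded (cycle_topology closure_of {x \<in> cycle_space. f x \<noteq> 0})}"

definition vague_topology :: "real list measure topology" where
  "vague_topology = topology_generated_by
     {{\<nu> \<in> locally_finite_measures. (\<integral>x. f x \<partial>\<nu>) \<in> U} | f U. f \<in> vague_test_functions \<and> open U}"

definition random_element :: "'w measure \<Rightarrow> 'a topology \<Rightarrow> ('w \<Rightarrow> 'a) \<Rightarrow> bool" where
  "random_element M T X \<longleftrightarrow> prob_space M \<and> X \<in> M \<rightarrow>\<^sub>M borel_measure_of T"

definition converges_in_distribution ::
    "'a topology \<Rightarrow> (nat \<Rightarrow> 'v measure) \<Rightarrow> (nat \<Rightarrow> 'v \<Rightarrow> 'a) \<Rightarrow> 'w measure \<Rightarrow> ('w \<Rightarrow> 'a) \<Rightarrow> bool" where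
  "converges_in_distribution T M X P Y \<longleftrightarrow>
     (\<forall>\<^sub>F n in sequentially. random_element (M n) T (X n)) \<and> random_element P T Y \<and>
     (\<forall>g. continuous_map T euclideanreal g \<and> bounded (g ` topspace T) \<longrightarrow>
        (\<lambda>n. \<integral>\<omega>. g (X n \<omega>) \<partial>M n) \<longlonglongrightarrow> (\<integral>\<omega>. g (Y \<omega>) \<partial>P))"

definition poisson_random_measure ::
    "real list measure \<Rightarrow> 'w measure \<Rightarrow> ('w \<Rightarrow> real list measure) \<Rightarrow> bool" where
  "poisson_random_measure \<Lambda> P \<Psi> \<longleftrightarrow>
     random_element P vague_topology \<Psi> \<and>
     (\<forall>B \<in> sets cycle_borel.
        if emeasure \<Lambda> B = \<infinity> then (AE \<omega> in P. emeasure (\<Psi> \<omega>) B = \<infinity>)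
        else (\<forall>j::nat. measure P {\<omega> \<in> space P. emeasure (\<Psi> \<omega>) B = of_nat j} =
                measure \<Lambda> B ^ j / fact j * exp (- measure \<Lambda> B))) \<and>
     (\<forall>(m::nat) B. (\<forall>i<m. B i \<in> sets cycle_borel) \<and> disjoint_family_on B {..<m} \<longrightarrow>
        prob_space.indep_vars P (\<lambda>_. borel) (\<lambda>i \<omega>. emeasure (\<Psi> \<omega>) (B i)) {..<m})"

lemma cycle_dist_le_sqrt:
  assumes "xs \<in> cycle_cell k" "ys \<in> cycle_cell k"
  shows "cycle_dist xs ys \<le> sqrt (real k)"
proof -
  have "(\<Sum>i<k. (xs ! i - ys ! i)\<^sup>2) \<le> (\<Sum>i<k. 1)"
  proof (rule sum_mono)
    fix i assume i: "i \<in> {..<k}"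
    then have "xs ! i \<in> set xs" "ys ! i \<in> set ys"
      using assms by (auto simp: cycle_cell_def)
    then have "xs ! i \<in> {0..1}" "ys ! i \<in> {0..1}"
      using assms unfolding cycle_cell_def by blast+
    then have "\<bar>xs ! i - ys ! i\<bar> \<le> 1" by auto
    then show "(xs ! i - ys ! i)\<^sup>2 \<le> 1" by (simp add: abs_square_le_1)
  qed
  then show ?thesis
    using assms unfolding cycle_cell_def cycle_dist_def L2_set_def by simp
qed

lemma Metric_space_cycle: "Metric_space cycle_space cycle_dist"
proof
  show "0 \<le> cycle_dist x y" for x y :: "real list"
    by (simp add: cycle_dist_def max_def)
  show "cycle_dist x y = cycle_dist y x" for x y :: "real list"
    by (simp add: cycle_dist_def max.commute L2_set_def power2_commute)
  show "cycle_dist x y = 0 \<longleftrightarrow> x = y" if "x \<in> cycle_space" "y \<in> cycle_space" for x y :: "real list"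
  proof (cases "length x = length y")
    case True
    then show ?thesis
      by (auto simp: cycle_dist_def L2_set_eq_0_iff intro: nth_equalityI)
  next
    case False
    then show ?thesis by (auto simp: cycle_dist_def max_def)
  qed
  fix x y z :: "real list"
  assume x: "x \<in> cycle_space" and z: "z \<in> cycle_space"
  consider "length x = length y" "length y = length z"
    | "length x = length y" "length y \<noteq> length z"
    | "length x \<noteq> length y" "length y = length z"
    | "length x \<noteq> length y" "length x = length z"
    | "length x \<noteq> length y" "length y \<noteq> length z" "length x \<noteq> length z"
    by metis
  then show "cycle_dist x z \<le> cycle_dist x y + cycle_dist y z"
  proof cases
    case 1
    then show ?thesis
      using L2_set_triangle_ineq[of "\<lambda>i. x ! i - y ! i" "\<lambda>i. y ! i - z ! i" "{..<length x}"]
      by (simp add: cycle_dist_def)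
  next
    case 4
    have "cycle_dist x z \<le> sqrt (real (length x))"
      using x z 4 by (intro cycle_dist_le_sqrt) (auto simp: cycle_space_def cycle_cell_def)
    also have "\<dots> \<le> cycle_dist x y" using 4 by (simp add: cycle_dist_def)
    also have "\<dots> \<le> cycle_dist x y + cycle_dist y z" by (simp add: cycle_dist_def max_def)
    finally show ?thesis .
  next
    case 5
    then show ?thesis by (simp add: cycle_dist_def max_def add_increasing add_increasing2)
  qed (simp_all add: cycle_dist_def)
qed

lemma space_cycle_borel [simp]: "space cycle_borel = cycle_space"
  by (simp add: borel_measure_of_def Metric_space.topspace_mtopology[OF Metric_space_cycle]
      space_measure_of_conv)

lemma sets_borel_measure_of:
  "sets (borel_measure_of T) = sigma_sets (topspace T) {U. openin T U}"
  unfolding borel_measure_of_def by (rule sets_measure_of) (auto dest: openin_subset)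

lemma closed_cell: "closed {x. map x [0..<k] \<in> cycle_cell k}"
proof (cases k)
  case 0
  then show ?thesis by (simp add: cycle_cell_def)
next
  case (Suc m)
  have "map x [0..<k] \<in> cycle_cell k \<longleftrightarrow> (\<forall>i<k. 0 \<le> x i \<and> x i \<le> 1 \<and> x 0 \<le> x i)"
    for x :: "nat \<Rightarrow> real"
  proof -
    have "hd (map x [0..<k]) = x 0" using Suc by (simp add: hd_map del: upt_Suc)
    moreover have "Min (x ` {0..<k}) = x 0 \<longleftrightarrow> (\<forall>i<k. x 0 \<le> x i)"
      using Suc by (subst Min_eq_iff) auto
    ultimately show ?thesis by (auto simp: cycle_cell_def image_subset_iff)
  qed
  then have "{x. map x [0..<k] \<in> cycle_cell k}
      = (\<Inter>i\<in>{..<k}. {x. 0 \<le> x i} \<inter> {x. x i \<le> 1} \<inter> {x. x 0 \<le> x i})" by auto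
  also have "closed \<dots>"
    by (intro closed_INT ballI closed_Int closed_Collect_le continuous_on_const
        continuous_on_product_coordinates)
  finally show ?thesis .
qed

lemma cell_openin:
  assumes U: "openin cycle_topology U"
  obtains V :: "(nat \<Rightarrow> real) set" where "open V"
    "{x. map x [0..<Suc j] \<in> U \<inter> cycle_cell (Suc j)} = V \<inter> {x. map x [0..<Suc j] \<in> cycle_cell (Suc j)}"
proof -
  let ?k = "Suc j"
  define S where "S = {x::nat \<Rightarrow> real. map x [0..<?k] \<in> U \<inter> cycle_cell ?k}"
  interpret X: Metric_space cycle_space cycle_dist by (rule Metric_space_cycle)
  have "\<exists>r>0. X.mball (map a [0..<?k]) r \<subseteq> U" if "a \<in> S" for a
    using U that unfolding S_def X.openin_mtopology by blast
  then obtain r where r: "\<And>a. a \<in> S \<Longrightarrow> r a > 0"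
    "\<And>a. a \<in> S \<Longrightarrow> X.mball (map a [0..<?k]) (r a) \<subseteq> U" by metis
  define V where "V = (\<Union>a\<in>S. {x. L2_set (\<lambda>i. a i - x i) {..<?k} < r a})"
  have dist: "cycle_dist (map a [0..<?k]) (map x [0..<?k]) = L2_set (\<lambda>i. a i - x i) {..<?k}" for a x
    unfolding cycle_dist_def by (simp del: upt_Suc) (rule L2_set_cong, auto simp del: upt_Suc)
  have cell: "y \<in> cycle_cell ?k \<Longrightarrow> y \<in> cycle_space" for y
    by (auto simp: cycle_space_def)
  have "open V"
    unfolding V_def L2_set_def
    by (intro open_UN ballI open_Collect_less continuous_intros continuous_on_product_coordinates)
  moreover have "S = V \<inter> {x. map x [0..<?k] \<in> cycle_cell ?k}"
  proof (intro equalityI subsetI)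
    fix x assume "x \<in> S"
    then show "x \<in> V \<inter> {x. map x [0..<?k] \<in> cycle_cell ?k}"
      using r(1) by (auto simp: V_def S_def L2_set_def simp del: upt_Suc)
  next
    fix x assume x: "x \<in> V \<inter> {x. map x [0..<?k] \<in> cycle_cell ?k}"
    then obtain a where a: "a \<in> S" "L2_set (\<lambda>i. a i - x i) {..<?k} < r a"
      by (auto simp: V_def simp del: upt_Suc)
    have "map x [0..<?k] \<in> X.mball (map a [0..<?k]) (r a)"
      using a x cell by (simp add: dist S_def del: upt_Suc)
    then show "x \<in> S" using r(2)[OF a(1)] x by (auto simp: S_def simp del: upt_Suc)
  qed
  ultimately show thesis using that unfolding S_def by blast
qed

lemma cell_borel:
  assumes B: "B \<in> sets cycle_borel"
  shows "{x::nat \<Rightarrow> real. map x [0..<Suc j] \<in> B \<inter> cycle_cell (Suc j)} \<in> sets borel"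
  using assms unfolding sets_borel_measure_of
proof (induction rule: sigma_sets.induct)
  case (Basic U)
  then obtain V :: "(nat \<Rightarrow> real) set" where "open V"
    "{x. map x [0..<Suc j] \<in> U \<inter> cycle_cell (Suc j)} = V \<inter> {x. map x [0..<Suc j] \<in> cycle_cell (Suc j)}"
    using cell_openin by (metis mem_Collect_eq)
  then show ?case using closed_cell[of "Suc j"] by (metis borel_closed borel_open sets.Int)
next
  case Empty
  then show ?case by simp
next
  case (Compl A)
  have "cycle_cell (Suc j) \<subseteq> cycle_space" by (auto simp: cycle_space_def)
  then have "{x. map x [0..<Suc j] \<in> (topspace cycle_topology - A) \<inter> cycle_cell (Suc j)} =
      {x. map x [0..<Suc j] \<in> cycle_cell (Suc j)} - {x. map x [0..<Suc j] \<in> A \<inter> cycle_cell (Suc j)}"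
    by (auto simp: Metric_space.topspace_mtopology[OF Metric_space_cycle] simp del: upt_Suc)
  then show ?case using Compl closed_cell[of "Suc j"] by (metis borel_closed sets.Diff)
next
  case (Union A)
  have "{x. map x [0..<Suc j] \<in> \<Union> (range A) \<inter> cycle_cell (Suc j)} =
      (\<Union>i. {x. map x [0..<Suc j] \<in> A i \<inter> cycle_cell (Suc j)})"
    by (auto simp del: upt_Suc)
  then show ?case using Union by simp
qed

lemma cell_lebesgue_measurable:
  assumes "B \<in> sets cycle_borel"
  shows "{x \<in> space (\<Pi>\<^sub>M i\<in>{..<Suc j}. (lborel :: real measure)).
           map x [0..<Suc j] \<in> B \<inter> cycle_cell (Suc j)}
         \<in> sets (\<Pi>\<^sub>M i\<in>{..<Suc j}. (lborel :: real measure))"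
proof -
  let ?L = "\<Pi>\<^sub>M i\<in>{..<Suc j}. (lborel :: real measure)"
  have "(\<lambda>x i. if i < Suc j then x i else 0) \<in> ?L \<rightarrow>\<^sub>M (\<Pi>\<^sub>M i\<in>UNIV. (borel :: real measure))"
  proof (rule measurable_PiM_single')
    show "(\<lambda>x. if i < Suc j then x i else 0) \<in> ?L \<rightarrow>\<^sub>M borel" for i
    proof (cases "i < Suc j")
      case True
      then have "(\<lambda>x. x i) \<in> ?L \<rightarrow>\<^sub>M lborel" by (intro measurable_component_singleton) auto
      then show ?thesis using True by simp
    qed simp
  qed simp
  then have "(\<lambda>x i. if i < Suc j then x i else 0) \<in> ?L \<rightarrow>\<^sub>M borel"
    using sets_PiM_equal_borel measurable_cong_sets by blast
  from measurable_sets[OF this cell_borel[OF assms, of j]]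
  show ?thesis
  proof (rule back_subst[of "\<lambda>A. A \<in> sets ?L"])
    have eq: "map (\<lambda>i. if i < Suc j then x i else 0) [0..<Suc j] = map x [0..<Suc j]" for x :: "nat \<Rightarrow> real"
      by (rule map_cong) auto
    show "(\<lambda>x i. if i < Suc j then x i else 0) -` {x. map x [0..<Suc j] \<in> B \<inter> cycle_cell (Suc j)} \<inter> space ?L =
        {x \<in> space ?L. map x [0..<Suc j] \<in> B \<inter> cycle_cell (Suc j)}"
      by (auto simp: eq simp del: upt_Suc map_eq_conv)
  qed
qed

lemma emeasure_cycle_intensity:
  assumes "B \<in> sets cycle_borel"
  shows "emeasure (cycle_intensity \<theta>) B =
    (\<Sum>j. ennreal (\<theta> (Suc j)) * cell_lebesgue (Suc j) (B \<inter> cycle_cell (Suc j)))"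
proof (rule emeasure_measure_of[OF cycle_intensity_def])
  let ?S = "sets cycle_borel"
  let ?\<mu> = "\<lambda>B. \<Sum>j. ennreal (\<theta> (Suc j)) * cell_lebesgue (Suc j) (B \<inter> cycle_cell (Suc j))"
  have S: "sets (cycle_intensity \<theta>) = ?S"
    unfolding cycle_intensity_def by (simp only: sets.sets_measure_of_eq)
  show "?S \<subseteq> Pow (space cycle_borel)" by (rule sets.space_closed)
  show "B \<in> sets (cycle_intensity \<theta>)" using assms by (simp only: S)
  show "positive (sets (cycle_intensity \<theta>)) ?\<mu>" by (simp add: positive_def cell_lebesgue_def)
  show "countably_additive (sets (cycle_intensity \<theta>)) ?\<mu>"
  proof (rule countably_additiveI)
    fix A :: "nat \<Rightarrow> real list set"
    assume "range A \<subseteq> sets (cycle_intensity \<theta>)" and disj: "disjoint_family A"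
    then have A: "A i \<in> ?S" for i by (auto simp: S)
    have *: "(\<Sum>i. cell_lebesgue (Suc j) (A i \<inter> cycle_cell (Suc j)))
        = cell_lebesgue (Suc j) (\<Union> (range A) \<inter> cycle_cell (Suc j))" for j
    proof -
      let ?L = "\<Pi>\<^sub>M i\<in>{..<Suc j}. (lborel :: real measure)"
      let ?D = "\<lambda>i. {x \<in> space ?L. map x [0..<Suc j] \<in> A i \<inter> cycle_cell (Suc j)}"
      have "(\<Sum>i. emeasure ?L (?D i)) = emeasure ?L (\<Union>i. ?D i)"
      proof (rule suminf_emeasure)
        show "range ?D \<subseteq> sets ?L" using cell_lebesgue_measurable[OF A] by blast
        show "disjoint_family ?D" using disj unfolding disjoint_family_on_def by blast
      qed
      also have "(\<Union>i. ?D i) =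
          {x \<in> space ?L. map x [0..<Suc j] \<in> \<Union> (range A) \<inter> cycle_cell (Suc j)}"
        by (auto simp del: upt_Suc)
      finally show ?thesis by (simp add: cell_lebesgue_def Let_def del: upt_Suc)
    qed
    have "(\<Sum>i. ?\<mu> (A i)) =
        (\<Sum>j. \<Sum>i. ennreal (\<theta> (Suc j)) * cell_lebesgue (Suc j) (A i \<inter> cycle_cell (Suc j)))"
      using nn_integral_suminf[of "\<lambda>j i. ennreal (\<theta> (Suc j)) * cell_lebesgue (Suc j) (A i \<inter> cycle_cell (Suc j))"
          "count_space UNIV"]
      by (simp add: nn_integral_count_space_nat)
    then show "(\<Sum>i. ?\<mu> (A i)) = ?\<mu> (\<Union> (range A))" by (simp add: *)
  qed
qed

lemma finite_cycle_tuples: "finite (cycle_tuples n \<pi>)"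
  by (rule finite_subset[OF _ finite_subset_distinct[of "{1..n}"]])
    (auto simp: cycle_tuples_def)

lemma emeasure_cycle_point_measure:
  assumes "B \<in> sets cycle_borel"
  shows "emeasure (cycle_point_measure n \<pi>) B =
    (\<Sum>t\<in>cycle_tuples n \<pi>. indicator B (map (\<lambda>i. real i / real n) t))"
proof -
  let ?f = "map (\<lambda>i. real i / real n)"
  have "?f t \<in> cycle_space" if "t \<in> cycle_tuples n \<pi>" for t
  proof -
    have t: "t \<noteq> []" "set t \<subseteq> {1..n}" "Min (set t) = hd t"
      using that by (auto simp: cycle_tuples_def)
    have "mono (\<lambda>i. real i / real n)" by (auto simp: mono_def divide_right_mono)
    then have "Min (set (?f t)) = hd (?f t)"
      using t mono_Min_commute[of "\<lambda>i. real i / real n" "set t"] by (simp add: hd_map)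
    moreover have "set (?f t) \<subseteq> {0..1}" using t(2) by (auto simp: divide_le_eq)
    ultimately show ?thesis
      using t(1) by (auto simp: cycle_space_def cycle_cell_def Suc_le_eq)
  qed
  then have f: "?f \<in> count_space (cycle_tuples n \<pi>) \<rightarrow>\<^sub>M cycle_borel" by auto
  have "emeasure (cycle_point_measure n \<pi>) B =
      (\<integral>\<^sup>+ t. indicator B (?f t) \<partial>count_space (cycle_tuples n \<pi>))"
    using assms f by (simp add: cycle_point_measure_def emeasure_distr nn_integral_distr
        flip: nn_integral_indicator)
  then show ?thesis
    by (simp add: nn_integral_count_space_finite finite_cycle_tuples)
qed

lemma topspace_vague_topology: "topspace vague_topology = locally_finite_measures"
proof -
  have "(\<lambda>_. 0) \<in> vague_test_functions"
    by (simp add: vague_test_functions_def Metric_space.mbounded_empty[OF Metric_space_cycle])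
  then have "locally_finite_measures \<in>
      {{\<nu> \<in> locally_finite_measures. (\<integral>x. f x \<partial>\<nu>) \<in> U} | f U. f \<in> vague_test_functions \<and> open U}"
    by (intro CollectI exI[of _ "\<lambda>_. 0"] exI[of _ UNIV]) auto
  then show ?thesis
    unfolding vague_topology_def topology_generated_by_topspace by blast
qed

end

theory Submission
  imports Defs "HOL-Combinatorics.Cycles"
begin

text \<open>
  The weight of all permutations of \<open>[n]\<close> that contain given disjoint cycles of total length \<open>s\<close> is
  the product of the corresponding \<open>\<theta>\<close>'s times \<open>(n - s)! h\<^bsub>n-s\<^esub>\<close>. Hence the joint factorial moments of
  the numbers of atoms of \<open>\<Psi>\<^sub>n\<close> in disjoint cells are, up to the factor \<open>h\<^bsub>n-s\<^esub> / h\<^sub>n \<longrightarrow> 1\<close>, normalized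
  counts of grid points, that is, Riemann sums converging to the products of the intensities of the
  cells. As \<open>h\<^bsub>n-s\<^esub> / h\<^sub>n \<le> C 2\<^sup>s\<close>, dominated convergence inverts the moments, and the cell counts converge
  jointly to independent Poisson variables.

  A vaguely continuous functional \<open>g\<close> is compared with its values at discretized measures, which carry
  the mass of each cell of a finite grid at a corner of the cell. For a fixed mesh these depend on
  finitely many cell counts only. The error is uniformly small on the configurations with at most
  \<open>a\<^sub>k\<close> cycles of length \<open>k\<close> for all \<open>k\<close>, since these are sequentially compact in the vague topology,
  and the first moment bound shows that \<open>\<Psi>\<^sub>n\<close> belongs to such a set with probability close to 1
  uniformly in \<open>n\<close>.
\<close>


section \<open>Weighted permutations containing prescribed cycles\<close>

text \<open>The vague topology enters through convergent sequences only. For a fixed mesh a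
  functional becomes a function of a list of natural numbers, and on this countable type convergence
  of point probabilities already gives convergence of expectations. The price is an interchange of
  the limits in \<open>n\<close> and in the mesh. For the Poisson measure almost sure convergence of
  the discretizations is enough; for \<Psi>_n the error must be small uniformly in \<open>n\<close>,
  which is what the compactness argument provides.

  The total intensity may be infinite, so the total number of cycles need not be tight, and every
  length gets its own bound.

  Convergence of the ratios gives the limit of each fixed moment, but no majorant as
  \<open>s\<close> grows. A geometric bound suffices, because it only enlarges the Poisson
  parameters to \<open>\<theta> k * 2 ^ k\<close>, and the factorials in the binomial moments absorb
  geometric growth. Half-open grid cells make the Riemann sums converge without a discussion of cell
  boundaries.\<close>

definition cycle_lists :: "nat set \<Rightarrow> nat list set" where
  "cycle_lists S = {t. t \<noteq> [] \<and> distinct t \<and> set t \<subseteq> S \<and> Min (set t) = hd t}"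

definition traverses :: "(nat \<Rightarrow> nat) \<Rightarrow> nat list \<Rightarrow> bool" where
  "traverses \<pi> t \<longleftrightarrow> (\<forall>j<length t. \<pi> (t ! j) = t ! (Suc j mod length t))"

text \<open>The weight is attached to cycles instead of cycle lengths and makes sense on any finite
  ground set: removing a cycle from a permutation of \<open>{1..n}\<close> leaves a permutation of a
  set that need not be an initial segment.\<close>

definition orbit_weight :: "(nat \<Rightarrow> real) \<Rightarrow> nat set \<Rightarrow> (nat \<Rightarrow> nat) \<Rightarrow> real" where
  "orbit_weight \<theta> S \<pi> = (\<Prod>c\<in>orbit \<pi> ` S. \<theta> (card c))"

definition total_weight :: "(nat \<Rightarrow> real) \<Rightarrow> nat set \<Rightarrow> real" where
  "total_weight \<theta> S = (\<Sum>\<pi> | \<pi> permutes S. orbit_weight \<theta> S \<pi>)"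

lemma cycle_tuples_eq: "cycle_tuples n \<pi> = {t \<in> cycle_lists {1..n}. traverses \<pi> t}"
  by (auto simp: cycle_tuples_def cycle_lists_def traverses_def)

lemma funpow_traverses:
  assumes "traverses \<pi> t" "j < length t"
  shows "(\<pi> ^^ j) (hd t) = t ! j"
  using assms(2)
proof (induction j)
  case 0
  then show ?case by (simp add: hd_conv_nth)
next
  case (Suc j)
  then show ?case using assms(1) by (simp add: traverses_def)
qed

lemma traverses_in_set:
  assumes "traverses \<pi> t" "x \<in> set t"
  shows "\<pi> x \<in> set t"
proof -
  obtain j where "j < length t" "x = t ! j" using assms(2) by (metis in_set_conv_nth)
  moreover have "Suc j mod length t < length t"
    using calculation(1) by (intro mod_less_divisor) auto
  ultimately show ?thesis using assms(1) by (simp add: traverses_def)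
qed

lemma cyclic_on_traverses:
  assumes "traverses \<pi> t" "t \<noteq> []"
  shows "cyclic_on \<pi> (set t)"
proof (rule cyclic_on_singleI[of "hd t"])
  show "hd t \<in> set t" using assms(2) by simp
  show "set t = orbit \<pi> (hd t)"
  proof
    show "orbit \<pi> (hd t) \<subseteq> set t"
    proof
      fix x assume "x \<in> orbit \<pi> (hd t)"
      then show "x \<in> set t"
        by induction (use assms traverses_in_set in auto)
    qed
    \<comment> \<open>\<open>orbit\<close> collects images under at least one application of
      \<open>\<pi>\<close>, so the starting point lies in its orbit only because the list closes up:
      at the last index \<open>Suc j mod length t\<close> is 0.\<close>
    have base: "hd t \<in> orbit \<pi> (hd t)"
    proof -
      let ?j = "length t - 1"
      have j: "?j < length t" "Suc ?j = length t" using assms(2) by (auto simp: Suc_diff_Suc)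
      have "(\<pi> ^^ length t) (hd t) = \<pi> (t ! ?j)"
        using funpow_traverses[OF assms(1) j(1)] by (subst j(2)[symmetric]) (simp del: Suc_pred)
      also have "\<dots> = hd t"
        using assms(1) j unfolding traverses_def by (metis assms(2) hd_conv_nth mod_self)
      finally show ?thesis using assms(2) unfolding orbit_altdef
        by (metis (mono_tags, lifting) length_greater_0_conv mem_Collect_eq)
    qed
    show "set t \<subseteq> orbit \<pi> (hd t)"
    proof
      fix x assume "x \<in> set t"
      then obtain j where j: "j < length t" "x = t ! j" by (metis in_set_conv_nth)
      have "(\<pi> ^^ j) (hd t) \<in> orbit \<pi> (hd t)" using base by (rule funpow_in_orbit)
      then show "x \<in> orbit \<pi> (hd t)" using funpow_traverses[OF assms(1) j(1)] j(2) by simp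
    qed
  qed
qed

text \<open>If the lists meet, both entry sets are the orbit of a common point and hence equal.
  Since the minimum comes first, both lists start at the same point, and iterating
  \<open>\<pi>\<close> determines the rest.\<close>

lemma traverses_disjoint:
  assumes "traverses \<pi> t" "traverses \<pi> u" "t \<in> cycle_lists S" "u \<in> cycle_lists S" "t \<noteq> u"
  shows "set t \<inter> set u = {}"
proof (rule ccontr)
  assume "set t \<inter> set u \<noteq> {}"
  then obtain x where x: "x \<in> set t" "x \<in> set u" by blast
  have "t \<noteq> []" "u \<noteq> []" using x by auto
  then have eq: "set t = set u"
    using x orbit_cyclic_eq3[OF cyclic_on_traverses] assms(1,2) by metis
  then have hd: "hd t = hd u" and len: "length t = length u"
    using assms(3,4) unfolding cycle_lists_def by (simp, metis (mono_tags) mem_Collect_eq distinct_card)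
  have "t = u"
    using funpow_traverses[OF assms(1)] funpow_traverses[OF assms(2)] hd len
    by (intro nth_equalityI) auto
  with assms(5) show False by contradiction
qed

lemma permutes_self_in_orbit: "\<pi> permutes S \<Longrightarrow> finite S \<Longrightarrow> x \<in> orbit \<pi> x"
  by (rule permutation_self_in_orbit) (auto simp: permutation_permutes)

lemma cycle_weight_eq:
  assumes "\<pi> permutes {1..n}"
  shows "cycle_weight \<theta> n \<pi> = orbit_weight \<theta> {1..n} \<pi>"
proof -
  let ?O = "orbit \<pi> ` {1..n}"
  have "card ` ?O \<subseteq> {1..n}"
  proof clarsimp
    fix x assume x: "Suc 0 \<le> x" "x \<le> n"
    have sub: "orbit \<pi> x \<subseteq> {1..n}" using assms x by (intro permutes_orbit_subset) auto
    then have "card (orbit \<pi> x) \<le> n" using card_mono[OF _ sub] by simp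
    moreover have "card (orbit \<pi> x) > 0"
      using finite_subset[OF sub] orbit_nonempty[of \<pi> x] by (simp add: card_gt_0_iff)
    ultimately show "Suc 0 \<le> card (orbit \<pi> x) \<and> card (orbit \<pi> x) \<le> n" by simp
  qed
  then have "(\<Prod>k\<in>{1..n}. \<Prod>c\<in>{c \<in> ?O. card c = k}. \<theta> (card c)) = (\<Prod>c\<in>?O. \<theta> (card c))"
    by (intro prod.group) auto
  moreover have "(\<Prod>c\<in>{c \<in> ?O. card c = k}. \<theta> (card c)) = \<theta> k ^ cycle_count n k \<pi>" for k
    by (simp add: cycle_count_def)
  ultimately show ?thesis
    by (simp add: cycle_weight_def orbit_weight_def)
qed

lemma total_weight_atLeastAtMost: "total_weight \<theta> {1..n} = fact n * cycle_norm \<theta> n"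
  unfolding total_weight_def cycle_norm_def by (simp, intro sum.cong) (auto simp: cycle_weight_eq)

text \<open>Conjugation by \<open>f\<close> maps orbits to their images and so keeps all cycle
  lengths. \<open>?h\<close> spells out the conjugation in the form of
  \<open>bij_betw_permutations\<close>, by which the sum is reindexed.\<close>

lemma total_weight_bij:
  assumes f: "bij_betw f A B" and fin: "finite A"
  shows "total_weight \<theta> B = total_weight \<theta> A"
proof -
  let ?h = "\<lambda>\<pi> x. if x \<in> B then f (\<pi> (inv_into A f x)) else x"
  have inj: "inj_on f A" and B: "f ` A = B" using f by (auto simp: bij_betw_def)
  have "orbit_weight \<theta> B (?h \<pi>) = orbit_weight \<theta> A \<pi>" if \<pi>: "\<pi> permutes A" for \<pi>
  proof -
    have sub: "orbit \<pi> x \<subseteq> A" if "x \<in> A" for x using permutes_orbit_subset[OF \<pi> that] .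
    have orb: "f ` orbit \<pi> x = orbit (?h \<pi>) (f x)" if x: "x \<in> A" for x
    proof (rule orbit_inverse)
      show "x \<in> orbit \<pi> x" by (rule permutes_self_in_orbit[OF \<pi> fin])
      show "?h \<pi> (f y) = f (\<pi> y)" if "y \<in> orbit \<pi> x" for y
      proof -
        have "y \<in> A" using sub[OF x] that by blast
        then show ?thesis using inj B by auto
      qed
    qed
    have "orbit (?h \<pi>) ` B = image f ` (orbit \<pi> ` A)"
      unfolding B[symmetric] image_image by (rule image_cong) (auto simp: orb B)
    moreover have "inj_on (image f) (orbit \<pi> ` A)"
      by (rule inj_on_subset[OF inj_on_image_Pow[OF inj]]) (use sub in auto)
    ultimately have "orbit_weight \<theta> B (?h \<pi>) = (\<Prod>c\<in>orbit \<pi> ` A. \<theta> (card (f ` c)))"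
      unfolding orbit_weight_def by (simp add: prod.reindex)
    also have "\<dots> = orbit_weight \<theta> A \<pi>"
    proof -
      have "card (f ` c) = card c" if "c \<in> orbit \<pi> ` A" for c
        using that sub inj by (intro card_image) (blast intro: inj_on_subset)
      then show ?thesis unfolding orbit_weight_def by (intro prod.cong) simp_all
    qed
    finally show ?thesis .
  qed
  then have "(\<Sum>\<pi> | \<pi> permutes A. orbit_weight \<theta> B (?h \<pi>)) = total_weight \<theta> A"
    unfolding total_weight_def by (intro sum.cong) auto
  then show ?thesis
    using sum.reindex_bij_betw[OF bij_betw_permutations[OF f], of "orbit_weight \<theta> B"]
    by (simp add: total_weight_def)
qed

lemma total_weight_eq:
  assumes "finite S"
  shows "total_weight \<theta> S = fact (card S) * cycle_norm \<theta> (card S)"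
proof -
  obtain f where "bij_betw f S {1..card S}"
    using finite_same_card_bij[OF assms, of "{1..card S}"] by auto
  from total_weight_bij[OF this assms, of \<theta>, symmetric] show ?thesis
    unfolding total_weight_atLeastAtMost .
qed

text \<open>\<open>set t\<close> is one orbit and its complement \<open>R\<close> is invariant, so
  restricting \<open>\<pi>\<close> to \<open>R\<close> changes no other orbit.\<close>

lemma orbit_weight_traverses:
  assumes \<pi>: "\<pi> permutes S" and fin: "finite S" and t: "t \<in> cycle_lists S" "traverses \<pi> t"
  defines "R \<equiv> S - set t"
  shows "orbit_weight \<theta> S \<pi> = \<theta> (length t) * orbit_weight \<theta> R (perm_restrict \<pi> R)"
proof -
  have ne: "t \<noteq> []" "distinct t" "set t \<subseteq> S" using t by (auto simp: cycle_lists_def)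
  have cyc: "cyclic_on \<pi> (set t)" using cyclic_on_traverses t(2) ne(1) .
  have perm: "perm_restrict \<pi> R permutes R"
    unfolding R_def by (rule perm_restrict_diff_cyclic[OF \<pi> cyc])
  have orbR: "orbit \<pi> x = orbit (perm_restrict \<pi> R) x" if "x \<in> R" for x
  proof (rule orbit_cong)
    show "x \<in> orbit (perm_restrict \<pi> R) x"
      by (rule permutes_self_in_orbit[OF perm]) (use fin in \<open>simp add: R_def\<close>)
    fix s assume "s \<in> orbit (perm_restrict \<pi> R) x"
    then have "s \<in> R" using permutes_orbit_subset[OF perm that] by blast
    then show "\<pi> s = perm_restrict \<pi> R s" by (simp add: perm_restrict_def)
  qed
  have orbt: "orbit \<pi> x = set t" if "x \<in> set t" for x
    using orbit_cyclic_eq3[OF cyc that] .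
  have S: "S = set t \<union> R" using ne by (auto simp: R_def)
  have "orbit \<pi> ` S = insert (set t) (orbit (perm_restrict \<pi> R) ` R)"
  proof -
    have "orbit \<pi> ` set t = {set t}" using ne(1) orbt by (auto intro!: image_eqI[of _ _ "hd t"])
    moreover have "orbit \<pi> ` R = orbit (perm_restrict \<pi> R) ` R" using orbR by auto
    moreover have "orbit \<pi> ` S = orbit \<pi> ` set t \<union> orbit \<pi> ` R"
      using S by (metis image_Un)
    ultimately show ?thesis by simp
  qed
  moreover have "set t \<notin> orbit (perm_restrict \<pi> R) ` R"
  proof
    assume "set t \<in> orbit (perm_restrict \<pi> R) ` R"
    then have "set t \<subseteq> R" using permutes_orbit_subset[OF perm] by blast
    then show False using ne(1) by (cases t) (auto simp: R_def)
  qed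
  moreover have "finite R" using fin by (simp add: R_def)
  ultimately show ?thesis
    unfolding orbit_weight_def using ne by (simp add: distinct_card)
qed

text \<open>On \<open>set t\<close> a permutation that traverses \<open>t\<close> is prescribed,
  hence its restriction to the complement determines it. The inverse map composes with
  \<open>cycle_of_list t\<close>.\<close>

lemma perm_restrict_bij_betw:
  assumes t: "t \<in> cycle_lists S"
  shows "bij_betw (\<lambda>\<pi>. perm_restrict \<pi> (S - set t))
    {\<pi>. \<pi> permutes S \<and> traverses \<pi> t} {\<pi>. \<pi> permutes (S - set t)}"
proof (rule bij_betwI')
  let ?R = "S - set t"
  have ne: "t \<noteq> []" "distinct t" "set t \<subseteq> S" using t by (auto simp: cycle_lists_def)
  fix \<pi> \<rho> assume p: "\<pi> \<in> {\<pi>. \<pi> permutes S \<and> traverses \<pi> t}" "\<rho> \<in> {\<pi>. \<pi> permutes S \<and> traverses \<pi> t}"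
  show "(perm_restrict \<pi> ?R = perm_restrict \<rho> ?R) = (\<pi> = \<rho>)"
  proof
    assume eq: "perm_restrict \<pi> ?R = perm_restrict \<rho> ?R"
    show "\<pi> = \<rho>"
    proof
      fix x
      consider "x \<notin> S" | "x \<in> ?R" | "x \<in> set t" by blast
      then show "\<pi> x = \<rho> x"
      proof cases
        case 1
        then show ?thesis using p by (auto simp: permutes_not_in)
      next
        case 2
        then show ?thesis using fun_cong[OF eq, of x] by (simp add: perm_restrict_def)
      next
        case 3
        then obtain j where "j < length t" "x = t ! j" by (metis in_set_conv_nth)
        then show ?thesis using p by (simp add: traverses_def)
      qed
    qed
  qed simp
next
  let ?R = "S - set t"
  fix \<pi> assume "\<pi> \<in> {\<pi>. \<pi> permutes S \<and> traverses \<pi> t}"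
  then show "perm_restrict \<pi> ?R \<in> {\<pi>. \<pi> permutes ?R}"
    using t by (auto intro!: perm_restrict_diff_cyclic cyclic_on_traverses simp: cycle_lists_def)
next
  let ?R = "S - set t" and ?c = "cycle_of_list t"
  have ne: "t \<noteq> []" "distinct t" "set t \<subseteq> S" using t by (auto simp: cycle_lists_def)
  fix \<rho> assume "\<rho> \<in> {\<pi>. \<pi> permutes ?R}"
  then have \<rho>: "\<rho> permutes ?R" by simp
  have c: "?c permutes set t" by (rule cycle_permutes)
  have rot: "map ?c t = rotate1 t" using cyclic_rotation[of t 1] ne(2) by simp
  have "?c \<circ> \<rho> permutes S"
    by (rule permutes_compose) (use \<rho> c ne permutes_subset in blast)+
  moreover have "traverses (?c \<circ> \<rho>) t"
    unfolding traverses_def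
  proof (intro allI impI)
    fix j assume j: "j < length t"
    then have "\<rho> (t ! j) = t ! j" using \<rho> by (auto simp: permutes_not_in)
    moreover have "?c (t ! j) = rotate1 t ! j" using j by (simp flip: rot)
    ultimately show "(?c \<circ> \<rho>) (t ! j) = t ! (Suc j mod length t)"
      using j by (simp add: nth_rotate1)
  qed
  moreover have "\<rho> = perm_restrict (?c \<circ> \<rho>) ?R"
  proof
    fix x
    show "\<rho> x = perm_restrict (?c \<circ> \<rho>) ?R x"
    proof (cases "x \<in> ?R")
      case True
      then have "\<rho> x \<in> ?R" using permutes_in_image[OF \<rho>] by blast
      then show ?thesis using True permutes_not_in[OF c] by (simp add: perm_restrict_def)
    next
      case False
      then have "\<rho> x = x" using \<rho> by (simp add: permutes_not_in)
      with False show ?thesis by (simp add: perm_restrict_simps)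
    qed
  qed
  ultimately show "\<exists>\<pi>\<in>{\<pi>. \<pi> permutes S \<and> traverses \<pi> t}. \<rho> = perm_restrict \<pi> ?R"
    by blast
qed

text \<open>One cycle is removed at a time; the remaining lists live on the smaller ground set, so
  the induction must leave \<open>S\<close> free. Distinctness of \<open>concat ts\<close> says that
  every list is distinct and that different lists are disjoint.\<close>

lemma sum_orbit_weight_traverses:
  assumes "finite S" "\<forall>t\<in>set ts. t \<in> cycle_lists S" "distinct (concat ts)"
  shows "(\<Sum>\<pi> | \<pi> permutes S \<and> (\<forall>t\<in>set ts. traverses \<pi> t). orbit_weight \<theta> S \<pi>) =
    prod_list (map (\<lambda>t. \<theta> (length t)) ts) * total_weight \<theta> (S - set (concat ts))"
  using assms
proof (induction ts arbitrary: S)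
  case Nil
  then show ?case by (simp add: total_weight_def)
next
  case (Cons t ts)
  let ?R = "S - set t"
  have t: "t \<in> cycle_lists S" using Cons.prems by simp
  have disj: "set u \<inter> set t = {}" if "u \<in> set ts" for u using Cons.prems that by auto
  have bij: "bij_betw (\<lambda>\<pi>. perm_restrict \<pi> ?R)
      {\<pi>. \<pi> permutes S \<and> (\<forall>t\<in>set (t # ts). traverses \<pi> t)}
      {\<pi>. \<pi> permutes ?R \<and> (\<forall>t\<in>set ts. traverses \<pi> t)}"
  proof -
    have tr: "traverses (perm_restrict \<pi> ?R) u \<longleftrightarrow> traverses \<pi> u" if "u \<in> set ts" for \<pi> u
    proof -
      have "set u \<subseteq> ?R" using disj[OF that] Cons.prems that by (auto simp: cycle_lists_def)
      then have "perm_restrict \<pi> ?R (u ! j) = \<pi> (u ! j)" if "j < length u" for j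
        using nth_mem[OF that] by (auto simp: perm_restrict_def)
      then show ?thesis by (simp add: traverses_def)
    qed
    let ?f = "\<lambda>\<pi>. perm_restrict \<pi> ?R"
    have bij: "bij_betw ?f {\<pi>. \<pi> permutes S \<and> traverses \<pi> t} {\<pi>. \<pi> permutes ?R}"
      by (rule perm_restrict_bij_betw[OF t])
    have "?f ` {\<pi>. \<pi> permutes S \<and> (\<forall>t\<in>set (t # ts). traverses \<pi> t)} =
        {\<pi>. \<pi> permutes ?R \<and> (\<forall>t\<in>set ts. traverses \<pi> t)}" (is "?f ` ?P = ?Q")
    proof
      show "?f ` ?P \<subseteq> ?Q" using bij tr by (auto simp: bij_betw_def)
      show "?Q \<subseteq> ?f ` ?P"
      proof
        fix \<rho> assume \<rho>: "\<rho> \<in> ?Q"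
        then obtain \<pi> where "\<pi> permutes S" "traverses \<pi> t" "\<rho> = ?f \<pi>"
          using bij by (auto simp: bij_betw_def)
        then show "\<rho> \<in> ?f ` ?P" using \<rho> tr by auto
      qed
    qed
    then show ?thesis by (intro bij_betw_subset[OF bij]) auto
  qed
  have "(\<Sum>\<pi> | \<pi> permutes S \<and> (\<forall>t\<in>set (t # ts). traverses \<pi> t). orbit_weight \<theta> S \<pi>) =
      (\<Sum>\<pi> | \<pi> permutes S \<and> (\<forall>t\<in>set (t # ts). traverses \<pi> t).
        \<theta> (length t) * orbit_weight \<theta> ?R (perm_restrict \<pi> ?R))"
    using Cons.prems by (intro sum.cong) (auto simp: orbit_weight_traverses)
  also have "\<dots> = \<theta> (length t) *
      (\<Sum>\<pi> | \<pi> permutes ?R \<and> (\<forall>t\<in>set ts. traverses \<pi> t). orbit_weight \<theta> ?R \<pi>)"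
    unfolding sum_distrib_left by (rule sum.reindex_bij_betw[OF bij])
  also have "\<dots> = \<theta> (length t) * (prod_list (map (\<lambda>t. \<theta> (length t)) ts) *
      total_weight \<theta> (?R - set (concat ts)))"
    using Cons.prems disj by (subst Cons.IH) (auto simp: cycle_lists_def)
  also have "?R - set (concat ts) = S - set (concat (t # ts))" by auto
  finally show ?case by (simp add: mult.assoc)
qed

text \<open>Together with \<open>distinct_if_concat\<close> this identifies two conditions on lists
  of cycles of one permutation: being different, which is what binomial coefficients count, and
  being disjoint, which is what the evaluation of the weights needs.\<close>

lemma distinct_concat_traverses:
  assumes "\<forall>t\<in>set ts. t \<in> cycle_lists S \<and> traverses \<pi> t" "distinct ts"
  shows "distinct (concat ts)"
  using assms
proof (induction ts)
  case (Cons t ts)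
  then have "set t \<inter> set u = {}" if "u \<in> set ts" for u
    using traverses_disjoint[of \<pi> t u S] that by auto
  then show ?case using Cons by (auto simp: cycle_lists_def)
qed simp

text \<open>The empty list could be repeated without a trace in \<open>concat ts\<close>.\<close>

lemma distinct_if_concat:
  assumes "distinct (concat ts)" "[] \<notin> set ts"
  shows "distinct ts"
  using assms
proof (induction ts)
  case (Cons t ts)
  have "t \<notin> set ts"
  proof
    assume "t \<in> set ts"
    then have "set t \<subseteq> set (concat ts)" by auto
    then show False using Cons.prems by (cases t) auto
  qed
  then show ?case using Cons by auto
qed simp


section \<open>Poisson limits from binomial moments\<close>

lemma choose_add_mult_fact:
  "real ((c + r) choose c) / fact (c + r) = 1 / (fact c * fact r)"
  by (simp add: binomial_fact field_simps)

text \<open>Inclusion-exclusion. For \<open>x \<ge> c\<close> the terms are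
  \<open>x choose c\<close> times an alternating row of Pascal's triangle, whose sum is 0 unless
  \<open>x = c\<close>. The number of nonzero terms depends on \<open>x\<close>, so an infinite
  series is the form that can be averaged over permutations.\<close>

lemma of_bool_eq_binomial_sums:
  fixes x c :: nat
  shows "(\<lambda>r. (- 1) ^ r * real ((c + r) choose c) * real (x choose (c + r))) sums of_bool (x = c)"
proof (cases "x < c")
  case True
  then show ?thesis using sums_zero by (simp add: binomial_eq_0)
next
  case False
  have eq: "(- 1) ^ r * real ((c + r) choose c) * real (x choose (c + r)) =
      real (x choose c) * ((- 1) ^ r * real ((x - c) choose r))" for r
  proof (cases "c + r \<le> x")
    case True
    then have "(x choose (c + r)) * ((c + r) choose c) = (x choose c) * ((x - c) choose r)"
      using choose_mult[of c "c + r" x] by simp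
    then have "real (x choose (c + r)) * real ((c + r) choose c) =
        real (x choose c) * real ((x - c) choose r)"
      by (simp flip: of_nat_mult)
    then show ?thesis by (simp add: mult_ac)
  next
    case False
    then have zero: "x choose (c + r) = 0" "(x - c) choose r = 0"
      using \<open>\<not> x < c\<close> by (auto simp: binomial_eq_0)
    show ?thesis unfolding zero by simp
  qed
  have "(\<lambda>r. (- 1) ^ r * real ((x - c) choose r)) sums
      (\<Sum>r\<le>x - c. (- 1) ^ r * real ((x - c) choose r))"
    by (rule sums_finite) (auto simp: binomial_eq_0)
  also have "(\<Sum>r\<le>x - c. (- 1) ^ r * real ((x - c) choose r)) = of_bool (x = c)"
    using False choose_alternating_sum[of "x - c", where 'a = real] by (cases "x = c") auto
  finally have "(\<lambda>r. real (x choose c) * ((- 1) ^ r * real ((x - c) choose r))) sums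
      (real (x choose c) * of_bool (x = c))"
    by (rule sums_mult)
  then show ?thesis unfolding eq by (cases "x = c") simp_all
qed

text \<open>\<open>a ^ r / fact r\<close> is the binomial moment of order \<open>r\<close> of a
  Poisson variable with mean \<open>a\<close>; the same alternating series returns its point
  probability at \<open>c\<close>.\<close>

lemma poisson_alternating_sums:
  fixes a :: real
  shows "(\<lambda>r. (- 1) ^ r * real ((c + r) choose c) * (a ^ (c + r) / fact (c + r))) sums
    (a ^ c / fact c * exp (- a))"
proof -
  have "(\<lambda>r. (- a) ^ r /\<^sub>R fact r) sums exp (- a)" by (rule exp_converges)
  then have "(\<lambda>r. a ^ c / fact c * ((- a) ^ r /\<^sub>R fact r)) sums (a ^ c / fact c * exp (- a))"
    by (rule sums_mult)
  moreover have "(- 1) ^ r * real ((c + r) choose c) * (a ^ (c + r) / fact (c + r)) =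
      a ^ c / fact c * ((- a) ^ r /\<^sub>R fact r)" for r
  proof -
    have "(- 1) ^ r * real ((c + r) choose c) * (a ^ (c + r) / fact (c + r)) =
        (- 1) ^ r * a ^ (c + r) * (real ((c + r) choose c) / fact (c + r))" by simp
    also have "\<dots> = a ^ c / fact c * ((- a) ^ r /\<^sub>R fact r)"
      unfolding choose_add_mult_fact power_minus[of a] by (simp add: power_add field_simps)
    finally show ?thesis .
  qed
  ultimately show ?thesis by simp
qed

text \<open>Binomial moments are inverted one coordinate at a time: in the intermediate quantities
  the coordinates below \<open>j\<close> already enter through indicators and the others still through
  binomial coefficients.\<close>

lemma poisson_limit_from_binomial_moments:
  fixes S :: "nat \<Rightarrow> 'p set" and p :: "nat \<Rightarrow> 'p \<Rightarrow> real" and X :: "nat \<Rightarrow> nat \<Rightarrow> 'p \<Rightarrow> nat"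
    and a b :: "nat \<Rightarrow> real"
  assumes p: "\<And>n \<pi>. n \<ge> n0 \<Longrightarrow> \<pi> \<in> S n \<Longrightarrow> p n \<pi> \<ge> 0"
    and lim: "\<And>r. (\<lambda>n. \<Sum>\<pi>\<in>S n. p n \<pi> * (\<Prod>i<L. real (X n i \<pi> choose r i)))
      \<longlonglongrightarrow> (\<Prod>i<L. a i ^ r i / fact (r i))"
    and b: "\<And>i. b i \<ge> 0"
    and bound: "\<And>n r. n \<ge> n0 \<Longrightarrow>
      (\<Sum>\<pi>\<in>S n. p n \<pi> * (\<Prod>i<L. real (X n i \<pi> choose r i))) \<le> C * (\<Prod>i<L. b i ^ r i / fact (r i))"
  shows "(\<lambda>n. \<Sum>\<pi>\<in>S n. p n \<pi> * of_bool (\<forall>i<L. X n i \<pi> = c i))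
    \<longlonglongrightarrow> (\<Prod>i<L. a i ^ c i / fact (c i) * exp (- a i))"
proof -
  define \<phi> where "\<phi> j r n i \<pi> =
    (if i < j then of_bool (X n i \<pi> = c i) else real (X n i \<pi> choose r i))" for j n i \<pi> and r :: "nat \<Rightarrow> nat"
  define Z where "Z j r n = (\<Sum>\<pi>\<in>S n. p n \<pi> * (\<Prod>i<L. \<phi> j r n i \<pi>))" for j r n
  define l where "l j r i = (if i < j then a i ^ c i / fact (c i) * exp (- a i) else a i ^ r i / fact (r i))"
    for j i and r :: "nat \<Rightarrow> nat"
  have "Z j r \<longlonglongrightarrow> (\<Prod>i<L. l j r i)" if "j \<le> L" for j r
    using that
  proof (induction j arbitrary: r)
    case 0
    then show ?case using lim[of r] by (simp add: Z_def \<phi>_def l_def)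
  next
    case (Suc j)
    then have j: "j < L" by simp
    define k where "k q = (- 1) ^ q * real ((c j + q) choose c j)" for q
    define r' where "r' q = r(j := c j + q)" for q
    have split: "(\<Prod>i<L. f i) = f j * (\<Prod>i\<in>{..<L} - {j}. f i)" for f :: "nat \<Rightarrow> real"
      using j by (subst prod.remove[of _ j]) auto
    have "(\<lambda>q. k q * Z j (r' q) n) sums Z (Suc j) r n" for n
    proof -
      have 1: "(\<lambda>q. k q * (\<Prod>i<L. \<phi> j (r' q) n i \<pi>)) sums (\<Prod>i<L. \<phi> (Suc j) r n i \<pi>)" for \<pi>
      proof -
        have "(\<Prod>i<L. \<phi> j (r' q) n i \<pi>) =
            real (X n j \<pi> choose (c j + q)) * (\<Prod>i\<in>{..<L} - {j}. \<phi> (Suc j) r n i \<pi>)" for q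
          unfolding split by (intro arg_cong2[of _ _ _ _ "(*)"] prod.cong) (auto simp: \<phi>_def r'_def)
        moreover have "(\<Prod>i<L. \<phi> (Suc j) r n i \<pi>) =
            of_bool (X n j \<pi> = c j) * (\<Prod>i\<in>{..<L} - {j}. \<phi> (Suc j) r n i \<pi>)"
          unfolding split by (simp add: \<phi>_def)
        ultimately show ?thesis
          using sums_mult2[OF of_bool_eq_binomial_sums[of "c j" "X n j \<pi>"]]
          by (simp add: k_def mult.assoc)
      qed
      have "(\<lambda>q. \<Sum>\<pi>\<in>S n. p n \<pi> * (k q * (\<Prod>i<L. \<phi> j (r' q) n i \<pi>))) sums Z (Suc j) r n"
        unfolding Z_def by (intro sums_sum sums_mult 1)
      then show ?thesis by (simp add: Z_def sum_distrib_left mult.left_commute)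
    qed
    then have Zs: "Z (Suc j) r n = (\<Sum>q. k q * Z j (r' q) n)" for n by (simp add: sums_iff)
    have "(\<lambda>q. k q * (\<Prod>i<L. l j (r' q) i)) sums (\<Prod>i<L. l (Suc j) r i)"
    proof -
      have "(\<Prod>i<L. l j (r' q) i) =
          a j ^ (c j + q) / fact (c j + q) * (\<Prod>i\<in>{..<L} - {j}. l (Suc j) r i)" for q
        unfolding split by (intro arg_cong2[of _ _ _ _ "(*)"] prod.cong) (auto simp: l_def r'_def)
      moreover have "(\<Prod>i<L. l (Suc j) r i) =
          a j ^ c j / fact (c j) * exp (- a j) * (\<Prod>i\<in>{..<L} - {j}. l (Suc j) r i)"
        unfolding split by (simp add: l_def)
      ultimately show ?thesis
        using sums_mult2[OF poisson_alternating_sums[of "c j" "a j"]]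
        by (simp add: k_def mult.assoc)
    qed
    then have ls: "(\<Prod>i<L. l (Suc j) r i) = (\<Sum>q. k q * (\<Prod>i<L. l j (r' q) i))" by (simp add: sums_iff)
    define K where "K = C * (\<Prod>i\<in>{..<L} - {j}. b i ^ (if i < j then 0 else r i) / fact (if i < j then 0 else r i))"
    \<comment> \<open>\<open>choose_add_mult_fact\<close> cancels the binomial coefficient in
      \<open>k q\<close> against the factorial of \<open>c j + q\<close>. What remains is an
      exponential series in \<open>q\<close>, hence summable.\<close>
    define B where "B q = b j ^ c j / fact (c j) * K * (b j ^ q /\<^sub>R fact q)" for q
    have "norm (k q * Z j (r' q) n) \<le> B q" if n: "n \<ge> n0" for q n
    proof -
      \<comment> \<open>For coordinates already turned into indicators the exponent 0 is used, as
        \<open>x choose 0 = 1\<close> dominates the indicator.\<close>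
      let ?r = "\<lambda>i. if i < j then 0 else r' q i"
      have "0 \<le> Z j (r' q) n"
        unfolding Z_def \<phi>_def using p[OF n] by (intro sum_nonneg mult_nonneg_nonneg prod_nonneg) auto
      moreover have "Z j (r' q) n \<le> (\<Sum>\<pi>\<in>S n. p n \<pi> * (\<Prod>i<L. real (X n i \<pi> choose ?r i)))"
        unfolding Z_def using p[OF n] by (intro sum_mono mult_left_mono prod_mono) (auto simp: \<phi>_def)
      ultimately have "\<bar>Z j (r' q) n\<bar> \<le> C * (\<Prod>i<L. b i ^ ?r i / fact (?r i))"
        using bound[OF n, of ?r] by simp
      also have "\<dots> = b j ^ (c j + q) / fact (c j + q) * K"
        unfolding split K_def by (simp add: r'_def mult_ac) (intro disjI2 prod.cong, auto simp: r'_def)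
      finally have "\<bar>k q\<bar> * \<bar>Z j (r' q) n\<bar> \<le> \<bar>k q\<bar> * (b j ^ (c j + q) / fact (c j + q) * K)"
        by (intro mult_left_mono) auto
      then have "norm (k q * Z j (r' q) n) \<le>
          real ((c j + q) choose c j) * (b j ^ (c j + q) / fact (c j + q) * K)"
        by (simp add: k_def abs_mult power_abs)
      also have "\<dots> = b j ^ (c j + q) * K * (real ((c j + q) choose c j) / fact (c j + q))" by simp
      also have "\<dots> = B q"
        unfolding choose_add_mult_fact B_def by (simp add: power_add field_simps)
      finally show ?thesis .
    qed
    then have "eventually (\<lambda>(q, n). norm (k q * Z j (r' q) n) \<le> B q) (at_top \<times>\<^sub>F sequentially)"
      by (auto simp: eventually_prod_sequentially)
    moreover have "summable B"
      unfolding B_def by (intro summable_mult summable_exp_generic)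
    moreover have "(\<lambda>n. k q * Z j (r' q) n) \<longlonglongrightarrow> k q * (\<Prod>i<L. l j (r' q) i)" for q
      using Suc by (intro tendsto_mult_left Suc.IH) simp
    ultimately have "(\<lambda>n. \<Sum>q. k q * Z j (r' q) n) \<longlonglongrightarrow> (\<Sum>q. k q * (\<Prod>i<L. l j (r' q) i))"
      by (intro tannerys_theorem[THEN conjunct2, THEN conjunct2]) auto
    then show ?case unfolding Zs[symmetric] ls[symmetric] by (simp add: Zs)
  qed
  from this[of L "\<lambda>_. 0"] have "Z L (\<lambda>_. 0) \<longlonglongrightarrow> (\<Prod>i<L. l L (\<lambda>_. 0) i)" by simp
  also have "(\<Prod>i<L. l L (\<lambda>_. 0) i) = (\<Prod>i<L. a i ^ c i / fact (c i) * exp (- a i))"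
    by (intro prod.cong) (auto simp: l_def)
  also have "Z L (\<lambda>_. 0) = (\<lambda>n. \<Sum>\<pi>\<in>S n. p n \<pi> * of_bool (\<forall>i<L. X n i \<pi> = c i))"
  proof
    fix n
    have "(\<Prod>i<L. \<phi> L (\<lambda>_. 0) n i \<pi>) = of_bool (\<forall>i<L. X n i \<pi> = c i)" for \<pi>
    proof -
      have "(\<Prod>i<L. \<phi> L (\<lambda>_. 0) n i \<pi>) = (\<Prod>i<L. of_bool (X n i \<pi> = c i))"
        by (intro prod.cong) (auto simp: \<phi>_def)
      then show ?thesis by (cases "\<forall>i<L. X n i \<pi> = c i") (auto simp: prod_zero_iff)
    qed
    then show "Z L (\<lambda>_. 0) n = (\<Sum>\<pi>\<in>S n. p n \<pi> * of_bool (\<forall>i<L. X n i \<pi> = c i))"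
      by (simp add: Z_def)
  qed
  finally show ?thesis .
qed


section \<open>Counting grid points\<close>

lemma card_Int_set_eq_count:
  assumes "list_all2 (\<lambda>t i. t \<in> A i) ts w" "distinct ts"
    and "\<And>i j. i \<noteq> j \<Longrightarrow> A i \<inter> A j = {}"
  shows "card (A i \<inter> set ts) = count_list w i"
  using assms(1,2)
proof (induction rule: list_all2_induct)
  case (Cons t ts j w)
  show ?case
  proof (cases "j = i")
    case True
    then have "A i \<inter> set (t # ts) = insert t (A i \<inter> set ts)" using Cons by auto
    then show ?thesis using True Cons by simp
  next
    case False
    then have "A i \<inter> set (t # ts) = A i \<inter> set ts" using assms(3)[OF False] Cons by auto
    then show ?thesis using False Cons by simp
  qed
qed simp

lemma finite_list_all2: "(\<And>i. i \<in> set w \<Longrightarrow> finite (A i)) \<Longrightarrow> finite {ts. list_all2 (\<lambda>t i. t \<in> A i) ts w}"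
proof (induction w)
  case (Cons i w)
  have "{ts. list_all2 (\<lambda>t i. t \<in> A i) ts (i # w)} \<subseteq>
      (\<lambda>(t, ts). t # ts) ` (A i \<times> {ts. list_all2 (\<lambda>t i. t \<in> A i) ts w})"
    by (auto simp: list_all2_Cons2)
  then show ?case using Cons by (meson finite_SigmaI finite_imageI finite_subset list.set_intros)
qed simp

lemma card_list_all2:
  "card {ts. list_all2 (\<lambda>t i. t \<in> A i) ts w} = prod_list (map (\<lambda>i. card (A i)) w)"
proof (induction w)
  case (Cons i w)
  have "{ts. list_all2 (\<lambda>t i. t \<in> A i) ts (i # w)} =
      (\<lambda>(t, ts). t # ts) ` (A i \<times> {ts. list_all2 (\<lambda>t i. t \<in> A i) ts w})"
    by (auto simp: list_all2_Cons2)
  then show ?case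
    using Cons by (simp add: card_image inj_on_def card_cartesian_product)
qed simp

lemma Suc_times_choose_Suc: "Suc k * (n choose Suc k) = (n - k) * (n choose k)"
  by (simp only: binomial_absorption binomial_absorb_comp)

text \<open>\<open>w\<close> is a word of cell indices, and \<open>ts\<close> picks one element of
  the named cell for each letter. As the cells are disjoint, a new letter \<open>j\<close> finds
  exactly \<open>count_list w j\<close> elements of \<open>A j\<close> taken. This builds up the
  falling factorials, written as a factorial times a binomial coefficient.\<close>

lemma card_distinct_list_all2:
  fixes A :: "nat \<Rightarrow> 'a set"
  assumes fin: "\<And>i. finite (A i)" and disj: "\<And>i j. i \<noteq> j \<Longrightarrow> A i \<inter> A j = {}"
    and w: "set w \<subseteq> {..<L}"
  shows "card {ts. list_all2 (\<lambda>t i. t \<in> A i) ts w \<and> distinct ts} =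
    (\<Prod>i<L. fact (count_list w i) * (card (A i) choose count_list w i))"
  using w
proof (induction w)
  case Nil
  have "{ts. list_all2 (\<lambda>t i. t \<in> A i) ts [] \<and> distinct ts} = {[]}" by auto
  then show ?case by simp
next
  case (Cons j w)
  let ?T = "\<lambda>w. {ts. list_all2 (\<lambda>t i. t \<in> A i) ts w \<and> distinct ts}"
  have finT: "finite (?T w)" for w
    by (rule finite_subset[OF _ finite_list_all2[of w A]]) (use fin in auto)
  have "?T (j # w) = (\<lambda>(ts, t). t # ts) ` (SIGMA ts:?T w. A j - set ts)"
    by (auto simp: list_all2_Cons2 image_iff)
  then have "card (?T (j # w)) = (\<Sum>ts\<in>?T w. card (A j - set ts))"
    using finT fin by (simp add: card_image inj_on_def)
  also have "\<dots> = (\<Sum>ts\<in>?T w. card (A j) - count_list w j)"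
  proof (rule sum.cong)
    fix ts assume "ts \<in> ?T w"
    then have "card (A j \<inter> set ts) = count_list w j"
      using disj by (intro card_Int_set_eq_count) auto
    moreover have "A j - set ts = A j - (A j \<inter> set ts)" by auto
    ultimately show "card (A j - set ts) = card (A j) - count_list w j"
      using fin by (metis Int_lower1 card_Diff_subset finite_Int)
  qed simp
  also have "\<dots> = (card (A j) - count_list w j) *
      (\<Prod>i<L. fact (count_list w i) * (card (A i) choose count_list w i))"
    using Cons by simp
  also have "\<dots> = (\<Prod>i<L. fact (count_list (j # w) i) * (card (A i) choose count_list (j # w) i))"
  proof -
    have j: "j \<in> {..<L}" using Cons.prems by simp
    have "(\<Prod>i\<in>{..<L} - {j}. fact (count_list (j # w) i) * (card (A i) choose count_list (j # w) i)) =
        (\<Prod>i\<in>{..<L} - {j}. fact (count_list w i) * (card (A i) choose count_list w i) :: nat)"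
      by (rule prod.cong) auto
    moreover have "fact (count_list (j # w) j) * (card (A j) choose count_list (j # w) j) =
        (card (A j) - count_list w j) * (fact (count_list w j) * (card (A j) choose count_list w j))"
      (is "fact ?c' * _ = _ * (fact ?c * _)")
    proof -
      have c': "?c' = Suc ?c" by simp
      have "fact (Suc ?c) * (card (A j) choose Suc ?c) = fact ?c * (Suc ?c * (card (A j) choose Suc ?c))"
        by (simp only: fact_Suc mult_ac of_nat_id)
      also have "\<dots> = (card (A j) - ?c) * (fact ?c * (card (A j) choose ?c))"
        by (simp only: Suc_times_choose_Suc mult.left_commute)
      finally show ?thesis unfolding c' .
    qed
    ultimately show ?thesis
      unfolding prod.remove[OF finite_lessThan[of L] j] by (simp only: mult.assoc)
  qed
  finally show ?case .
qed

definition distinct_lists :: "nat \<Rightarrow> nat \<Rightarrow> nat list set" where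
  "distinct_lists n s = {xs. length xs = s \<and> distinct xs \<and> set xs \<subseteq> {1..n}}"

lemma finite_distinct_lists: "finite (distinct_lists n s)"
  by (rule finite_subset[OF _ finite_lists_length_eq[of "{1..n}" s]]) (auto simp: distinct_lists_def)

lemma distinct_lists_eq_empty: "n < s \<Longrightarrow> distinct_lists n s = {}"
proof (rule equals0I)
  fix xs assume "n < s" "xs \<in> distinct_lists n s"
  then have "card (set xs) = s" "set xs \<subseteq> {1..n}"
    by (simp_all add: distinct_lists_def distinct_card)
  then show False using \<open>n < s\<close> card_mono[of "{1..n}" "set xs"] by simp
qed

lemma fact_div_fact_eq_prod:
  "s \<le> n \<Longrightarrow> fact n / fact (n - s) = (\<Prod>i<s. real n - real i)"
proof (induction s)
  case (Suc s)
  then have "(fact (n - s) :: real) = (real n - real s) * fact (n - Suc s)"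
    by (metis Suc_diff_Suc Suc_le_lessD fact_Suc of_nat_diff Suc_leD)
  with Suc show ?case by (simp add: field_simps)
qed simp

lemma card_distinct_lists: "s \<le> n \<Longrightarrow> real (card (distinct_lists n s)) = fact n / fact (n - s)"
proof -
  assume s: "s \<le> n"
  have "card (distinct_lists n s) = \<Prod>{n - s + 1..n}"
    unfolding distinct_lists_def using s card_lists_distinct_length_eq[of "{1..n}" s] by simp
  moreover have "fact n = fact (n - s) * (\<Prod>{n - s + 1..n} :: nat)"
    unfolding fact_prod using prod.ub_add_nat[of 1 "n - s" "\<lambda>i. i" s] s by simp
  ultimately have "fact n = fact (n - s) * card (distinct_lists n s)" by simp
  then have "(fact n :: real) = fact (n - s) * real (card (distinct_lists n s))"
    by (metis of_nat_fact of_nat_mult)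
  then show ?thesis by simp
qed

text \<open>This makes collisions between the entries of different cycles negligible in the
  limit.\<close>

lemma card_distinct_lists_asymp: "(\<lambda>n. real (card (distinct_lists n s)) / real n ^ s) \<longlonglongrightarrow> 1"
proof -
  have "(\<lambda>n. \<Prod>i<s. 1 - real i / real n) \<longlonglongrightarrow> (\<Prod>i<s. 1 - 0)"
    by (intro tendsto_prod tendsto_diff tendsto_const lim_const_over_n)
  moreover have "eventually (\<lambda>n. (\<Prod>i<s. 1 - real i / real n) = real (card (distinct_lists n s)) / real n ^ s)
      sequentially"
    using eventually_ge_at_top[of "max 1 s"]
  proof eventually_elim
    case (elim n)
    have "(\<Prod>i<s. 1 - real i / real n) = (\<Prod>i<s. (real n - real i) / real n)"
      using elim by (intro prod.cong) (auto simp: field_simps)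
    also have "\<dots> = (\<Prod>i<s. real n - real i) / real n ^ s" by (simp add: prod_dividef)
    finally show ?case using elim by (simp add: card_distinct_lists fact_div_fact_eq_prod)
  qed
  ultimately have "(\<lambda>n. real (card (distinct_lists n s)) / real n ^ s) \<longlonglongrightarrow> (\<Prod>i<s. 1 - 0)"
    by (rule Lim_transform_eventually)
  then show ?thesis by simp
qed

section \<open>Concatenations without repeated entries\<close>

context
  fixes A :: "nat \<Rightarrow> nat list set" and k :: "nat \<Rightarrow> nat" and n :: nat and w :: "nat list" and s :: nat
  assumes A: "\<And>i t. i \<in> set w \<Longrightarrow> t \<in> A i \<Longrightarrow> length t = k i \<and> set t \<subseteq> {1..n}"
  defines "s \<equiv> sum_list (map k w)"
begin

lemma list_all2_concat:
  assumes "list_all2 (\<lambda>t i. t \<in> A i) ts w"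
  shows "map length ts = map k w" "length (concat ts) = s" "set (concat ts) \<subseteq> {1..n}"
proof -
  show *: "map length ts = map k w"
    using assms A by (auto simp: list_eq_iff_nth_eq list_all2_conv_all_nth)
  show "length (concat ts) = s" by (simp add: length_concat * s_def)
  show "set (concat ts) \<subseteq> {1..n}"
  proof
    fix x assume "x \<in> set (concat ts)"
    then obtain j where j: "j < length ts" "x \<in> set (ts ! j)" by (auto simp: in_set_conv_nth[of _ ts])
    then have "w ! j \<in> set w" "ts ! j \<in> A (w ! j)"
      using assms by (auto simp: list_all2_conv_all_nth)
    then show "x \<in> {1..n}" using A[of "w ! j" "ts ! j"] j(2) by blast
  qed
qed

text \<open>The word \<open>w\<close> prescribes the block lengths, so a concatenation can be cut in
  one way only.\<close>

lemma inj_on_concat: "inj_on concat {ts. list_all2 (\<lambda>t i. t \<in> A i) ts w}"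
proof (rule inj_onI)
  fix ts us assume *: "ts \<in> {ts. list_all2 (\<lambda>t i. t \<in> A i) ts w}" "us \<in> {ts. list_all2 (\<lambda>t i. t \<in> A i) ts w}"
    and eq: "concat ts = concat us"
  have m: "map length ts = map length us" using list_all2_concat(1) * by simp
  from m have "length ts = length us" by (rule map_eq_imp_length_eq)
  moreover have "\<forall>(x, y)\<in>set (zip ts us). length x = length y"
    using m by (auto simp: set_zip list_eq_iff_nth_eq)
  ultimately show "ts = us" using eq by (intro concat_injective)
qed

lemma card_distinct_concat_le:
  "card {ts. list_all2 (\<lambda>t i. t \<in> A i) ts w \<and> distinct (concat ts)} \<le> card (distinct_lists n s)"
proof (rule card_inj_on_le[of concat])
  show "inj_on concat {ts. list_all2 (\<lambda>t i. t \<in> A i) ts w \<and> distinct (concat ts)}"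
    by (rule inj_on_subset[OF inj_on_concat]) auto
  show "concat ` {ts. list_all2 (\<lambda>t i. t \<in> A i) ts w \<and> distinct (concat ts)} \<subseteq> distinct_lists n s"
    using list_all2_concat(2,3) unfolding distinct_lists_def by blast
qed (rule finite_distinct_lists)

text \<open>Lists whose concatenation repeats an entry inject into the words of length
  \<open>s\<close> over \<open>{1..n}\<close> with a repetition. The number of these words does not
  involve the sets \<open>A i\<close>, so the error bound is the same for all cells.\<close>

lemma card_distinct_concat_close:
  "\<bar>real (card {ts. list_all2 (\<lambda>t i. t \<in> A i) ts w \<and> distinct (concat ts)}) -
     prod_list (map (\<lambda>i. real (card (A i))) w)\<bar> \<le> real n ^ s - real (card (distinct_lists n s))"
proof -
  let ?T = "{ts. list_all2 (\<lambda>t i. t \<in> A i) ts w}" and ?D = "{ts. distinct (concat ts)}"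
  let ?E = "{xs. set xs \<subseteq> {1..n} \<and> length xs = s}"
  have finA: "finite (A i)" if "i \<in> set w" for i
    by (rule finite_subset[OF _ finite_lists_length_eq[of "{1..n}" "k i"]]) (use A that in auto)
  have finT: "finite ?T" using finA by (rule finite_list_all2)
  have finE: "finite ?E" by (rule finite_lists_length_eq) simp
  have "card (?T - ?D) \<le> card (?E - distinct_lists n s)"
  proof (rule card_inj_on_le[of concat])
    show "inj_on concat (?T - ?D)" by (rule inj_on_subset[OF inj_on_concat]) auto
    show "concat ` (?T - ?D) \<subseteq> ?E - distinct_lists n s"
      using list_all2_concat(2,3) unfolding distinct_lists_def by blast
  qed (use finE in simp)
  also have "\<dots> = card ?E - card (distinct_lists n s)"
    by (rule card_Diff_subset[OF finite_distinct_lists]) (unfold distinct_lists_def, blast)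
  also have "card ?E = n ^ s" by (simp add: card_lists_length_eq)
  finally have 1: "card (?T - ?D) \<le> n ^ s - card (distinct_lists n s)" .
  have 2: "card (distinct_lists n s) \<le> n ^ s"
  proof -
    have "card (distinct_lists n s) \<le> card ?E"
      by (rule card_mono[OF finE]) (auto simp: distinct_lists_def)
    then show ?thesis by (simp add: card_lists_length_eq)
  qed
  have "card ?T = card (?T \<inter> ?D) + card (?T - ?D)"
    using finT by (subst Int_Diff_Un[of ?T ?D, symmetric], intro card_Un_disjoint) auto
  moreover have "real (card ?T) = prod_list (map (\<lambda>i. real (card (A i))) w)"
    unfolding card_list_all2 by (induction w) auto
  moreover have "?T \<inter> ?D = {ts. list_all2 (\<lambda>t i. t \<in> A i) ts w \<and> distinct (concat ts)}" by auto
  moreover have "real (card (?T - ?D)) \<le> real n ^ s - real (card (distinct_lists n s))"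
    using of_nat_mono[OF 1, where 'a = real] unfolding of_nat_diff[OF 2] by simp
  ultimately show ?thesis by (simp only: of_nat_add)
qed

end

section \<open>Riemann sums for the volume of a set in one cell of the state space\<close>

lemma cycle_cell_iff:
  assumes "k \<ge> 1"
  shows "xs \<in> cycle_cell k \<longleftrightarrow> length xs = k \<and> (\<forall>i<k. 0 \<le> xs ! i \<and> xs ! i \<le> 1 \<and> xs ! 0 \<le> xs ! i)"
proof (cases "length xs = k")
  case True
  then have ne: "xs \<noteq> []" using assms by auto
  have "Min (set xs) = hd xs \<longleftrightarrow> (\<forall>x\<in>set xs. hd xs \<le> x)"
    using ne by (subst Min_eq_iff) auto
  then show ?thesis
    using True ne by (auto simp: cycle_cell_def hd_conv_nth all_set_conv_all_nth subset_iff in_set_conv_nth)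
qed (auto simp: cycle_cell_def)

lemma cycle_cell_subset_space: "k \<ge> 1 \<Longrightarrow> cycle_cell k \<subseteq> cycle_space"
  by (auto simp: cycle_space_def)

lemma cycle_space_iff:
  "xs \<in> cycle_space \<longleftrightarrow> xs \<noteq> [] \<and> (\<forall>i<length xs. 0 \<le> xs ! i \<and> xs ! i \<le> 1 \<and> xs ! 0 \<le> xs ! i)"
proof -
  have "xs \<in> cycle_space \<longleftrightarrow> length xs \<ge> 1 \<and> xs \<in> cycle_cell (length xs)"
    by (auto simp: cycle_space_def cycle_cell_def)
  then show ?thesis using cycle_cell_iff[of "length xs" xs] by (cases xs) auto
qed

abbreviation product_lborel :: "nat \<Rightarrow> (nat \<Rightarrow> real) measure" where
  "product_lborel k \<equiv> \<Pi>\<^sub>M i\<in>{..<k}. (lborel :: real measure)"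

abbreviation cell_section :: "nat \<Rightarrow> real list set \<Rightarrow> (nat \<Rightarrow> real) set" where
  "cell_section k B \<equiv> {x \<in> space (product_lborel k). map x [0..<k] \<in> B}"

interpretation product_sigma_finite "\<lambda>_::nat. lborel :: real measure" ..

abbreviation rescale :: "nat \<Rightarrow> nat list \<Rightarrow> real list" where
  "rescale n \<equiv> map (\<lambda>i. real i / real n)"

text \<open>Tuples with repeated entries are included, so the count is a genuine Riemann sum over
  the grid; distinctness is imposed later, on concatenations.\<close>

definition grid_points :: "nat \<Rightarrow> real list set \<Rightarrow> nat list set" where
  "grid_points n B = {t. set t \<subseteq> {1..n} \<and> rescale n t \<in> B}"

lemma measure_product_box:
  assumes "\<And>i. i < k \<Longrightarrow> l i \<le> u i"
  shows "emeasure (product_lborel k) (\<Pi>\<^sub>E i\<in>{..<k}. {l i<..u i}) = ennreal (\<Prod>i<k. u i - l i)"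
    and "measure (product_lborel k) (\<Pi>\<^sub>E i\<in>{..<k}. {l i<..u i}) = (\<Prod>i<k. u i - l i)"
proof -
  have "emeasure (product_lborel k) (\<Pi>\<^sub>E i\<in>{..<k}. {l i<..u i}) = (\<Prod>i<k. emeasure lborel {l i<..u i})"
    by (rule emeasure_PiM) auto
  also have "\<dots> = (\<Prod>i<k. ennreal (u i - l i))" using assms by (intro prod.cong) auto
  also have "\<dots> = ennreal (\<Prod>i<k. u i - l i)" using assms by (intro prod_ennreal) auto
  finally show *: "emeasure (product_lborel k) (\<Pi>\<^sub>E i\<in>{..<k}. {l i<..u i}) = ennreal (\<Prod>i<k. u i - l i)" .
  show "measure (product_lborel k) (\<Pi>\<^sub>E i\<in>{..<k}. {l i<..u i}) = (\<Prod>i<k. u i - l i)"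
    unfolding measure_def * by (rule enn2real_ennreal) (use assms in \<open>auto intro!: prod_nonneg\<close>)
qed

text \<open>The other factors are infinite, and \<open>0 * \<infinity> = 0\<close> in
  \<open>ennreal\<close>. For \<open>a = 0\<close> this disposes of the faces of the cube that
  half-open boxes miss.\<close>

lemma emeasure_coordinate_hyperplane:
  assumes "j < k"
  shows "emeasure (product_lborel k) (\<Pi>\<^sub>E i\<in>{..<k}. if i = j then {a} else UNIV) = 0"
proof -
  have "emeasure (product_lborel k) (\<Pi>\<^sub>E i\<in>{..<k}. if i = j then {a} else UNIV) =
      (\<Prod>i<k. emeasure lborel (if i = j then {a} else UNIV))"
    by (rule emeasure_PiM) auto
  also have "\<dots> = 0" using assms by (intro prod_zero) auto
  finally show ?thesis .
qed

lemma ceiling_grid_bounds: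
  assumes "n \<ge> 1"
  shows "x \<le> real_of_int \<lceil>real n * x\<rceil> / real n" "real_of_int \<lceil>real n * x\<rceil> / real n < x + 1 / real n"
  using assms ceiling_correct[of "real n * x"] by (auto simp: field_simps)

lemma ceiling_grid_tendsto: "(\<lambda>n. real_of_int \<lceil>real n * x\<rceil> / real n) \<longlonglongrightarrow> x"
proof (rule tendsto_sandwich)
  show "\<forall>\<^sub>F n in sequentially. x \<le> real_of_int \<lceil>real n * x\<rceil> / real n"
    using eventually_ge_at_top[of 1] by eventually_elim (rule ceiling_grid_bounds)
  show "\<forall>\<^sub>F n in sequentially. real_of_int \<lceil>real n * x\<rceil> / real n \<le> x + 1 / real n"
    using eventually_ge_at_top[of 1] by eventually_elim (rule less_imp_le, rule ceiling_grid_bounds)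
  have "(\<lambda>n. x + 1 / real n) \<longlonglongrightarrow> x + 0" by (intro tendsto_add tendsto_const lim_1_over_n)
  then show "(\<lambda>n. x + 1 / real n) \<longlonglongrightarrow> x" by simp
qed simp

text \<open>Rounding up to the grid moves a point to the right. The hypothesis \<open>stable\<close> therefore holds at
  every point, and not just almost everywhere, as soon as \<open>B\<close> is cut out by half-open conditions
  \<open>l \<le> x\<^sub>i < u\<close> and by order relations between the coordinates.\<close>

lemma card_grid_points_tendsto:
  assumes k: "k \<ge> 1" and B: "B \<in> sets cycle_borel" "B \<subseteq> cycle_cell k"
    and stable: "\<And>x. (\<And>i. i < k \<Longrightarrow> 0 < x i \<and> x i \<le> 1) \<Longrightarrow>
      \<forall>\<^sub>F n in sequentially.
        map (\<lambda>i. real_of_int \<lceil>real n * x i\<rceil> / real n) [0..<k] \<in> B \<longleftrightarrow> map x [0..<k] \<in> B"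
  shows "(\<lambda>n. real (card (grid_points n B)) / real n ^ k) \<longlonglongrightarrow>
    measure (product_lborel k) (cell_section k B)"
    and "emeasure (product_lborel k) (cell_section k B) < \<infinity>"
proof -
  let ?L = "product_lborel k"
  define D where "D = cell_section k B"
  define U where "U = (\<Pi>\<^sub>E i\<in>{..<k}. {0::real<..1})"
  \<comment> \<open>The half-open cube of side \<open>1 / n\<close> with upper corner
    \<open>rescale n t\<close>. The entries of a grid point are at least 1, so the subtraction of
    natural numbers is exact.\<close>
  define box where "box n t = (\<Pi>\<^sub>E i\<in>{..<k}. {real (t ! i - 1) / real n<..real (t ! i) / real n})" for n and t :: "nat list"
  have D: "D \<in> sets ?L"
  proof -
    obtain j where j: "k = Suc j" using k by (cases k) auto
    show ?thesis
      using cell_lebesgue_measurable[OF B(1), of j] unfolding j[symmetric] Int_absorb2[OF B(2)] D_def .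
  qed
  have U: "U \<in> sets ?L" "emeasure ?L U = 1"
    unfolding U_def by (auto simp: measure_product_box)
  \<comment> \<open>\<open>B\<close> may contain points with a zero coordinate, which no box covers;
    they form a null set.\<close>
  have DU: "AE x in ?L. x \<in> D \<longleftrightarrow> x \<in> U \<inter> D"
  proof (rule AE_I')
    let ?H = "\<lambda>j. \<Pi>\<^sub>E i\<in>{..<k}. if i = j then {0::real} else UNIV"
    show "{x \<in> space ?L. \<not> (x \<in> D \<longleftrightarrow> x \<in> U \<inter> D)} \<subseteq> (\<Union>j<k. ?H j)"
    proof
      fix x assume "x \<in> {x \<in> space ?L. \<not> (x \<in> D \<longleftrightarrow> x \<in> U \<inter> D)}"
      then have x: "x \<in> space ?L" "map x [0..<k] \<in> cycle_cell k" "x \<notin> U"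
        using B by (auto simp: D_def)
      then obtain j where j: "j < k" "\<not> (0 < x j \<and> x j \<le> 1)"
        by (auto simp: U_def space_PiM PiE_iff)
      then have "x j = 0" using x(2) k by (fastforce simp: cycle_cell_iff)
      then show "x \<in> (\<Union>j<k. ?H j)" using j(1) x(1) by (auto simp: space_PiM PiE_iff)
    qed
    have "?H j \<in> null_sets ?L" if "j < k" for j
      using emeasure_coordinate_hyperplane[OF that, of 0] by (intro null_setsI) (auto intro!: sets_PiM_I_finite)
    then show "(\<Union>j<k. ?H j) \<in> null_sets ?L" by (intro null_sets_UN') auto
  qed
  have eD: "emeasure ?L D = emeasure ?L (U \<inter> D)"
    using DU D U by (intro emeasure_eq_AE) auto
  have mD: "measure ?L D = measure ?L (U \<inter> D)" by (simp add: measure_def eD)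
  have "emeasure ?L (U \<inter> D) \<le> emeasure ?L U" using U by (intro emeasure_mono) auto
  then show "emeasure ?L (cell_section k B) < \<infinity>"
    using eD U by (simp add: D_def[symmetric]) (metis ennreal_one_less_top le_less_trans)
  \<comment> \<open>The normalized count is the integral of this step function. On \<open>U\<close>
    the value of \<open>f n\<close> is the indicator of \<open>B\<close> at the point rounded up to
    the grid, so \<open>stable\<close> gives the pointwise limit and the indicator of
    \<open>U\<close> is a majorant.\<close>
  define f where "f n x = (\<Sum>t\<in>grid_points n B. indicat_real (box n t) x)" for n x
  have finG: "finite (grid_points n B)" for n
    by (rule finite_subset[OF _ finite_lists_length_eq[of "{1..n}" k]])
       (use B in \<open>auto simp: grid_points_def cycle_cell_def\<close>)
  have lenG: "length t = k" "set t \<subseteq> {1..n}" if "t \<in> grid_points n B" for t n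
  proof -
    show "set t \<subseteq> {1..n}" using that by (simp add: grid_points_def)
    have "rescale n t \<in> cycle_cell k" using that B by (auto simp: grid_points_def)
    then show "length t = k" by (simp add: cycle_cell_def)
  qed
  have box: "measure ?L (box n t) = 1 / real n ^ k" "emeasure ?L (box n t) < \<infinity>" "box n t \<in> sets ?L"
    if t: "t \<in> grid_points n B" for n t
  proof -
    have "t ! i \<in> {1..n}" if "i < k" for i using lenG[OF t] that nth_mem[of i t] by blast
    then have *: "real (t ! i) / real n - real (t ! i - 1) / real n = 1 / real n" if "i < k" for i
      using that by (force simp: of_nat_diff field_simps)
    have le: "real (t ! i - 1) / real n \<le> real (t ! i) / real n" for i
      by (intro divide_right_mono) auto
    show "measure ?L (box n t) = 1 / real n ^ k"
    proof -
      have "measure ?L (box n t) = (\<Prod>i<k. real (t ! i) / real n - real (t ! i - 1) / real n)"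
        unfolding box_def by (rule measure_product_box[OF le])
      also have "\<dots> = (\<Prod>i<k. 1 / real n)" by (rule prod.cong[OF refl]) (simp only: * lessThan_iff)
      finally show ?thesis by (simp add: power_one_over)
    qed
    show "emeasure ?L (box n t) < \<infinity>" unfolding box_def by (subst measure_product_box(1)[OF le]) simp
    show "box n t \<in> sets ?L" unfolding box_def by auto
  qed
  have int_f: "integral\<^sup>L ?L (f n) = real (card (grid_points n B)) / real n ^ k" for n
    unfolding f_def using box by (subst Bochner_Integration.integral_sum) auto
  have f_outside: "f n x = 0" if "x \<in> space ?L" "x \<notin> U" for n x
  proof -
    have "x \<notin> box n t" if t: "t \<in> grid_points n B" for t
    proof
      assume x: "x \<in> box n t"
      have "0 < x i \<and> x i \<le> 1" if i: "i < k" for i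
      proof -
        have "real (t ! i - 1) / real n < x i" "x i \<le> real (t ! i) / real n" using x i by (auto simp: box_def PiE_iff)
        moreover have "t ! i \<in> {1..n}" using lenG[OF t] i nth_mem[of i t] by blast
        then have "real (t ! i) / real n \<le> 1" by (auto simp: divide_le_eq)
        moreover have "0 \<le> real (t ! i - 1) / real n" by simp
        ultimately show ?thesis by linarith
      qed
      then show False using that \<open>x \<notin> U\<close> \<open>x \<in> space ?L\<close> by (auto simp: U_def PiE_iff space_PiM)
    qed
    then show ?thesis by (simp add: f_def)
  qed
  have f_inside: "f n x = indicat_real B (map (\<lambda>i. real_of_int \<lceil>real n * x i\<rceil> / real n) [0..<k])"
    if x: "x \<in> U" and n: "n \<ge> 1" for n x
  proof -
    \<comment> \<open>In rescaled form the upper corner of the only box of side \<open>1 / n\<close>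
      that contains \<open>x\<close>.\<close>
    define t where "t = map (\<lambda>i. nat \<lceil>real n * x i\<rceil>) [0..<k]"
    have xi: "0 < x i" "x i \<le> 1" if "i < k" for i using x that by (auto simp: U_def PiE_iff)
    have pos: "0 < \<lceil>real n * x i\<rceil>" "\<lceil>real n * x i\<rceil> \<le> int n" if "i < k" for i
    proof -
      show "0 < \<lceil>real n * x i\<rceil>" using xi(1)[OF that] n by simp
      show "\<lceil>real n * x i\<rceil> \<le> int n" using xi(2)[OF that] n by (simp add: ceiling_le_iff mult_left_le)
    qed
    have setT: "set t \<subseteq> {1..n}" 
    proof
      fix j assume "j \<in> set t"
      then obtain i where "i < k" "j = nat \<lceil>real n * x i\<rceil>" by (auto simp: t_def)
      then show "j \<in> {1..n}" using pos[of i] by simp linarith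
    qed
    have scaled: "rescale n t = map (\<lambda>i. real_of_int \<lceil>real n * x i\<rceil> / real n) [0..<k]"
      using pos by (auto simp: t_def less_imp_le)
    have uniq: "x \<in> box n u \<longleftrightarrow> u = t" if u: "u \<in> grid_points n B" for u
    proof -
      have ui: "u ! i \<in> {1..n}" if "i < k" for i using lenG[OF u] that nth_mem[of i u] by blast
      have "real (u ! i - 1) / real n < x i \<and> x i \<le> real (u ! i) / real n \<longleftrightarrow> u ! i = nat \<lceil>real n * x i\<rceil>"
        if i: "i < k" for i
      proof -
        have "real (u ! i - 1) / real n < x i \<and> x i \<le> real (u ! i) / real n \<longleftrightarrow>
            real_of_int (int (u ! i)) - 1 < real n * x i \<and> real n * x i \<le> real_of_int (int (u ! i))"
          using n ui[OF i] by (auto simp: of_nat_diff field_simps)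
        also have "\<dots> \<longleftrightarrow> \<lceil>real n * x i\<rceil> = int (u ! i)" by (auto simp: ceiling_eq_iff)
        also have "\<dots> \<longleftrightarrow> u ! i = nat \<lceil>real n * x i\<rceil>" using pos[OF i] by auto
        finally show ?thesis .
      qed
      moreover have "x \<in> box n u \<longleftrightarrow> (\<forall>i<k. real (u ! i - 1) / real n < x i \<and> x i \<le> real (u ! i) / real n)"
        using x by (auto simp: box_def U_def PiE_iff)
      ultimately show ?thesis using lenG[OF u] by (auto simp: t_def list_eq_iff_nth_eq)
    qed
    have "f n x = (\<Sum>u\<in>grid_points n B. if u = t then 1 else 0)"
      unfolding f_def by (rule sum.cong) (auto simp: uniq)
    also have "\<dots> = (if t \<in> grid_points n B then 1 else 0)" using finG by (simp add: sum.delta')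
    also have "\<dots> = indicat_real B (rescale n t)" using setT by (simp add: grid_points_def)
    finally show ?thesis unfolding scaled .
  qed
  have "(\<lambda>n. integral\<^sup>L ?L (f n)) \<longlonglongrightarrow> integral\<^sup>L ?L (indicat_real (U \<inter> D))"
  proof (rule integral_dominated_convergence[where w = "indicat_real U"])
    show "f n \<in> borel_measurable ?L" for n
      unfolding f_def using box(3) by (intro borel_measurable_sum borel_measurable_indicator) auto
    show "integrable ?L (indicat_real U)" using U by simp
    show "AE x in ?L. (\<lambda>n. f n x) \<longlonglongrightarrow> indicat_real (U \<inter> D) x"
    proof (rule AE_I2)
      fix x assume x: "x \<in> space ?L"
      show "(\<lambda>n. f n x) \<longlonglongrightarrow> indicat_real (U \<inter> D) x"
      proof (cases "x \<in> U")
        case True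
        then have xi: "0 < x i \<and> x i \<le> 1" if "i < k" for i using that by (auto simp: U_def PiE_iff)
        have stable_x: "\<forall>\<^sub>F n in sequentially.
            map (\<lambda>i. real_of_int \<lceil>real n * x i\<rceil> / real n) [0..<k] \<in> B \<longleftrightarrow> map x [0..<k] \<in> B"
          by (rule stable) (rule xi)
        have "\<forall>\<^sub>F n in sequentially. f n x = indicat_real (U \<inter> D) x"
          using stable_x eventually_ge_at_top[of 1]
        proof eventually_elim
          case (elim n)
          then show ?case using True x by (simp add: f_inside D_def indicator_def)
        qed
        then show ?thesis by (rule tendsto_eventually)
      qed (simp add: f_outside x)
    qed
    show "AE x in ?L. norm (f n x) \<le> indicat_real U x" for n
    proof (rule AE_I2)
      fix x assume x: "x \<in> space ?L"
      show "norm (f n x) \<le> indicat_real U x"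
      proof (cases "x \<in> U")
        case True
        show ?thesis
        proof (cases "n \<ge> 1")
          case False
          then have "grid_points n B = {}" using lenG[of _ n] k by force
          then show ?thesis by (simp add: f_def)
        qed (use True in \<open>simp add: f_inside indicator_def\<close>)
      qed (simp add: f_outside x)
    qed
  qed (use U D in auto)
  moreover have "integral\<^sup>L ?L (indicat_real (U \<inter> D)) = measure ?L D"
    using mD U D sets.sets_into_space by (simp add: Int_absorb2)
  ultimately show "(\<lambda>n. real (card (grid_points n B)) / real n ^ k) \<longlonglongrightarrow>
      measure ?L (cell_section k B)"
    by (simp add: int_f D_def)
qed

lemma measure_cycle_intensity_cell:
  assumes k: "k \<ge> 1" and B: "B \<in> sets cycle_borel" "B \<subseteq> cycle_cell k" and \<theta>: "\<theta> k \<ge> 0"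
  shows "emeasure (cycle_intensity \<theta>) B =
      ennreal (\<theta> k) * emeasure (product_lborel k) (cell_section k B)"
    and "measure (cycle_intensity \<theta>) B =
      \<theta> k * measure (product_lborel k) (cell_section k B)"
proof -
  \<comment> \<open>The series in \<open>cycle_intensity\<close> starts at index 0, so length
    \<open>k\<close> belongs to the summand \<open>k - 1\<close>.\<close>
  have "ennreal (\<theta> (Suc j)) * cell_lebesgue (Suc j) (B \<inter> cycle_cell (Suc j)) =
      (if j = k - 1 then ennreal (\<theta> k) * cell_lebesgue k B else 0)" for j
  proof (cases "Suc j = k")
    case True
    then show ?thesis using B by (auto simp: Int_absorb2)
  next
    case False
    then have "B \<inter> cycle_cell (Suc j) = {}" using B by (auto simp: cycle_cell_def)
    then show ?thesis using False k by (auto simp: cell_lebesgue_def)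
  qed
  then have "emeasure (cycle_intensity \<theta>) B =
      (\<Sum>j. if j = k - 1 then ennreal (\<theta> k) * cell_lebesgue k B else 0)"
    by (simp add: emeasure_cycle_intensity[OF B(1)])
  also have "\<dots> = ennreal (\<theta> k) * cell_lebesgue k B"
    by (subst suminf_finite[of "{k - 1}"]) auto
  finally show *: "emeasure (cycle_intensity \<theta>) B =
      ennreal (\<theta> k) * emeasure (product_lborel k) (cell_section k B)"
    by (simp add: cell_lebesgue_def Let_def)
  show "measure (cycle_intensity \<theta>) B =
      \<theta> k * measure (product_lborel k) (cell_section k B)"
    unfolding measure_def * using \<theta> by (simp add: enn2real_mult)
qed


section \<open>Joint limit of cell counts\<close>

definition cell_count :: "nat \<Rightarrow> real list set \<Rightarrow> (nat \<Rightarrow> nat) \<Rightarrow> nat" where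
  "cell_count n B \<pi> = card {t \<in> cycle_tuples n \<pi>. rescale n t \<in> B}"

definition permutation_prob :: "(nat \<Rightarrow> real) \<Rightarrow> nat \<Rightarrow> (nat \<Rightarrow> nat) \<Rightarrow> real" where
  "permutation_prob \<theta> n \<pi> = cycle_weight \<theta> n \<pi> / (cycle_norm \<theta> n * fact n)"

abbreviation binomial_mean ::
    "(nat \<Rightarrow> real) \<Rightarrow> nat \<Rightarrow> nat \<Rightarrow> (nat \<Rightarrow> real list set) \<Rightarrow> (nat \<Rightarrow> nat) \<Rightarrow> real" where
  "binomial_mean \<theta> n L B r \<equiv> \<Sum>\<pi> | \<pi> permutes {1..n}. permutation_prob \<theta> n \<pi> * (\<Prod>i<L. real (cell_count n (B i) \<pi> choose r i))"

abbreviation disjoint_cells :: "nat \<Rightarrow> (nat \<Rightarrow> real list set) \<Rightarrow> (nat \<Rightarrow> nat) \<Rightarrow> bool" where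
  "disjoint_cells L B k \<equiv> (\<forall>i<L. B i \<subseteq> cycle_cell (k i) \<and> k i \<ge> 1) \<and> disjoint_family_on B {..<L}"

lemma cycle_weight_nonneg: "(\<And>k. k \<ge> 1 \<Longrightarrow> \<theta> k \<ge> 0) \<Longrightarrow> cycle_weight \<theta> n \<pi> \<ge> 0"
  by (auto simp: cycle_weight_def intro!: prod_nonneg)

lemma cycle_norm_nonneg: "(\<And>k. k \<ge> 1 \<Longrightarrow> \<theta> k \<ge> 0) \<Longrightarrow> cycle_norm \<theta> n \<ge> 0"
  by (auto simp: cycle_norm_def intro!: sum_nonneg divide_nonneg_pos cycle_weight_nonneg)

lemma grid_points_cycle_lists:
  assumes "t \<in> grid_points n B" "B \<subseteq> cycle_space" "distinct t" "n \<ge> 1"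
  shows "t \<in> cycle_lists {1..n}"
proof -
  have t: "set t \<subseteq> {1..n}" "rescale n t \<in> cycle_space"
    using assms by (auto simp: grid_points_def)
  then have ne: "t \<noteq> []" by (auto simp: cycle_space_iff)
  have le: "t ! 0 \<le> t ! i" if "i < length t" for i
  proof -
    have "rescale n t ! 0 \<le> rescale n t ! i"
      using t(2) that unfolding cycle_space_iff length_map by blast
    moreover have "0 < length t" using ne by simp
    ultimately have "real (t ! 0) / real n \<le> real (t ! i) / real n"
      using that by (simp only: nth_map)
    then show ?thesis using assms(4) by (simp add: divide_le_cancel)
  qed
  have "Min (set t) = hd t"
    using le ne by (intro Min_eqI) (auto simp: hd_conv_nth in_set_conv_nth)
  then show ?thesis using t ne assms(3) by (simp add: cycle_lists_def)
qed

lemma list_all2_memberD: "list_all2 P xs ys \<Longrightarrow> x \<in> set xs \<Longrightarrow> \<exists>y\<in>set ys. P x y"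
  by (induction rule: list_all2_induct) auto

lemma prod_list_concat_replicate:
  fixes f :: "nat \<Rightarrow> 'b::comm_monoid_mult"
  shows "prod_list (map f (concat (map (\<lambda>i. replicate (r i) i) [0..<m]))) = (\<Prod>i<m. f i ^ r i)"
  by (induction m) (auto simp: prod_list_replicate)

lemma sum_list_concat_replicate:
  "sum_list (map f (concat (map (\<lambda>i. replicate (r i) i) [0..<m]))) = (\<Sum>i<m. r i * f i :: nat)"
  by (induction m) (auto simp: sum_list_replicate)

lemma count_list_concat_replicate:
  "count_list (concat (map (\<lambda>i. replicate (r i) i) [0..<m])) i = (if i < m then r i else 0)"
proof (induction m)
  case (Suc m)
  have "count_list (replicate q m) i = (if i = m then q else 0)" for q
    by (induction q) auto
  then show ?case using Suc by (auto simp: less_Suc_eq)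
qed simp

text \<open>Ordered choices of \<open>r i\<close> atoms in each \<open>B i\<close> are lists of
  tuples following the word \<open>w\<close>, in which every index \<open>i\<close> occurs
  \<open>r i\<close> times; the factorials remove the order. After the sums are exchanged, the
  probability of the permutations with given cycles \<open>ts\<close> depends on their lengths only,
  so that just the number of lists remains. If \<open>s\<close> exceeds \<open>n\<close> there are
  no such lists, and the truncated \<open>n - s\<close> does no harm.\<close>

lemma binomial_moment:
  fixes B :: "nat \<Rightarrow> real list set" and k r :: "nat \<Rightarrow> nat"
  assumes n: "n \<ge> 1" and h: "cycle_norm \<theta> n > 0"
    and cell: "\<And>i. i < L \<Longrightarrow> B i \<subseteq> cycle_cell (k i)" and k: "\<And>i. i < L \<Longrightarrow> k i \<ge> 1"
    and disj: "\<And>i j. i < L \<Longrightarrow> j < L \<Longrightarrow> i \<noteq> j \<Longrightarrow> B i \<inter> B j = {}"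
  defines "s \<equiv> \<Sum>i<L. r i * k i"
    and "w \<equiv> concat (map (\<lambda>i. replicate (r i) i) [0..<L])"
  shows "binomial_mean \<theta> n L B r =
    (\<Prod>i<L. \<theta> (k i) ^ r i / fact (r i)) * (cycle_norm \<theta> (n - s) / cycle_norm \<theta> n) *
    (fact (n - s) / fact n) *
    real (card {ts. list_all2 (\<lambda>t i. t \<in> grid_points n (B i)) ts w \<and> distinct (concat ts)})"
proof -
  \<comment> \<open>Empty sets beyond \<open>L\<close> give the disjointness for all indices that
    \<open>card_distinct_list_all2\<close> asks for.\<close>
  define A where "A \<pi> i = (if i < L then {t \<in> cycle_tuples n \<pi>. rescale n t \<in> B i} else {})" for \<pi> i
  define TT where "TT = {ts. list_all2 (\<lambda>t i. t \<in> grid_points n (B i)) ts w \<and> distinct (concat ts)}"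
  define Perm where "Perm = {\<pi>. \<pi> permutes {1..n}}"
  have finPerm: "finite Perm" by (simp add: Perm_def finite_permutations)
  have setw: "set w \<subseteq> {..<L}" by (auto simp: w_def)
  have countw: "count_list w i = r i" if "i < L" for i
    unfolding w_def count_list_concat_replicate using that by simp
  have sw: "sum_list (map k w) = s"
    unfolding w_def sum_list_concat_replicate by (simp add: s_def)
  have thw: "prod_list (map (\<lambda>i. \<theta> (k i)) w) = (\<Prod>i<L. \<theta> (k i) ^ r i)"
    unfolding w_def by (rule prod_list_concat_replicate)
  have gp: "length t = k i \<and> set t \<subseteq> {1..n}" if "i \<in> set w" "t \<in> grid_points n (B i)" for i t
  proof -
    have "rescale n t \<in> cycle_cell (k i)" using that cell setw by (auto simp: grid_points_def)
    then show ?thesis using that by (auto simp: grid_points_def cycle_cell_def)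
  qed
  note l2 = list_all2_concat[OF gp]
  have finTT: "finite TT"
  proof -
    have "finite (grid_points n (B i))" if "i \<in> set w" for i
      by (rule finite_subset[OF _ finite_lists_length_eq[of "{1..n}" "k i"]]) (use gp that in auto)
    then have "finite {ts. list_all2 (\<lambda>t i. t \<in> grid_points n (B i)) ts w}" by (rule finite_list_all2)
    then show ?thesis by (rule rev_finite_subset) (auto simp: TT_def)
  qed
  have TT_cycle: "t \<in> cycle_lists {1..n}" if ts: "ts \<in> TT" "t \<in> set ts" for ts t
  proof -
    have "list_all2 (\<lambda>t i. t \<in> grid_points n (B i)) ts w" using ts(1) by (simp add: TT_def)
    from list_all2_memberD[OF this ts(2)]
    obtain i where i: "i \<in> set w" "t \<in> grid_points n (B i)" by blast
    then have "i < L" using setw by auto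
    moreover have "distinct t" using ts by (auto simp: TT_def distinct_concat_iff)
    moreover have "B i \<subseteq> cycle_space"
      using cell[OF \<open>i < L\<close>] cycle_cell_subset_space[OF k[OF \<open>i < L\<close>]] by (rule subset_trans)
    ultimately show ?thesis using n i(2) by (intro grid_points_cycle_lists)
  qed
  \<comment> \<open>Different cycles are disjoint: on the left are the lists counted by the binomial
    coefficients, on the right the lists for which the total weight can be evaluated.\<close>
  have eq: "{ts. list_all2 (\<lambda>t i. t \<in> A \<pi> i) ts w \<and> distinct ts} = {ts \<in> TT. \<forall>t\<in>set ts. traverses \<pi> t}"
    (is "?X = ?Y") if "\<pi> \<in> Perm" for \<pi>
  proof (intro equalityI subsetI)
    fix ts assume ts: "ts \<in> ?X"
    then have all: "t \<in> cycle_lists {1..n} \<and> traverses \<pi> t" if "t \<in> set ts" for t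
    proof -
      have "list_all2 (\<lambda>t i. t \<in> A \<pi> i) ts w" using ts by simp
      from list_all2_memberD[OF this that] obtain i where "t \<in> A \<pi> i" by blast
      then show ?thesis by (auto simp: A_def cycle_tuples_eq split: if_splits)
    qed
    have "distinct (concat ts)" using all ts by (intro distinct_concat_traverses[of ts "{1..n}" \<pi>]) auto
    moreover have "list_all2 (\<lambda>t i. t \<in> grid_points n (B i)) ts w"
      using ts by (auto simp: A_def cycle_tuples_eq cycle_lists_def grid_points_def
          elim!: list_all2_mono split: if_splits)
    ultimately show "ts \<in> ?Y" using all by (simp add: TT_def)
  next
    fix ts assume ts: "ts \<in> ?Y"
    have cl: "t \<in> cycle_lists {1..n}" if "t \<in> set ts" for t using TT_cycle ts that by blast
    have "distinct ts"
      using ts cl by (intro distinct_if_concat) (auto simp: TT_def cycle_lists_def)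
    moreover have "list_all2 (\<lambda>t i. t \<in> A \<pi> i) ts w"
    proof -
      have l: "list_all2 (\<lambda>t i. t \<in> grid_points n (B i)) ts w" using ts by (simp add: TT_def)
      have "ts ! j \<in> A \<pi> (w ! j)" if j: "j < length w" for j
      proof -
        have "ts ! j \<in> set ts" "w ! j \<in> set w" "ts ! j \<in> grid_points n (B (w ! j))"
          using l j by (auto simp: list_all2_conv_all_nth)
        then show ?thesis using cl ts setw by (auto simp: A_def cycle_tuples_eq grid_points_def)
      qed
      then show ?thesis using l by (auto simp: list_all2_conv_all_nth)
    qed
    ultimately show "ts \<in> ?X" by simp
  qed
  have prod_eq: "(\<Prod>i<L. real (cell_count n (B i) \<pi> choose r i)) =
      (\<Prod>i<L. 1 / fact (r i)) * (\<Sum>ts\<in>TT. of_bool (\<forall>t\<in>set ts. traverses \<pi> t))" if \<pi>: "\<pi> \<in> Perm" for \<pi>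
  proof -
    have "(\<Sum>ts\<in>TT. of_bool (\<forall>t\<in>set ts. traverses \<pi> t)) = real (card {ts \<in> TT. \<forall>t\<in>set ts. traverses \<pi> t})"
      using finTT by (simp add: Int_def)
    also have "\<dots> = real (\<Prod>i<L. fact (count_list w i) * (card (A \<pi> i) choose count_list w i))"
      unfolding eq[OF \<pi>, symmetric]
    proof (subst card_distinct_list_all2[OF _ _ setw])
      show "finite (A \<pi> i)" for i using finite_cycle_tuples[of n \<pi>] by (simp add: A_def)
      show "A \<pi> i \<inter> A \<pi> j = {}" if "i \<noteq> j" for i j using disj[of i j] that by (auto simp: A_def)
    qed simp
    also have "\<dots> = (\<Prod>i<L. fact (r i) * real (cell_count n (B i) \<pi> choose r i))"
      unfolding of_nat_prod by (rule prod.cong) (auto simp: countw A_def cell_count_def)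
    finally show ?thesis by (simp add: prod.distrib prod_dividef)
  qed
  have W: "(\<Sum>\<pi>\<in>Perm. permutation_prob \<theta> n \<pi> * of_bool (\<forall>t\<in>set ts. traverses \<pi> t)) =
      (\<Prod>i<L. \<theta> (k i) ^ r i) * (cycle_norm \<theta> (n - s) / cycle_norm \<theta> n) * (fact (n - s) / fact n)"
    if ts: "ts \<in> TT" for ts
  proof -
    have l: "list_all2 (\<lambda>t i. t \<in> grid_points n (B i)) ts w" "distinct (concat ts)"
      using ts by (auto simp: TT_def)
    have len: "map length ts = map k w" "length (concat ts) = s" "set (concat ts) \<subseteq> {1..n}"
      using l2[OF _ _ l(1)] sw by auto
    have card: "card ({1..n} - set (concat ts)) = n - s"
      using len(2,3) distinct_card[OF l(2)] by (subst card_Diff_subset) auto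
    have "(\<Sum>\<pi>\<in>Perm. permutation_prob \<theta> n \<pi> * of_bool (\<forall>t\<in>set ts. traverses \<pi> t)) =
        (\<Sum>\<pi> | \<pi> permutes {1..n} \<and> (\<forall>t\<in>set ts. traverses \<pi> t). permutation_prob \<theta> n \<pi>)"
      using finPerm unfolding Perm_def by (intro sum.mono_neutral_cong_right) auto
    also have "\<dots> = (\<Sum>\<pi> | \<pi> permutes {1..n} \<and> (\<forall>t\<in>set ts. traverses \<pi> t). orbit_weight \<theta> {1..n} \<pi>) /
        (cycle_norm \<theta> n * fact n)"
      unfolding sum_divide_distrib by (rule sum.cong) (auto simp: permutation_prob_def cycle_weight_eq)
    also have "\<dots> = prod_list (map (\<lambda>t. \<theta> (length t)) ts) * total_weight \<theta> ({1..n} - set (concat ts)) /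
        (cycle_norm \<theta> n * fact n)"
      using TT_cycle[OF ts] l(2) by (subst sum_orbit_weight_traverses) auto
    also have "prod_list (map (\<lambda>t. \<theta> (length t)) ts) = prod_list (map \<theta> (map length ts))" by (simp add: o_def)
    also have "\<dots> = (\<Prod>i<L. \<theta> (k i) ^ r i)" unfolding len(1) using thw by (simp add: o_def)
    also have "total_weight \<theta> ({1..n} - set (concat ts)) = fact (n - s) * cycle_norm \<theta> (n - s)"
      by (subst total_weight_eq) (simp_all only: card finite_Diff finite_atLeastAtMost)
    finally show ?thesis by simp
  qed
  have "(\<Sum>\<pi>\<in>Perm. permutation_prob \<theta> n \<pi> * (\<Prod>i<L. real (cell_count n (B i) \<pi> choose r i))) =
      (\<Sum>\<pi>\<in>Perm. (\<Prod>i<L. 1 / fact (r i)) *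
        (\<Sum>ts\<in>TT. permutation_prob \<theta> n \<pi> * of_bool (\<forall>t\<in>set ts. traverses \<pi> t)))"
    by (rule sum.cong) (simp_all only: prod_eq sum_distrib_left[symmetric] mult.left_commute)
  also have "\<dots> = (\<Prod>i<L. 1 / fact (r i)) *
      (\<Sum>ts\<in>TT. \<Sum>\<pi>\<in>Perm. permutation_prob \<theta> n \<pi> * of_bool (\<forall>t\<in>set ts. traverses \<pi> t))"
    by (subst sum.swap) (rule sum_distrib_left[symmetric])
  also have "\<dots> = (\<Prod>i<L. 1 / fact (r i)) * (real (card TT) * ((\<Prod>i<L. \<theta> (k i) ^ r i) *
      (cycle_norm \<theta> (n - s) / cycle_norm \<theta> n) * (fact (n - s) / fact n)))"
    by (simp add: W)
  finally show ?thesis by (simp add: Perm_def TT_def prod_dividef mult_ac)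
qed

section \<open>Consequences of the stability condition\<close>

locale stable_weights =
  fixes \<theta> :: "nat \<Rightarrow> real"
  assumes weight_nonneg: "\<And>k. k \<ge> 1 \<Longrightarrow> \<theta> k \<ge> 0"
    and norm_ratio: "(\<lambda>n. cycle_norm \<theta> (n - 1) / cycle_norm \<theta> n) \<longlonglongrightarrow> 1"
begin

lemma norm_nonneg: "cycle_norm \<theta> n \<ge> 0"
  using weight_nonneg by (rule cycle_norm_nonneg)

lemma permutation_prob_nonneg: "permutation_prob \<theta> n \<pi> \<ge> 0"
  using weight_nonneg norm_nonneg unfolding permutation_prob_def
  by (intro divide_nonneg_nonneg cycle_weight_nonneg mult_nonneg_nonneg) auto

text \<open>As \<open>x / 0 = 0\<close>, a ratio close to 1 cannot have denominator 0.\<close>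

lemma norm_pos_eventually: "\<forall>\<^sub>F n in sequentially. cycle_norm \<theta> n > 0"
proof -
  have "\<forall>\<^sub>F n in sequentially. cycle_norm \<theta> (n - 1) / cycle_norm \<theta> n > 0"
    using order_tendstoD(1)[OF norm_ratio, of 0] by simp
  then show ?thesis
    by eventually_elim (metis div_by_0 less_eq_real_def norm_nonneg order_less_irrefl)
qed

lemma norm_ratio_shift: "(\<lambda>n. cycle_norm \<theta> (n - s) / cycle_norm \<theta> n) \<longlonglongrightarrow> 1"
proof (induction s)
  case 0
  have "\<forall>\<^sub>F n in sequentially. 1 = cycle_norm \<theta> (n - 0) / cycle_norm \<theta> n"
    using norm_pos_eventually by eventually_elim simp
  then show ?case by (rule Lim_transform_eventually[OF tendsto_const])
next
  case (Suc s)
  have lim: "filterlim (\<lambda>n. n - s) sequentially sequentially" by (rule filterlim_minus_const_nat_at_top)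
  have "(\<lambda>n. cycle_norm \<theta> (n - s - 1) / cycle_norm \<theta> (n - s)) \<longlonglongrightarrow> 1"
    using filterlim_compose[OF norm_ratio lim] .
  from tendsto_mult[OF this Suc.IH]
  have "(\<lambda>n. cycle_norm \<theta> (n - s - 1) / cycle_norm \<theta> (n - s) * (cycle_norm \<theta> (n - s) / cycle_norm \<theta> n)) \<longlonglongrightarrow> 1"
    by simp
  moreover have "\<forall>\<^sub>F n in sequentially. cycle_norm \<theta> (n - s - 1) / cycle_norm \<theta> (n - s) *
      (cycle_norm \<theta> (n - s) / cycle_norm \<theta> n) = cycle_norm \<theta> (n - Suc s) / cycle_norm \<theta> n"
    using eventually_compose_filterlim[OF norm_pos_eventually lim]
    by eventually_elim simp
  ultimately show ?case by (rule Lim_transform_eventually)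
qed

text \<open>While \<open>n - s\<close> stays above \<open>n0\<close>, every single step multiplies
  by less than 2; below \<open>n0\<close> only finitely many values of \<open>cycle_norm\<close>
  occur. Any base above 1 could replace 2.\<close>

lemma norm_ratio_bound:
  "\<exists>n0\<ge>1. \<exists>C\<ge>0. (\<forall>n\<ge>n0. cycle_norm \<theta> n > 0) \<and>
    (\<forall>n\<ge>n0. \<forall>s\<le>n. cycle_norm \<theta> (n - s) / cycle_norm \<theta> n \<le> C * 2 ^ s)"
proof -
  let ?h = "cycle_norm \<theta>"
  have "\<forall>\<^sub>F n in sequentially. ?h n > 0 \<and> ?h (n - 1) / ?h n < 2"
    using norm_pos_eventually order_tendstoD(2)[OF norm_ratio, of 2] by (simp add: eventually_conj)
  then obtain N where N: "\<And>n. n \<ge> N \<Longrightarrow> ?h n > 0 \<and> ?h (n - 1) / ?h n < 2"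
    by (auto simp: eventually_sequentially)
  define n0 where "n0 = max 1 N"
  have pos: "?h n > 0" if "n \<ge> n0" for n using N[of n] that by (simp add: n0_def)
  have step: "?h (n - s) \<le> 2 ^ s * ?h n" if "n - s \<ge> n0" "s \<le> n" for n s
    using that
  proof (induction s)
    case (Suc s)
    have "?h (n - s - 1) < 2 * ?h (n - s)"
    proof -
      have "n - s \<ge> N" using Suc.prems unfolding n0_def by linarith
      then have "?h (n - s) > 0" "?h (n - s - 1) / ?h (n - s) < 2" using N[of "n - s"] by simp_all
      then show ?thesis by (simp add: divide_less_eq)
    qed
    also have "\<dots> \<le> 2 * (2 ^ s * ?h n)" using Suc by simp
    finally show ?case by simp
  qed simp
  define H where "H = (\<Sum>j\<le>n0. ?h j)"
  \<comment> \<open>The summand 1 covers the case \<open>n - s \<ge> n0\<close>, the quotient the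
    remaining one.\<close>
  define C where "C = 1 + H / ?h n0"
  have H: "?h j \<le> H" if "j \<le> n0" for j
    unfolding H_def using that norm_nonneg by (intro member_le_sum) auto
  have "0 \<le> H" unfolding H_def using norm_nonneg by (intro sum_nonneg) auto
  then have H0: "0 \<le> H / ?h n0" using norm_nonneg by simp
  show ?thesis
  proof (intro exI[of _ n0] exI[of _ C] conjI allI impI)
    show "n0 \<ge> 1" by (simp add: n0_def)
    show "C \<ge> 0" using H0 by (simp add: C_def)
    fix n s assume n: "n \<ge> n0" and s: "s \<le> n"
    show "?h (n - s) / ?h n \<le> C * 2 ^ s"
    proof (cases "n - s \<ge> n0")
      case True
      have "?h (n - s) / ?h n \<le> 1 * 2 ^ s" using step[OF True s] pos[OF n] by (simp add: divide_le_eq)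
      also have "\<dots> \<le> C * 2 ^ s" using H0 by (intro mult_right_mono) (auto simp: C_def)
      finally show ?thesis .
    next
      case False
      \<comment> \<open>Single steps are controlled only down to \<open>n0\<close>, and
        \<open>n - n0 \<le> s\<close> in this case.\<close>
      have "?h n0 \<le> 2 ^ (n - n0) * ?h n" using step[of n "n - n0"] n by simp
      also have "\<dots> \<le> 2 ^ s * ?h n"
        using False n s pos[OF n] by (intro mult_right_mono power_increasing) auto
      finally have *: "?h n0 / ?h n \<le> 2 ^ s" using pos[OF n] by (simp add: divide_le_eq)
      have "?h (n - s) / ?h n \<le> H / ?h n"
        using H[of "n - s"] False pos[OF n] by (intro divide_right_mono) auto
      also have "\<dots> = H / ?h n0 * (?h n0 / ?h n)" using pos[of n0] by simp
      also have "\<dots> \<le> H / ?h n0 * 2 ^ s" using * H0 by (rule mult_left_mono)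
      also have "\<dots> \<le> C * 2 ^ s" by (intro mult_right_mono) (auto simp: C_def)
      finally show ?thesis .
    qed
  qed (rule pos)
qed

text \<open>The number of lists is at most n! / (n-s)!, which cancels the quotient of factorials,
  and \<open>2 ^ s\<close> is distributed over the cells. The same \<open>n0\<close> and
  \<open>C\<close> serve all families of cells: tightness uses them for every cycle length at
  once.\<close>

lemma binomial_moment_bound:
  "\<exists>n0\<ge>1. \<exists>C\<ge>0. (\<forall>n\<ge>n0. cycle_norm \<theta> n > 0) \<and>
    (\<forall>n\<ge>n0. \<forall>L B k r. disjoint_cells L B k \<longrightarrow>
      binomial_mean \<theta> n L B r \<le> C * (\<Prod>i<L. (\<theta> (k i) * 2 ^ k i) ^ r i / fact (r i)))"
proof -
  obtain n0 C where n0: "n0 \<ge> 1" "C \<ge> 0" "\<And>n. n \<ge> n0 \<Longrightarrow> cycle_norm \<theta> n > 0"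
    "\<And>n s. n \<ge> n0 \<Longrightarrow> s \<le> n \<Longrightarrow> cycle_norm \<theta> (n - s) / cycle_norm \<theta> n \<le> C * 2 ^ s"
    using norm_ratio_bound by auto
  show ?thesis
  proof (intro exI[of _ n0] exI[of _ C] conjI allI impI)
    show "n0 \<ge> 1" "C \<ge> 0" by (fact n0)+
    show "cycle_norm \<theta> n > 0" if "n \<ge> n0" for n using n0(3) that .
    fix n L :: nat and B :: "nat \<Rightarrow> real list set" and k r :: "nat \<Rightarrow> nat"
    assume n: "n \<ge> n0" and "disjoint_cells L B k"
    then have cell: "\<And>i. i < L \<Longrightarrow> B i \<subseteq> cycle_cell (k i)" and k: "\<And>i. i < L \<Longrightarrow> k i \<ge> 1"
      and disj: "\<And>i j. i < L \<Longrightarrow> j < L \<Longrightarrow> i \<noteq> j \<Longrightarrow> B i \<inter> B j = {}"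
      by (auto simp: disjoint_family_on_def)
    define s where "s = (\<Sum>i<L. r i * k i)"
    define w where "w = concat (map (\<lambda>i. replicate (r i) i) [0..<L])"
    define T where "T = {ts. list_all2 (\<lambda>t i. t \<in> grid_points n (B i)) ts w \<and> distinct (concat ts)}"
    have "card T \<le> card (distinct_lists n (sum_list (map k w)))"
      unfolding T_def
    proof (rule card_distinct_concat_le)
      fix i t assume "i \<in> set w" "t \<in> grid_points n (B i)"
      then have "rescale n t \<in> cycle_cell (k i)" "set t \<subseteq> {1..n}"
        using cell by (auto simp: w_def grid_points_def)
      then show "length t = k i \<and> set t \<subseteq> {1..n}" by (simp add: cycle_cell_def)
    qed
    then have T: "card T \<le> card (distinct_lists n s)"
      unfolding w_def sum_list_concat_replicate s_def .
    have \<theta>0: "0 \<le> (\<Prod>i<L. \<theta> (k i) ^ r i / fact (r i))"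
      using weight_nonneg k by (intro prod_nonneg) auto
    have "binomial_mean \<theta> n L B r =
        (\<Prod>i<L. \<theta> (k i) ^ r i / fact (r i)) * (cycle_norm \<theta> (n - s) / cycle_norm \<theta> n) *
        (fact (n - s) / fact n) * real (card T)"
      unfolding s_def T_def w_def using n n0 cell k disj by (intro binomial_moment) auto
    also have "\<dots> \<le> (\<Prod>i<L. \<theta> (k i) ^ r i / fact (r i)) * (C * 2 ^ s)"
    proof (cases "s \<le> n")
      case True
      have "(fact (n - s) / fact n) * real (card T) \<le> (fact (n - s) / fact n) * real (card (distinct_lists n s))"
        using T by (intro mult_left_mono) auto
      also have "\<dots> = 1" using True by (simp add: card_distinct_lists)
      finally have "(cycle_norm \<theta> (n - s) / cycle_norm \<theta> n) * ((fact (n - s) / fact n) * real (card T)) \<le> (C * 2 ^ s) * 1"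
        using n0(2) n0(4)[OF n True] norm_nonneg by (intro mult_mono) auto
      then show ?thesis unfolding mult.assoc using \<theta>0 by (intro mult_left_mono) (auto simp: mult.assoc)
    next
      case False
      then have "card T = 0" using T distinct_lists_eq_empty[of n s] by simp
      then show ?thesis using \<theta>0 n0(2) by simp
    qed
    also have "\<dots> = C * (\<Prod>i<L. (\<theta> (k i) * 2 ^ k i) ^ r i / fact (r i))"
    proof -
      have "(2::real) ^ s = (\<Prod>i<L. (2 ^ k i) ^ r i)"
        unfolding s_def power_sum by (simp add: power_mult[symmetric] mult.commute)
      then show ?thesis by (simp add: power_mult_distrib prod_dividef prod.distrib)
    qed
    finally show "binomial_mean \<theta> n L B r \<le> C * (\<Prod>i<L. (\<theta> (k i) * 2 ^ k i) ^ r i / fact (r i))" .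
  qed
qed

text \<open>Apart from collisions, whose number is of smaller order than \<open>n ^ s\<close>, the
  lists in \<open>binomial_moment\<close> are chosen independently in each cell. Their normalized
  number therefore tends to the product of the \<open>v i ^ r i\<close>, and the moments tend to
  those of independent Poisson variables.\<close>

lemma cell_count_poisson_limit:
  fixes B :: "nat \<Rightarrow> real list set" and k c :: "nat \<Rightarrow> nat" and v :: "nat \<Rightarrow> real"
  assumes cell: "\<And>i. i < L \<Longrightarrow> B i \<subseteq> cycle_cell (k i)" and k: "\<And>i. i < L \<Longrightarrow> k i \<ge> 1"
    and disj: "\<And>i j. i < L \<Longrightarrow> j < L \<Longrightarrow> i \<noteq> j \<Longrightarrow> B i \<inter> B j = {}"
    and v: "\<And>i. i < L \<Longrightarrow> (\<lambda>n. real (card (grid_points n (B i))) / real n ^ k i) \<longlonglongrightarrow> v i"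
  shows "(\<lambda>n. \<Sum>\<pi> | \<pi> permutes {1..n}. permutation_prob \<theta> n \<pi> * of_bool (\<forall>i<L. cell_count n (B i) \<pi> = c i))
    \<longlonglongrightarrow> (\<Prod>i<L. (\<theta> (k i) * v i) ^ c i / fact (c i) * exp (- (\<theta> (k i) * v i)))"
proof -
  obtain n0 C where n0: "n0 \<ge> 1" and pos: "\<forall>n\<ge>n0. cycle_norm \<theta> n > 0"
    and bound: "\<forall>n\<ge>n0. \<forall>L B k r. disjoint_cells L B k \<longrightarrow>
      binomial_mean \<theta> n L B r \<le> C * (\<Prod>i<L. (\<theta> (k i) * 2 ^ k i) ^ r i / fact (r i))"
    using binomial_moment_bound by blast
  have cells: "disjoint_cells L B k"
    using cell k disj by (auto simp: disjoint_family_on_def)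
  show ?thesis
  \<comment> \<open>Beyond \<open>L\<close> the values \<open>k i\<close> are arbitrary and could
    make the parameter of the majorant negative, hence the default 0.\<close>
  proof (rule poisson_limit_from_binomial_moments[where ?n0.0 = n0 and C = C and b = "\<lambda>i. if i < L then \<theta> (k i) * 2 ^ k i else 0"])
    show "permutation_prob \<theta> n \<pi> \<ge> 0" for n \<pi>
      by (rule permutation_prob_nonneg)
    show "(if i < L then \<theta> (k i) * 2 ^ k i else 0) \<ge> 0" for i using weight_nonneg k by simp
    show "binomial_mean \<theta> n L B r \<le> C * (\<Prod>i<L. (if i < L then \<theta> (k i) * 2 ^ k i else 0) ^ r i / fact (r i))" if "n \<ge> n0" for n r
      using bound[rule_format, OF that cells, of r] by simp
    fix r :: "nat \<Rightarrow> nat"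
    define s where "s = (\<Sum>i<L. r i * k i)"
    define w where "w = concat (map (\<lambda>i. replicate (r i) i) [0..<L])"
    define T where "T n = {ts. list_all2 (\<lambda>t i. t \<in> grid_points n (B i)) ts w \<and> distinct (concat ts)}" for n
    define d where "d n = real (card (distinct_lists n s)) / real n ^ s" for n
    let ?q = "\<lambda>n. \<Prod>i<L. (real (card (grid_points n (B i))) / real n ^ k i) ^ r i"
    have d: "d \<longlonglongrightarrow> 1" unfolding d_def by (rule card_distinct_lists_asymp)
    have lim_prod: "?q \<longlonglongrightarrow> (\<Prod>i<L. v i ^ r i)"
      using v by (intro tendsto_prod tendsto_power) auto
    have pow: "real n ^ s = (\<Prod>i<L. (real n ^ k i) ^ r i)" for n
      unfolding s_def power_sum by (simp add: power_mult[symmetric] mult.commute)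
    have close: "\<bar>real (card (T n)) / real n ^ s - ?q n\<bar> \<le> 1 - d n"
      if n: "n \<ge> 1" for n
    proof -
      have "\<bar>real (card (T n)) - prod_list (map (\<lambda>i. real (card (grid_points n (B i)))) w)\<bar> \<le>
          real n ^ sum_list (map k w) - real (card (distinct_lists n (sum_list (map k w))))"
        unfolding T_def
      proof (rule card_distinct_concat_close)
        fix i t assume "i \<in> set w" "t \<in> grid_points n (B i)"
        then have "rescale n t \<in> cycle_cell (k i)" "set t \<subseteq> {1..n}"
          using cell by (auto simp: w_def grid_points_def)
        then show "length t = k i \<and> set t \<subseteq> {1..n}" by (simp add: cycle_cell_def)
      qed
      then have *: "\<bar>real (card (T n)) - (\<Prod>i<L. real (card (grid_points n (B i))) ^ r i)\<bar> \<le>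
          real n ^ s - real (card (distinct_lists n s))"
        unfolding w_def sum_list_concat_replicate prod_list_concat_replicate s_def .
      have "?q n =
          (\<Prod>i<L. real (card (grid_points n (B i))) ^ r i) / real n ^ s"
        by (simp add: pow power_divide prod_dividef)
      then have "\<bar>real (card (T n)) / real n ^ s - ?q n\<bar> =
          \<bar>real (card (T n)) - (\<Prod>i<L. real (card (grid_points n (B i))) ^ r i)\<bar> / real n ^ s"
        by (simp add: diff_divide_distrib[symmetric])
      also have "\<dots> \<le> (real n ^ s - real (card (distinct_lists n s))) / real n ^ s"
        using * by (intro divide_right_mono) auto
      also have "\<dots> = 1 - d n" using n by (simp add: d_def diff_divide_distrib)
      finally show ?thesis .
    qed
    have "(\<lambda>n. 1 - d n) \<longlonglongrightarrow> 1 - 1" by (intro tendsto_diff tendsto_const d)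
    then have d0: "(\<lambda>n. 1 - d n) \<longlonglongrightarrow> 0" by simp
    have "(\<lambda>n. real (card (T n)) / real n ^ s - ?q n) \<longlonglongrightarrow> 0"
      (is "?e \<longlonglongrightarrow> 0")
    proof (rule Lim_null_comparison[OF _ d0])
      show "\<forall>\<^sub>F n in sequentially. norm (?e n) \<le> 1 - d n"
        using eventually_ge_at_top[of 1] by eventually_elim (simp only: real_norm_def close)
    qed
    from tendsto_add[OF this lim_prod]
    have limT: "(\<lambda>n. real (card (T n)) / real n ^ s) \<longlonglongrightarrow> (\<Prod>i<L. v i ^ r i)" by simp
    \<comment> \<open>Division by \<open>d n\<close> replaces \<open>n ^ s\<close> by n! / (n-s)!,
      the normalization that occurs in \<open>binomial_moment\<close>.\<close>
    have "(\<lambda>n. (\<Prod>i<L. \<theta> (k i) ^ r i / fact (r i)) * (cycle_norm \<theta> (n - s) / cycle_norm \<theta> n) *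
        ((real (card (T n)) / real n ^ s) / d n)) \<longlonglongrightarrow>
        (\<Prod>i<L. \<theta> (k i) ^ r i / fact (r i)) * 1 * ((\<Prod>i<L. v i ^ r i) / 1)"
      by (intro tendsto_mult tendsto_const norm_ratio_shift tendsto_divide limT d) simp
    moreover have "\<forall>\<^sub>F n in sequentially. (\<Prod>i<L. \<theta> (k i) ^ r i / fact (r i)) * (cycle_norm \<theta> (n - s) / cycle_norm \<theta> n) *
        ((real (card (T n)) / real n ^ s) / d n) =
        binomial_mean \<theta> n L B r"
      using eventually_ge_at_top[of "max n0 s"]
    proof eventually_elim
      case (elim n)
      then have n: "n \<ge> n0" "s \<le> n" "n \<ge> 1" using n0 by auto
      have "(real (card (T n)) / real n ^ s) / d n = (fact (n - s) / fact n) * real (card (T n))"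
        using n by (simp add: d_def card_distinct_lists)
      then show ?case
        unfolding s_def T_def w_def
        by (subst binomial_moment[OF n(3) pos[rule_format, OF n(1)] cell k disj]) auto
    qed
    ultimately have "(\<lambda>n. binomial_mean \<theta> n L B r)
        \<longlonglongrightarrow> (\<Prod>i<L. \<theta> (k i) ^ r i / fact (r i)) * 1 * ((\<Prod>i<L. v i ^ r i) / 1)"
      by (rule Lim_transform_eventually)
    also have "(\<Prod>i<L. \<theta> (k i) ^ r i / fact (r i)) * 1 * ((\<Prod>i<L. v i ^ r i) / 1) =
        (\<Prod>i<L. (\<theta> (k i) * v i) ^ r i / fact (r i))"
      by (simp add: power_mult_distrib prod.distrib prod_dividef)
    finally show "(\<lambda>n. binomial_mean \<theta> n L B r)
        \<longlonglongrightarrow> (\<Prod>i<L. (\<theta> (k i) * v i) ^ r i / fact (r i))" .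
  qed
qed

end


section \<open>The vague topology\<close>

interpretation cycle_metric: Metric_space cycle_space cycle_dist
  by (rule Metric_space_cycle)

lemma space_borel_measure_of [simp]: "space (borel_measure_of T) = topspace T"
  by (auto simp: borel_measure_of_def space_measure_of_conv)

lemma openin_sets_borel_measure_of: "openin T U \<Longrightarrow> U \<in> sets (borel_measure_of T)"
  unfolding sets_borel_measure_of by (auto intro: sigma_sets.Basic)

lemma continuous_map_borel_measurable:
  assumes "continuous_map T euclideanreal g"
  shows "g \<in> borel_measurable (borel_measure_of T)"
proof (rule borel_measurableI)
  fix S :: "real set" assume "open S"
  then have "openin T {x \<in> topspace T. g x \<in> S}"
    using assms by (intro openin_continuous_map_preimage[of T euclideanreal]) auto
  moreover have "g -` S \<inter> space (borel_measure_of T) = {x \<in> topspace T. g x \<in> S}" by auto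
  ultimately show "g -` S \<inter> space (borel_measure_of T) \<in> sets (borel_measure_of T)"
    by (simp add: openin_sets_borel_measure_of)
qed

lemma cycle_dist_coordinate:
  assumes "length xs = length ys" "i < length xs"
  shows "\<bar>xs ! i - ys ! i\<bar> \<le> cycle_dist xs ys"
proof -
  have "\<bar>xs ! i - ys ! i\<bar> \<le> L2_set (\<lambda>i. \<bar>xs ! i - ys ! i\<bar>) {..<length xs}"
    using assms by (intro member_le_L2_set) auto
  then show ?thesis using assms by (simp add: cycle_dist_def L2_set_def)
qed

lemma cycle_dist_less_1:
  assumes "cycle_dist xs ys < 1" "xs \<in> cycle_space"
  shows "length xs = length ys"
proof (rule ccontr)
  assume "length xs \<noteq> length ys"
  moreover have "1 \<le> length xs" using assms(2) by (auto simp: cycle_space_iff Suc_le_eq)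
  ultimately show False using assms(1) by (simp add: cycle_dist_def split: if_splits)
qed

lemma openin_coordinate_less:
  assumes "i < k"
  shows "openin cycle_topology {xs \<in> cycle_space. length xs = k \<and> xs ! i < a}"
  unfolding cycle_metric.openin_mtopology
proof (intro conjI allI impI)
  fix xs assume xs: "xs \<in> {xs \<in> cycle_space. length xs = k \<and> xs ! i < a}"
  \<comment> \<open>A radius of at most 1 excludes points of another length.\<close>
  define r where "r = min 1 (a - xs ! i)"
  have "cycle_metric.mball xs r \<subseteq> {xs \<in> cycle_space. length xs = k \<and> xs ! i < a}"
  proof
    fix ys assume "ys \<in> cycle_metric.mball xs r"
    then have ys: "ys \<in> cycle_space" "cycle_dist xs ys < r" by auto
    then have len: "length xs = length ys" using xs by (intro cycle_dist_less_1) (auto simp: r_def)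
    have "\<bar>xs ! i - ys ! i\<bar> \<le> cycle_dist xs ys"
      using xs assms len by (intro cycle_dist_coordinate) auto
    then have "ys ! i < a" using ys(2) unfolding r_def by linarith
    then show "ys \<in> {xs \<in> cycle_space. length xs = k \<and> xs ! i < a}" using ys(1) len xs by simp
  qed
  moreover have "r > 0" using xs by (simp add: r_def)
  ultimately show "\<exists>r>0. cycle_metric.mball xs r \<subseteq> {xs \<in> cycle_space. length xs = k \<and> xs ! i < a}" by blast
qed auto

text \<open>With \<open>mbounded_lengthD\<close> this shows that bounded means of bounded length:
  the cell of dimension \<open>k\<close> has diameter at most \<open>sqrt k\<close>, and the
  distance to another cell grows with the length.\<close>

lemma mbounded_length_le: "cycle_bounded {xs \<in> cycle_space. length xs \<le> K}"
  unfolding cycle_metric.mbounded_def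
proof (intro exI subsetI)
  fix ys assume ys: "ys \<in> {xs \<in> cycle_space. length xs \<le> K}"
  have 0: "[0] \<in> cycle_space" by (simp add: cycle_space_iff)
  have "cycle_dist [0] ys \<le> sqrt (max 1 (real K))"
  proof (cases "length ys = 1")
    case True
    then have "cycle_dist [0] ys \<le> sqrt (real 1)"
      using ys 0 by (intro cycle_dist_le_sqrt) (auto simp: cycle_space_def cycle_cell_def)
    also have "\<dots> \<le> sqrt (max 1 (real K))" by (intro real_sqrt_le_mono) simp
    finally show ?thesis .
  next
    case False
    then have "cycle_dist [0] ys = sqrt (max 1 (real (length ys)))" by (auto simp: cycle_dist_def)
    also have "\<dots> \<le> sqrt (max 1 (real K))" using ys by (intro real_sqrt_le_mono) auto
    finally show ?thesis .
  qed
  then show "ys \<in> cycle_metric.mcball [0] (sqrt (max 1 (real K)))" using 0 ys by simp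
qed

lemma mbounded_lengthD:
  assumes "cycle_bounded B"
  shows "\<exists>K. \<forall>xs\<in>B. length xs \<le> K"
proof -
  obtain y b where yb: "B \<subseteq> cycle_metric.mcball y b" using assms by (auto simp: cycle_metric.mbounded_def)
  show ?thesis
  proof (intro exI ballI)
    fix xs assume "xs \<in> B"
    then have "cycle_dist y xs \<le> b" using yb by auto
    show "length xs \<le> max (length y) (nat \<lceil>b\<^sup>2\<rceil>)"
    proof (cases "length y = length xs")
      case False
      then have "sqrt (max (real (length y)) (real (length xs))) \<le> b"
        using \<open>cycle_dist y xs \<le> b\<close> by (simp add: cycle_dist_def)
      then have "max (real (length y)) (real (length xs)) \<le> b\<^sup>2" by (rule sqrt_le_D)
      then have "real (length xs) \<le> b\<^sup>2" by simp
      then show ?thesis by (simp add: le_max_iff_disj le_nat_iff) linarith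
    qed simp
  qed
qed

lemma cycle_limitin:
  assumes y: "y \<in> cycle_space"
    and ys: "\<forall>\<^sub>F j in F. ys j \<in> cycle_space \<and> length (ys j) = length y"
    and lim: "\<And>i. i < length y \<Longrightarrow> ((\<lambda>j. ys j ! i) \<longlongrightarrow> y ! i) F"
  shows "limitin cycle_topology ys y F"
proof -
  have "((\<lambda>j. L2_set (\<lambda>i. ys j ! i - y ! i) {..<length y}) \<longlongrightarrow> sqrt (\<Sum>i<length y. (y ! i - y ! i)\<^sup>2)) F"
    unfolding L2_set_def using lim by (intro tendsto_intros) auto
  then have "((\<lambda>j. L2_set (\<lambda>i. ys j ! i - y ! i) {..<length y}) \<longlongrightarrow> 0) F" by simp
  then have L2: "\<forall>\<^sub>F j in F. L2_set (\<lambda>i. ys j ! i - y ! i) {..<length y} < e" if "e > 0" for e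
    using that by (rule order_tendstoD)
  have "\<forall>\<^sub>F j in F. ys j \<in> cycle_space \<and> cycle_dist (ys j) y < e" if "e > 0" for e
    using L2[OF that] ys by eventually_elim (auto simp: cycle_dist_def)
  then show ?thesis using y unfolding cycle_metric.limitin_metric by auto
qed

lemma test_function_tendsto:
  assumes "f \<in> vague_test_functions" "y \<in> cycle_space"
    and "\<forall>\<^sub>F j in F. ys j \<in> cycle_space \<and> length (ys j) = length y"
    and "\<And>i. i < length y \<Longrightarrow> ((\<lambda>j. ys j ! i) \<longlongrightarrow> y ! i) F"
  shows "((\<lambda>j. f (ys j)) \<longlongrightarrow> f y) F"
proof -
  have "limitin euclideanreal (f \<circ> ys) (f y) F"
    using assms(1) cycle_limitin[OF assms(2-4)]
    by (intro continuous_map_limit) (auto simp: vague_test_functions_def)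
  then show ?thesis by (simp add: o_def)
qed

lemma test_function_measurable: "f \<in> vague_test_functions \<Longrightarrow> f \<in> borel_measurable cycle_borel"
  by (auto simp: vague_test_functions_def intro: continuous_map_borel_measurable)

lemma test_function_support:
  assumes "f \<in> vague_test_functions"
  shows "\<exists>K. \<forall>xs\<in>cycle_space. length xs > K \<longrightarrow> f xs = 0"
proof -
  have "cycle_bounded (cycle_topology closure_of {x \<in> cycle_space. f x \<noteq> 0})"
    using assms by (simp add: vague_test_functions_def)
  from mbounded_lengthD[OF this] obtain K
    where K: "\<And>xs. xs \<in> cycle_topology closure_of {x \<in> cycle_space. f x \<noteq> 0} \<Longrightarrow> length xs \<le> K"
    by blast
  have "{x \<in> cycle_space. f x \<noteq> 0} \<subseteq> cycle_topology closure_of {x \<in> cycle_space. f x \<noteq> 0}"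
    by (rule closure_of_subset) auto
  then show ?thesis using K by (intro exI[of _ K]) force
qed

lemma compact_cube: "compact (PiE UNIV (\<lambda>_::'i::countable. {a..b::real}))"
proof -
  have "compactin (product_topology (\<lambda>_::'i. euclideanreal) UNIV) (PiE UNIV (\<lambda>_. {a..b}))"
    by (simp add: compactin_PiE)
  then show ?thesis by (simp add: euclidean_product_topology)
qed

text \<open>Only finitely many cells meet the support. On each of them \<open>f\<close> is pulled
  back along \<open>map x [0..<k]\<close> to a compact set of functions; the cube also confines the
  coordinates from \<open>k\<close> on, which the cell leaves free.\<close>

lemma test_function_bounded:
  assumes f: "f \<in> vague_test_functions"
  shows "\<exists>C. \<forall>xs\<in>cycle_space. \<bar>f xs\<bar> \<le> C"
proof -
  have "\<exists>C. \<forall>xs\<in>cycle_cell k. \<bar>f xs\<bar> \<le> C" if k: "k \<ge> 1" for k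
  proof -
    define S where "S = PiE UNIV (\<lambda>_::nat. {0..1::real}) \<inter> {x. map x [0..<k] \<in> cycle_cell k}"
    have S: "compact S" unfolding S_def by (rule compact_Int_closed[OF compact_cube closed_cell])
    have "continuous_on S (\<lambda>x. f (map x [0..<k]))"
      unfolding continuous_on_sequentially o_def
    proof (intro allI impI ballI)
      fix x and a assume a: "a \<in> S" and x: "(\<forall>n. x n \<in> S) \<and> x \<longlonglongrightarrow> a"
      show "(\<lambda>n. f (map (x n) [0..<k])) \<longlonglongrightarrow> f (map a [0..<k])"
      proof (rule test_function_tendsto[OF f])
        show "map a [0..<k] \<in> cycle_space" using a k cycle_cell_subset_space by (auto simp: S_def)
        show "\<forall>\<^sub>F n in sequentially. map (x n) [0..<k] \<in> cycle_space \<and> length (map (x n) [0..<k]) = length (map a [0..<k])"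
          using x cycle_cell_subset_space[OF k] by (intro always_eventually) (auto simp: S_def)
        fix i assume "i < length (map a [0..<k])"
        moreover have "(\<lambda>n. x n i) \<longlonglongrightarrow> a i"
          using x continuous_on_tendsto_compose[OF continuous_on_product_coordinates[of i], of x a] by auto
        ultimately show "(\<lambda>n. map (x n) [0..<k] ! i) \<longlonglongrightarrow> map a [0..<k] ! i" by simp
      qed
    qed
    then have "bounded ((\<lambda>x. f (map x [0..<k])) ` S)"
      using S by (intro compact_imp_bounded compact_continuous_image)
    then obtain C where C: "\<And>x. x \<in> S \<Longrightarrow> \<bar>f (map x [0..<k])\<bar> \<le> C" by (auto simp: bounded_iff)
    have "\<bar>f xs\<bar> \<le> C" if xs: "xs \<in> cycle_cell k" for xs
    proof -
      define x where "x i = (if i < k then xs ! i else 0)" for i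
      have "map x [0..<k] = xs"
        using xs by (intro nth_equalityI) (auto simp: x_def cycle_cell_def)
      moreover have "x \<in> PiE UNIV (\<lambda>_. {0..1})" using xs k by (auto simp: x_def cycle_cell_iff)
      ultimately show ?thesis using C[of x] xs by (simp add: S_def)
    qed
    then show ?thesis by blast
  qed
  then obtain C where C: "\<And>k xs. k \<ge> 1 \<Longrightarrow> xs \<in> cycle_cell k \<Longrightarrow> \<bar>f xs\<bar> \<le> C k" by metis
  obtain K where K: "\<And>xs. xs \<in> cycle_space \<Longrightarrow> length xs > K \<Longrightarrow> f xs = 0"
    using test_function_support[OF f] by blast
  show ?thesis
  proof (intro exI ballI)
    fix xs assume xs: "xs \<in> cycle_space"
    then have len: "length xs \<ge> 1" "xs \<in> cycle_cell (length xs)" by (auto simp: cycle_space_def cycle_cell_def)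
    show "\<bar>f xs\<bar> \<le> (\<Sum>k\<le>K. \<bar>C k\<bar>)"
    proof (cases "length xs \<le> K")
      case True
      have "\<bar>f xs\<bar> \<le> \<bar>C (length xs)\<bar>" using C[OF len] by simp
      also have "\<dots> \<le> (\<Sum>k\<le>K. \<bar>C k\<bar>)" using True by (intro member_le_sum) auto
      finally show ?thesis .
    next
      case False
      then show ?thesis using K xs by (simp add: sum_nonneg)
    qed
  qed
qed

lemma limitin_topology_generated_by:
  assumes "l \<in> topspace (topology_generated_by S)"
    and "\<And>U. U \<in> S \<Longrightarrow> l \<in> U \<Longrightarrow> eventually (\<lambda>j. x j \<in> U) F"
  shows "limitin (topology_generated_by S) x l F"
proof -
  have "eventually (\<lambda>j. x j \<in> U) F" if "generate_topology_on S U" "l \<in> U" for U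
    using that
  proof (induction rule: generate_topology_on.induct)
    case (Int a b)
    then show ?case by (auto intro: eventually_conj)
  next
    case (UN K)
    then obtain k where "k \<in> K" "l \<in> k" by blast
    then have "eventually (\<lambda>j. x j \<in> k) F" using UN.IH by blast
    then show ?case by eventually_elim (use \<open>k \<in> K\<close> in blast)
  qed (use assms(2) in auto)
  then show ?thesis using assms(1) by (auto simp: limitin_def openin_topology_generated_by_iff)
qed

lemma limitin_vague_topology:
  assumes "\<nu> \<in> locally_finite_measures" "\<forall>\<^sub>F j in F. N j \<in> locally_finite_measures"
    and "\<And>f. f \<in> vague_test_functions \<Longrightarrow> ((\<lambda>j. \<integral>x. f x \<partial>N j) \<longlongrightarrow> (\<integral>x. f x \<partial>\<nu>)) F"
  shows "limitin vague_topology N \<nu> F"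
  unfolding vague_topology_def
proof (rule limitin_topology_generated_by)
  show "\<nu> \<in> topspace (topology_generated_by
      {{\<nu> \<in> locally_finite_measures. (\<integral>x. f x \<partial>\<nu>) \<in> U} | f U. f \<in> vague_test_functions \<and> open U})"
    using assms(1) topspace_vague_topology by (simp add: vague_topology_def)
  fix V assume "V \<in> {{\<nu> \<in> locally_finite_measures. (\<integral>x. f x \<partial>\<nu>) \<in> U} | f U. f \<in> vague_test_functions \<and> open U}"
    and "\<nu> \<in> V"
  then obtain f U where V: "V = {\<nu> \<in> locally_finite_measures. (\<integral>x. f x \<partial>\<nu>) \<in> U}"
    and f: "f \<in> vague_test_functions" and U: "open U" "(\<integral>x. f x \<partial>\<nu>) \<in> U" by blast
  have "\<forall>\<^sub>F j in F. (\<integral>x. f x \<partial>N j) \<in> U" using assms(3)[OF f] U by (rule topological_tendstoD)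
  then show "\<forall>\<^sub>F j in F. N j \<in> V" using assms(2) by eventually_elim (simp add: V)
qed


section \<open>Discretization of point configurations\<close>

text \<open>Rounds down to multiples of \<open>1 / Suc m\<close>. The map is monotone, so the first
  coordinate of a point remains minimal and the rounded point stays in \<open>cycle_space\<close>.
  With \<open>Suc m\<close> there is no exception at \<open>m = 0\<close>.\<close>

definition grid_floor :: "nat \<Rightarrow> real \<Rightarrow> real" where
  "grid_floor m x = real_of_int \<lfloor>real (Suc m) * x\<rfloor> / real (Suc m)"

text \<open>One index \<open>m\<close> refines the mesh and raises the largest length at the same
  time, which keeps each grid finite.\<close>

definition grid :: "nat \<Rightarrow> real list set" where
  "grid m = map (grid_floor m) ` {xs \<in> cycle_space. length xs \<le> m}"

definition grid_cell :: "nat \<Rightarrow> real list \<Rightarrow> real list set" where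
  "grid_cell m q = {xs \<in> cycle_space. map (grid_floor m) xs = q}"

lemma grid_floor_mono: "x \<le> y \<Longrightarrow> grid_floor m x \<le> grid_floor m y"
  unfolding grid_floor_def by (intro divide_right_mono) (auto intro!: floor_mono mult_left_mono)

lemma grid_floor_bounds: "grid_floor m x \<le> x" "x - 1 / real (Suc m) \<le> grid_floor m x"
proof -
  have "real_of_int \<lfloor>real (Suc m) * x\<rfloor> / real (Suc m) \<le> (real (Suc m) * x) / real (Suc m)"
    by (intro divide_right_mono) auto
  then show "grid_floor m x \<le> x" by (simp add: grid_floor_def del: of_nat_Suc)
  have "(real (Suc m) * x - 1) / real (Suc m) \<le> real_of_int \<lfloor>real (Suc m) * x\<rfloor> / real (Suc m)"
    by (intro divide_right_mono) linarith+
  moreover have "(real (Suc m) * x - 1) / real (Suc m) = x - 1 / real (Suc m)"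
    by (simp add: diff_divide_distrib del: of_nat_Suc)
  ultimately show "x - 1 / real (Suc m) \<le> grid_floor m x" by (simp add: grid_floor_def)
qed

lemma grid_floor_nonneg: "0 \<le> x \<Longrightarrow> 0 \<le> grid_floor m x"
  by (simp add: grid_floor_def)

lemma map_grid_floor_cycle_space: "xs \<in> cycle_space \<Longrightarrow> map (grid_floor m) xs \<in> cycle_space"
  unfolding cycle_space_iff
  by (auto intro!: grid_floor_nonneg grid_floor_mono intro: order_trans[OF grid_floor_bounds(1)])

lemma grid_subset: "q \<in> grid m \<Longrightarrow> q \<in> cycle_space \<and> 1 \<le> length q \<and> length q \<le> m"
  using map_grid_floor_cycle_space by (auto simp: grid_def cycle_space_iff Suc_le_eq)

lemma finite_grid: "finite (grid m)"
proof (rule finite_subset)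
  let ?V = "(\<lambda>d. real_of_int d / real (Suc m)) ` {0..int (Suc m)}"
  show "grid m \<subseteq> {xs. set xs \<subseteq> ?V \<and> length xs \<le> m}"
  proof clarify
    fix q assume "q \<in> grid m"
    then obtain xs where xs: "xs \<in> cycle_space" "length xs \<le> m" "q = map (grid_floor m) xs"
      by (auto simp: grid_def)
    have "grid_floor m x \<in> ?V" if "x \<in> set xs" for x
    proof -
      have "0 \<le> x" "x \<le> 1" using that xs(1) by (auto simp: cycle_space_iff in_set_conv_nth)
      then have "0 \<le> real (Suc m) * x" "real (Suc m) * x \<le> real (Suc m)" by (auto simp: mult_left_le)
      then have "0 \<le> \<lfloor>real (Suc m) * x\<rfloor>" "\<lfloor>real (Suc m) * x\<rfloor> \<le> \<lfloor>real (Suc m)\<rfloor>"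
        by (simp_all only: zero_le_floor floor_mono)
      then have "\<lfloor>real (Suc m) * x\<rfloor> \<in> {0..int (Suc m)}" by (simp only: floor_of_nat atLeastAtMost_iff)
      then show ?thesis by (auto simp: grid_floor_def simp del: of_nat_Suc)
    qed
    then show "set q \<subseteq> ?V \<and> length q \<le> m" using xs by auto
  qed
  show "finite {xs. set xs \<subseteq> ?V \<and> length xs \<le> m}" by (rule finite_lists_length_le) simp
qed

lemma coordinate_less_sets:
  "i < k \<Longrightarrow> {xs \<in> cycle_space. length xs = k \<and> xs ! i < a} \<in> sets cycle_borel"
  by (intro openin_sets_borel_measure_of openin_coordinate_less)

lemma grid_floor_eq_iff:
  "grid_floor m x = y \<longleftrightarrow> (\<exists>d::int. y = real_of_int d / real (Suc m) \<and>
    real_of_int d / real (Suc m) \<le> x \<and> x < real_of_int (d + 1) / real (Suc m))"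
proof -
  have "\<lfloor>real (Suc m) * x\<rfloor> = d \<longleftrightarrow> real_of_int d / real (Suc m) \<le> x \<and> x < real_of_int (d + 1) / real (Suc m)" for d
    unfolding floor_eq_iff by (simp add: divide_le_eq less_divide_eq mult.commute del: of_nat_Suc)
  then show ?thesis unfolding grid_floor_def by (metis)
qed

lemma grid_cell_sets: "grid_cell m q \<in> sets cycle_borel"
proof (cases "grid_cell m q = {}")
  case False
  then obtain ys where ys: "ys \<in> cycle_space" "q = map (grid_floor m) ys" by (auto simp: grid_cell_def)
  define d where "d i = \<lfloor>real (Suc m) * ys ! i\<rfloor>" for i
  define A where "A i a = {xs \<in> cycle_space. length xs = length q \<and> xs ! i < a / real (Suc m)}" for i a
  have q: "q ! i = real_of_int (d i) / real (Suc m)" if "i < length q" for i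
    using that by (simp add: ys d_def grid_floor_def)
  have eq: "grid_floor m x = q ! i \<longleftrightarrow> real_of_int (d i) / real (Suc m) \<le> x \<and> x < real_of_int (d i + 1) / real (Suc m)"
    if "i < length q" for x i
    unfolding grid_floor_eq_iff q[OF that] by (auto simp del: of_nat_Suc)
  have ne: "{..<length q} \<noteq> {}" using ys by (auto simp: cycle_space_iff)
  \<comment> \<open>A half-open condition on one coordinate is a difference of two open sets
    \<open>A i a\<close>.\<close>
  have "grid_cell m q = (\<Inter>i\<in>{..<length q}. A i (real_of_int (d i + 1)) - A i (real_of_int (d i)))"
  proof -
    have "A i u - A i l = {xs \<in> cycle_space. length xs = length q \<and> l / real (Suc m) \<le> xs ! i \<and> xs ! i < u / real (Suc m)}"
      for i l u by (auto simp: A_def not_less simp del: of_nat_Suc)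
    then show ?thesis using ne by (auto simp: grid_cell_def list_eq_iff_nth_eq eq simp del: of_nat_Suc)
  qed
  also have "\<dots> \<in> sets cycle_borel"
    using ne by (intro sets.finite_INT sets.Diff) (auto simp: A_def intro!: coordinate_less_sets)
  finally show ?thesis .
qed simp

lemma grid_cell_subset_cell: "grid_cell m q \<subseteq> cycle_cell (length q)"
  by (auto simp: grid_cell_def cycle_space_def cycle_cell_def)

lemma grid_cell_disjoint: "q \<noteq> q' \<Longrightarrow> grid_cell m q \<inter> grid_cell m q' = {}"
  by (auto simp: grid_cell_def)

text \<open>Each defining condition keeps its truth value for large \<open>n\<close>. Lower bounds
  survive because coordinates only increase, strict upper bounds by convergence;
  \<open>x 0 \<le> x i\<close> survives because the ceiling is monotone, and its failure by
  convergence.\<close>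

lemma grid_cell_stable:
  assumes k: "length q = k" "k \<ge> 1" and x: "\<And>i. i < k \<Longrightarrow> 0 < x i \<and> x i \<le> 1"
  shows "\<forall>\<^sub>F n in sequentially. map (\<lambda>i. real_of_int \<lceil>real n * x i\<rceil> / real n) [0..<k] \<in> grid_cell m q \<longleftrightarrow>
    map x [0..<k] \<in> grid_cell m q"
proof -
  define y where "y n i = real_of_int \<lceil>real n * x i\<rceil> / real n" for n i
  have y_lim: "(\<lambda>n. y n i) \<longlonglongrightarrow> x i" for i unfolding y_def by (rule ceiling_grid_tendsto)
  have ge: "\<forall>\<^sub>F n in sequentially. \<forall>i<k. x i \<le> y n i \<and> y n i \<le> 1"
    using eventually_ge_at_top[of 1]
  proof eventually_elim
    case (elim n)
    show ?case
    proof (intro allI impI)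
      fix i assume i: "i < k"
      have "\<lceil>real n * x i\<rceil> \<le> int n" using x[OF i] by (simp add: ceiling_le_iff mult_left_le)
      then have "y n i \<le> 1" using elim by (simp add: y_def)
      then show "x i \<le> y n i \<and> y n i \<le> 1" using ceiling_grid_bounds(1)[OF elim] by (simp add: y_def)
    qed
  qed
  have order: "\<forall>\<^sub>F n in sequentially. (y n 0 \<le> y n i) = (x 0 \<le> x i)" for i
  proof (cases "x 0 \<le> x i")
    case True
    then have "y n 0 \<le> y n i" for n
      unfolding y_def by (intro divide_right_mono) (auto intro!: ceiling_mono mult_left_mono)
    then show ?thesis using True by simp
  next
    case False
    then have less: "x i < (x 0 + x i) / 2" "(x 0 + x i) / 2 < x 0" by auto
    show ?thesis
      using order_tendstoD(2)[OF y_lim less(1)] order_tendstoD(1)[OF y_lim less(2)]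
      by eventually_elim (use False in auto)
  qed
  have floor: "\<forall>\<^sub>F n in sequentially. grid_floor m (y n i) = grid_floor m (x i)" if i: "i < k" for i
  proof -
    define d where "d = \<lfloor>real (Suc m) * x i\<rfloor>"
    have d: "real_of_int d / real (Suc m) \<le> x i" "x i < real_of_int (d + 1) / real (Suc m)"
      "grid_floor m (x i) = real_of_int d / real (Suc m)"
      using grid_floor_eq_iff[of m "x i" "grid_floor m (x i)"] by (auto simp: d_def grid_floor_def divide_le_eq less_divide_eq mult.commute simp del: of_nat_Suc)
    have "\<forall>\<^sub>F n in sequentially. y n i < real_of_int (d + 1) / real (Suc m)"
      using order_tendstoD(2)[OF y_lim d(2)] .
    then show ?thesis using ge
    proof eventually_elim
      case (elim n)
      then have "real_of_int d / real (Suc m) \<le> y n i" using d(1) i by (meson order_trans)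
      then show ?case using elim(1) d(3) unfolding d(3) grid_floor_eq_iff by blast
    qed
  qed
  have "\<forall>\<^sub>F n in sequentially. \<forall>i\<in>{..<k}. (y n 0 \<le> y n i) = (x 0 \<le> x i) \<and> grid_floor m (y n i) = grid_floor m (x i)"
    using order floor by (intro eventually_ball_finite) (auto intro: eventually_conj)
  then show ?thesis using ge unfolding y_def[symmetric]
  proof eventually_elim
    case (elim n)
    have pos: "0 \<le> x i" "x i \<le> 1" "0 \<le> y n i" "y n i \<le> 1" if "i < k" for i
    proof -
      show "0 \<le> x i" "x i \<le> 1" "y n i \<le> 1" using x[OF that] elim(2) that by auto
      have "x i \<le> y n i" using elim(2) that by auto
      then show "0 \<le> y n i" using x[OF that] by linarith
    qed
    have "map (y n) [0..<k] \<in> cycle_space \<longleftrightarrow> map x [0..<k] \<in> cycle_space"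
      unfolding cycle_space_iff using k elim(1) pos by (auto simp del: upt_Suc)
    moreover have "map (grid_floor m) (map (y n) [0..<k]) = map (grid_floor m) (map x [0..<k])"
      using elim(1) by simp
    ultimately show ?case by (simp add: grid_cell_def del: map_map)
  qed
qed

definition grid_list :: "nat \<Rightarrow> real list list" where
  "grid_list m = (SOME qs. set qs = grid m \<and> distinct qs)"

lemma grid_list: "set (grid_list m) = grid m" "distinct (grid_list m)"
  using someI_ex[OF finite_distinct_list[OF finite_grid[of m]]] by (simp_all add: grid_list_def)

text \<open>For point measures the cell masses are natural numbers, and rounding only changes their
  type.\<close>

definition grid_counts :: "nat \<Rightarrow> real list measure \<Rightarrow> nat list" where
  "grid_counts m \<nu> = map (\<lambda>q. nat \<lfloor>measure \<nu> (grid_cell m q)\<rfloor>) (grid_list m)"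

text \<open>The argument is a list of counts and not a measure, so that every functional of the
  result is a function on the countable type \<open>nat list\<close>, where measurability is
  automatic.\<close>

definition grid_measure :: "nat \<Rightarrow> nat list \<Rightarrow> real list measure" where
  "grid_measure m c = distr (point_measure {..<length (grid_list m)} (\<lambda>i. ennreal (real (c ! i)))) cycle_borel
     (\<lambda>i. grid_list m ! i)"

text \<open>The discretization moved from the measure to the integrand: if all cell masses of the
  original measure are natural, integrating \<open>f\<close> against the discretized measure amounts
  to integrating \<open>coarsen f m\<close> against the original one.\<close>

definition coarsen :: "(real list \<Rightarrow> real) \<Rightarrow> nat \<Rightarrow> real list \<Rightarrow> real" where
  "coarsen f m xs = (if length xs \<le> m then f (map (grid_floor m) xs) else 0)"

lemma grid_list_nth: "i < length (grid_list m) \<Longrightarrow> grid_list m ! i \<in> grid m"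
  using grid_list(1)[of m] nth_mem by blast

lemma sum_grid: "(\<Sum>q\<in>grid m. h q) = (\<Sum>i<length (grid_list m). h (grid_list m ! i))"
  using sum.reindex_bij_betw[OF bij_betw_nth[OF grid_list(2) refl refl, of m], of h] grid_list(1)[of m]
  by simp

lemma grid_list_measurable:
  "(\<lambda>i. grid_list m ! i) \<in> point_measure {..<length (grid_list m)} w \<rightarrow>\<^sub>M cycle_borel"
  using grid_list_nth grid_subset by (auto simp: measurable_def sets_point_measure space_point_measure)

lemma grid_measure_locally_finite: "grid_measure m c \<in> locally_finite_measures"
proof -
  have "emeasure (grid_measure m c) B < \<infinity>" if "B \<in> sets cycle_borel" for B
  proof -
    let ?L = "{..<length (grid_list m)}"
    have "emeasure (grid_measure m c) B =
        emeasure (point_measure ?L (\<lambda>i. ennreal (real (c ! i)))) ((\<lambda>i. grid_list m ! i) -` B \<inter> ?L)"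
      unfolding grid_measure_def using that by (subst emeasure_distr[OF grid_list_measurable]) (auto simp: space_point_measure)
    also have "\<dots> = (\<Sum>i\<in>(\<lambda>i. grid_list m ! i) -` B \<inter> ?L. ennreal (real (c ! i)))"
      by (rule emeasure_point_measure_finite) auto
    also have "\<dots> < \<infinity>" by simp
    finally show ?thesis .
  qed
  then show ?thesis by (auto simp: locally_finite_measures_def grid_measure_def)
qed

lemma integral_grid_measure:
  assumes "f \<in> borel_measurable cycle_borel"
  shows "(\<integral>x. f x \<partial>grid_measure m c) = (\<Sum>i<length (grid_list m). real (c ! i) * f (grid_list m ! i))"
  unfolding grid_measure_def using assms
  by (simp add: integral_distr[OF grid_list_measurable] lebesgue_integral_point_measure_finite)

lemma length_le_sets: "{xs \<in> cycle_space. length xs \<le> K} \<in> sets cycle_borel"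
proof -
  \<comment> \<open>\<open>xs ! 0 < 2\<close> holds on the whole space; it gives the condition on
    the length the shape of \<open>coordinate_less_sets\<close>.\<close>
  have "{xs \<in> cycle_space. length xs \<le> K} = (\<Union>k\<in>{1..K}. {xs \<in> cycle_space. length xs = k \<and> xs ! 0 < 2})"
  proof -
    have "1 \<le> length xs \<and> xs ! 0 < 2" if "xs \<in> cycle_space" for xs
    proof -
      have "xs \<noteq> []" "\<forall>i<length xs. xs ! i \<le> 1" using that by (auto simp: cycle_space_iff)
      then show ?thesis by (cases xs) auto
    qed
    then show ?thesis by auto
  qed
  also have "\<dots> \<in> sets cycle_borel" by (intro sets.finite_UN coordinate_less_sets) auto
  finally show ?thesis .
qed

lemma locally_finite_space:
  assumes "\<nu> \<in> locally_finite_measures"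
  shows "sets \<nu> = sets cycle_borel" "space \<nu> = cycle_space"
  using assms sets_eq_imp_space_eq[of \<nu> cycle_borel] by (auto simp: locally_finite_measures_def)

lemma locally_finite_length_le:
  "\<nu> \<in> locally_finite_measures \<Longrightarrow> emeasure \<nu> {xs \<in> cycle_space. length xs \<le> K} < \<infinity>"
  using length_le_sets[of K] mbounded_length_le[of K] by (auto simp: locally_finite_measures_def)

lemma locally_finite_grid_cell:
  assumes "\<nu> \<in> locally_finite_measures"
  shows "emeasure \<nu> (grid_cell m q) < \<infinity>"
proof -
  have "emeasure \<nu> (grid_cell m q) \<le> emeasure \<nu> {xs \<in> cycle_space. length xs \<le> length q}"
    using length_le_sets assms by (intro emeasure_mono) (auto simp: grid_cell_def locally_finite_space)
  then show ?thesis using locally_finite_length_le[OF assms] by (rule le_less_trans)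
qed

lemma coarsen_eq_sum:
  assumes "xs \<in> cycle_space"
  shows "coarsen f m xs = (\<Sum>q\<in>grid m. f q * indicat_real (grid_cell m q) xs)"
proof -
  have "(\<Sum>q\<in>grid m. f q * indicat_real (grid_cell m q) xs) =
      (\<Sum>q\<in>grid m. if map (grid_floor m) xs = q then f q else 0)"
    using assms by (intro sum.cong) (auto simp: grid_cell_def)
  also have "\<dots> = (if map (grid_floor m) xs \<in> grid m then f (map (grid_floor m) xs) else 0)"
    by (simp add: finite_grid)
  also have "map (grid_floor m) xs \<in> grid m \<longleftrightarrow> length xs \<le> m"
    using assms grid_subset[of "map (grid_floor m) xs" m] by (auto simp: grid_def)
  finally show ?thesis by (simp add: coarsen_def)
qed

lemma coarsen_measurable: "coarsen f m \<in> borel_measurable cycle_borel"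
proof -
  have "(\<lambda>xs. \<Sum>q\<in>grid m. f q * indicat_real (grid_cell m q) xs) \<in> borel_measurable cycle_borel"
    using grid_cell_sets by (intro borel_measurable_sum borel_measurable_times borel_measurable_const borel_measurable_indicator)
  then show ?thesis by (subst measurable_cong[OF coarsen_eq_sum]) auto
qed

lemma integral_grid_measure_counts:
  assumes \<nu>: "\<nu> \<in> locally_finite_measures" and nat: "\<And>q. q \<in> grid m \<Longrightarrow> measure \<nu> (grid_cell m q) \<in> \<nat>"
    and f: "f \<in> borel_measurable cycle_borel"
  shows "(\<integral>x. f x \<partial>grid_measure m (grid_counts m \<nu>)) = (\<integral>x. coarsen f m x \<partial>\<nu>)"
proof -
  have count: "real (grid_counts m \<nu> ! i) = measure \<nu> (grid_cell m (grid_list m ! i))"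
    if i: "i < length (grid_list m)" for i
  proof -
    obtain z where "measure \<nu> (grid_cell m (grid_list m ! i)) = real z"
      using nat[OF grid_list_nth[OF i]] by (auto elim: Nats_cases)
    then show ?thesis using i by (simp add: grid_counts_def)
  qed
  have "(\<integral>x. coarsen f m x \<partial>\<nu>) = (\<integral>x. (\<Sum>q\<in>grid m. f q * indicat_real (grid_cell m q) x) \<partial>\<nu>)"
    using locally_finite_space[OF \<nu>] by (intro Bochner_Integration.integral_cong) (auto simp: coarsen_eq_sum)
  also have "\<dots> = (\<Sum>q\<in>grid m. \<integral>x. f q * indicat_real (grid_cell m q) x \<partial>\<nu>)"
    using locally_finite_grid_cell[OF \<nu>] locally_finite_space[OF \<nu>] grid_cell_sets
    by (intro Bochner_Integration.integral_sum integrable_mult_right) auto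
  also have "\<dots> = (\<Sum>q\<in>grid m. f q * measure \<nu> (grid_cell m q))"
  proof (rule sum.cong[OF refl])
    fix q
    have "grid_cell m q \<inter> space \<nu> = grid_cell m q" using locally_finite_space[OF \<nu>] by (auto simp: grid_cell_def)
    then show "(\<integral>x. f q * indicat_real (grid_cell m q) x \<partial>\<nu>) = f q * measure \<nu> (grid_cell m q)" by simp
  qed
  also have "\<dots> = (\<integral>x. f x \<partial>grid_measure m (grid_counts m \<nu>))"
    unfolding integral_grid_measure[OF f] sum_grid by (rule sum.cong) (auto simp: count)
  finally show ?thesis by simp
qed

lemma grid_floor_tendsto:
  assumes m: "filterlim m sequentially F" and x: "(x \<longlongrightarrow> a) F"
  shows "((\<lambda>j. grid_floor (m j) (x j)) \<longlongrightarrow> a) F"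
proof (rule tendsto_sandwich)
  have "((\<lambda>j. 1 / real (Suc (m j))) \<longlongrightarrow> 0) F"
    using filterlim_compose[OF LIMSEQ_Suc[OF lim_1_over_n] m] by simp
  from tendsto_diff[OF x this] show "((\<lambda>j. x j - 1 / real (Suc (m j))) \<longlongrightarrow> a) F" by simp
qed (use x grid_floor_bounds in auto)

text \<open>Point and mesh vary together, since in the compactness argument the configurations and
  their mesh indices run along one subsequence.\<close>

lemma coarsen_tendsto:
  assumes f: "f \<in> vague_test_functions" and y: "y \<in> cycle_space"
    and ys: "\<forall>\<^sub>F j in F. ys j \<in> cycle_space \<and> length (ys j) = length y"
    and lim: "\<And>i. i < length y \<Longrightarrow> ((\<lambda>j. ys j ! i) \<longlongrightarrow> y ! i) F"
    and m: "filterlim m sequentially F"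
  shows "((\<lambda>j. coarsen f (m j) (ys j)) \<longlongrightarrow> f y) F"
proof -
  have "((\<lambda>j. f (map (grid_floor (m j)) (ys j))) \<longlongrightarrow> f y) F"
  proof (rule test_function_tendsto[OF f y])
    show "\<forall>\<^sub>F j in F. map (grid_floor (m j)) (ys j) \<in> cycle_space \<and> length (map (grid_floor (m j)) (ys j)) = length y"
      using ys by eventually_elim (simp add: map_grid_floor_cycle_space)
    fix i assume i: "i < length y"
    have "((\<lambda>j. grid_floor (m j) (ys j ! i)) \<longlongrightarrow> y ! i) F" by (rule grid_floor_tendsto[OF m lim[OF i]])
    moreover have "\<forall>\<^sub>F j in F. grid_floor (m j) (ys j ! i) = map (grid_floor (m j)) (ys j) ! i"
      using ys by eventually_elim (simp add: i)
    ultimately show "((\<lambda>j. map (grid_floor (m j)) (ys j) ! i) \<longlongrightarrow> y ! i) F" by (rule Lim_transform_eventually)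
  qed
  moreover have "\<forall>\<^sub>F j in F. m j \<ge> length y" using m by (simp add: filterlim_at_top)
  then have "\<forall>\<^sub>F j in F. f (map (grid_floor (m j)) (ys j)) = coarsen f (m j) (ys j)"
    using ys by eventually_elim (simp add: coarsen_def)
  ultimately show ?thesis by (rule Lim_transform_eventually)
qed

lemma coarsen_eq_0:
  assumes "\<forall>xs\<in>cycle_space. length xs > K \<longrightarrow> f xs = 0" "xs \<in> cycle_space" "length xs > K"
  shows "coarsen f m xs = 0"
  using assms map_grid_floor_cycle_space[of xs m] by (simp add: coarsen_def)

text \<open>Convergence for one fixed measure, which serves the realizations of the Poisson measure.
  The configurations of \<Psi>_n change with \<open>n\<close> and call for
  \<open>uniform_discretization\<close>.\<close>

lemma grid_measure_limitin:
  assumes \<nu>: "\<nu> \<in> locally_finite_measures" and nat: "\<And>m q. q \<in> grid m \<Longrightarrow> measure \<nu> (grid_cell m q) \<in> \<nat>"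
  shows "limitin vague_topology (\<lambda>m. grid_measure m (grid_counts m \<nu>)) \<nu> sequentially"
proof (rule limitin_vague_topology[OF \<nu>])
  fix f assume f: "f \<in> vague_test_functions"
  obtain K where K: "\<forall>xs\<in>cycle_space. length xs > K \<longrightarrow> f xs = 0" using test_function_support[OF f] by blast
  obtain C where C: "\<forall>xs\<in>cycle_space. \<bar>f xs\<bar> \<le> C" using test_function_bounded[OF f] by blast
  let ?w = "\<lambda>x. \<bar>C\<bar> * indicat_real {xs \<in> cycle_space. length xs \<le> K} x"
  note sp = locally_finite_space[OF \<nu>]
  have "(\<lambda>m. \<integral>x. coarsen f m x \<partial>\<nu>) \<longlonglongrightarrow> (\<integral>x. f x \<partial>\<nu>)"
  proof (rule integral_dominated_convergence[where w = ?w])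
    show "f \<in> borel_measurable \<nu>" "coarsen f m \<in> borel_measurable \<nu>" for m
      using test_function_measurable[OF f] coarsen_measurable measurable_cong_sets[OF sp(1) refl] by blast+
    show "integrable \<nu> ?w"
      using locally_finite_length_le[OF \<nu>] length_le_sets sp by (intro integrable_mult_right) auto
    show "AE x in \<nu>. (\<lambda>m. coarsen f m x) \<longlonglongrightarrow> f x"
      by (rule AE_I2, rule coarsen_tendsto[OF f]) (auto simp: sp filterlim_ident)
    show "AE x in \<nu>. norm (coarsen f m x) \<le> ?w x" for m
    proof (rule AE_I2)
      fix x assume "x \<in> space \<nu>"
      then have x: "x \<in> cycle_space" by (simp add: sp)
      show "norm (coarsen f m x) \<le> ?w x"
      proof (cases "length x \<le> K")
        case True
        have "\<bar>coarsen f m x\<bar> \<le> \<bar>C\<bar>"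
          using C map_grid_floor_cycle_space[OF x, of m] by (auto simp: coarsen_def intro: order_trans)
        then show ?thesis using True x by simp
      next
        case False
        then show ?thesis using coarsen_eq_0[OF K x] by simp
      qed
    qed
  qed
  then show "(\<lambda>m. \<integral>x. f x \<partial>grid_measure m (grid_counts m \<nu>)) \<longlonglongrightarrow> (\<integral>x. f x \<partial>\<nu>)"
    by (simp add: integral_grid_measure_counts[OF \<nu> nat test_function_measurable[OF f]])
qed (simp add: grid_measure_locally_finite)

text \<open>Padding with zeros to a fixed number of slots allows limits to be taken slot by
  slot.\<close>

lemma sum_list_nth_bounded:
  fixes h :: "'a \<Rightarrow> real"
  assumes "length xs \<le> a"
  shows "(\<Sum>x\<leftarrow>xs. h x) = (\<Sum>l<a. if l < length xs then h (xs ! l) else 0)"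
proof -
  have "(\<Sum>x\<leftarrow>xs. h x) = (\<Sum>l<length xs. h (xs ! l))"
    by (simp add: sum_list_sum_nth atLeast0LessThan)
  also have "\<dots> = (\<Sum>l<a. if l < length xs then h (xs ! l) else 0)"
    using assms by (intro sum.mono_neutral_cong_left) auto
  finally show ?thesis .
qed

text \<open>Continuous convergence along points of constant length. The constant sequence
  \<open>f\<close> and the coarsenings of \<open>f\<close> are both instances, so a single
  compactness lemma treats configurations and their discretizations.\<close>

definition continuously_convergent :: "(nat \<Rightarrow> real list \<Rightarrow> real) \<Rightarrow> (real list \<Rightarrow> real) \<Rightarrow> bool" where
  "continuously_convergent \<phi> f \<longleftrightarrow>
    (\<forall>y zs. y \<in> cycle_space \<and> (\<forall>\<^sub>F j in sequentially. zs j \<in> cycle_space \<and> length (zs j) = length y) \<and>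
      (\<forall>i<length y. (\<lambda>j. zs j ! i) \<longlonglongrightarrow> y ! i) \<longrightarrow> (\<lambda>j. \<phi> j (zs j)) \<longlonglongrightarrow> f y)"

text \<open>A configuration with at most \<open>a k\<close> points in \<open>cycle_cell k\<close> is coded by all its coordinates,
  \<open>-1\<close> marking unused slots. The codes live in a countable product of compact intervals, and whether a
  slot is used in the limit can be read off the sign of its first coordinate.\<close>

lemma configurations_subsequence:
  fixes ys :: "nat \<Rightarrow> nat \<Rightarrow> real list list" and a :: "nat \<Rightarrow> nat"
  assumes cell: "\<And>j k y. k \<ge> 1 \<Longrightarrow> y \<in> set (ys j k) \<Longrightarrow> y \<in> cycle_cell k"
    and len: "\<And>j k. k \<ge> 1 \<Longrightarrow> length (ys j k) \<le> a k"
  shows "\<exists>r \<nu>. strict_mono r \<and> \<nu> \<in> locally_finite_measures \<and>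
    (\<forall>f K \<phi>. f \<in> vague_test_functions \<and> (\<forall>xs\<in>cycle_space. length xs > K \<longrightarrow> f xs = 0) \<and>
      continuously_convergent \<phi> f \<longrightarrow>
      (\<lambda>j. \<Sum>k=1..K. \<Sum>y\<leftarrow>ys (r j) k. \<phi> j y) \<longlonglongrightarrow> (\<integral>x. f x \<partial>\<nu>))"
proof -
  define used where "used j k l \<longleftrightarrow> k \<ge> 1 \<and> l < length (ys j k)" for j k l
  define code where "code j = (\<lambda>(k, l, i). if used j k l \<and> i < k then ys j k ! l ! i else -1)" for j
  have used_cell: "ys j k ! l \<in> cycle_cell k" if "used j k l" for j k l
    using that cell nth_mem unfolding used_def by blast
  then have coord: "length (ys j k ! l) = k" "\<And>i. i < k \<Longrightarrow> 0 \<le> ys j k ! l ! i \<and> ys j k ! l ! i \<le> 1 \<and> ys j k ! l ! 0 \<le> ys j k ! l ! i"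
    if "used j k l" for j k l
    using that cycle_cell_iff[of k "ys j k ! l"] by (auto simp: used_def)
  have "code j \<in> PiE UNIV (\<lambda>_. {-1..1})" for j
  proof -
    have "code j (k, l, i) \<in> {-1..1}" for k l i
      using coord(2)[of j k l i] by (auto simp: code_def)
    then show ?thesis by auto
  qed
  moreover have "seq_compact (PiE UNIV (\<lambda>_ :: nat \<times> nat \<times> nat. {-1..1::real}))"
    by (rule compact_imp_seq_compact[OF compact_cube])
  ultimately obtain c r where r: "strict_mono r" "(code \<circ> r) \<longlonglongrightarrow> c"
    unfolding seq_compact_def by metis
  have lim: "(\<lambda>j. code (r j) p) \<longlonglongrightarrow> c p" for p
    using continuous_on_tendsto_compose[OF continuous_on_product_coordinates[of p], of "code \<circ> r" c] r(2) by auto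
  define A where "A = {(k, l). k \<ge> 1 \<and> c (k, l, 0) \<ge> 0}"
  define Y where "Y = (\<lambda>(k, l). map (\<lambda>i. c (k, l, i)) [0..<k])"
  have A_used: "\<forall>\<^sub>F j in sequentially. used (r j) k l" if "(k, l) \<in> A" for k l
  proof -
    have "- 1 < c (k, l, 0)" using that by (simp add: A_def)
    from order_tendstoD(1)[OF lim this] show ?thesis
      by eventually_elim (auto simp: code_def split: if_splits)
  qed
  have not_A_unused: "\<forall>\<^sub>F j in sequentially. \<not> used (r j) k l" if "(k, l) \<notin> A" "k \<ge> 1" for k l
  proof -
    have "c (k, l, 0) < 0" using that by (simp add: A_def)
    from order_tendstoD(2)[OF lim this] show ?thesis
    proof eventually_elim
      case (elim j)
      then show ?case using coord(2)[of "r j" k l 0] that(2) by (auto simp: code_def)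
    qed
  qed
  \<comment> \<open>A slot used in the limit was used at some stage, where the bound
    \<open>a k\<close> is known.\<close>
  have A_bound: "1 \<le> k" "l < a k" if kl: "(k, l) \<in> A" for k l
  proof -
    show "1 \<le> k" using kl by (simp add: A_def)
    obtain j where "used (r j) k l"
      using A_used[OF kl] eventually_happens'[OF sequentially_bot] by blast
    then show "l < a k" using len[of k "r j"] by (auto simp: used_def)
  qed
  have Y: "Y (k, l) \<in> cycle_space" "length (Y (k, l)) = k"
    and Y_lim: "\<And>i. i < k \<Longrightarrow> (\<lambda>j. ys (r j) k ! l ! i) \<longlonglongrightarrow> Y (k, l) ! i" if kl: "(k, l) \<in> A" for k l
  proof -
    show "length (Y (k, l)) = k" by (simp add: Y_def)
    show Y_lim: "(\<lambda>j. ys (r j) k ! l ! i) \<longlonglongrightarrow> Y (k, l) ! i" if i: "i < k" for i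
    proof -
      have "\<forall>\<^sub>F j in sequentially. code (r j) (k, l, i) = ys (r j) k ! l ! i"
        using A_used[OF kl] by eventually_elim (simp add: code_def i)
      from Lim_transform_eventually[OF lim this] show ?thesis using i by (simp add: Y_def)
    qed
    have k: "k \<ge> 1" by (rule A_bound[OF kl])
    have "0 \<le> Y (k, l) ! i \<and> Y (k, l) ! i \<le> 1 \<and> Y (k, l) ! 0 \<le> Y (k, l) ! i" if i: "i < k" for i
    proof (intro conjI)
      have ev: "\<forall>\<^sub>F j in sequentially. 0 \<le> ys (r j) k ! l ! i \<and> ys (r j) k ! l ! i \<le> 1 \<and> ys (r j) k ! l ! 0 \<le> ys (r j) k ! l ! i"
        using A_used[OF kl] by eventually_elim (use coord(2) i in blast)
      show "0 \<le> Y (k, l) ! i"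
        by (rule tendsto_lowerbound[OF Y_lim[OF i]]) (use ev in \<open>auto elim: eventually_mono\<close>)
      show "Y (k, l) ! i \<le> 1"
        by (rule tendsto_upperbound[OF Y_lim[OF i]]) (use ev in \<open>auto elim: eventually_mono\<close>)
      show "Y (k, l) ! 0 \<le> Y (k, l) ! i"
        by (rule tendsto_le[OF _ Y_lim[OF i] Y_lim[of 0]]) (use ev k in \<open>auto elim: eventually_mono\<close>)
    qed
    then show "Y (k, l) \<in> cycle_space" using k by (auto simp: cycle_space_iff Y_def)
  qed
  have Y_meas: "Y \<in> count_space A \<rightarrow>\<^sub>M cycle_borel" using Y(1) by auto
  \<comment> \<open>Slots are counted and not points, so points that merge in the limit keep their
    multiplicity.\<close>
  define \<nu> where "\<nu> = distr (count_space A) cycle_borel Y"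
  have finA: "finite {p \<in> A. fst p \<le> K}" for K
  proof (rule finite_subset)
    show "{p \<in> A. fst p \<le> K} \<subseteq> (SIGMA k:{..K}. {..<a k})" using A_bound by auto
  qed auto
  have "\<nu> \<in> locally_finite_measures"
  proof -
    have "emeasure \<nu> B < \<infinity>" if B: "B \<in> sets cycle_borel" "cycle_bounded B" for B
    proof -
      obtain K where K: "\<forall>xs\<in>B. length xs \<le> K" using mbounded_lengthD[OF B(2)] by blast
      have "finite (Y -` B \<inter> A)"
        by (rule finite_subset[OF _ finA[of K]]) (use K Y(2) in force)
      then have "emeasure (count_space A) (Y -` B \<inter> A) < \<infinity>"
        by (subst emeasure_count_space_finite) (auto simp: of_nat_less_top)
      then show ?thesis using B(1) by (simp add: \<nu>_def emeasure_distr[OF Y_meas])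
    qed
    then show ?thesis by (simp add: locally_finite_measures_def \<nu>_def)
  qed
  moreover have "(\<lambda>j. \<Sum>k=1..K. \<Sum>y\<leftarrow>ys (r j) k. \<phi> j y) \<longlonglongrightarrow> (\<integral>x. f x \<partial>\<nu>)"
    if f: "f \<in> vague_test_functions" and K: "\<forall>xs\<in>cycle_space. length xs > K \<longrightarrow> f xs = 0"
      and \<phi>: "continuously_convergent \<phi> f" for f K \<phi>
  proof -
    have supp: "k \<le> K" if "(k, l) \<in> A" "f (Y (k, l)) \<noteq> 0" for k l
    proof -
      have "\<not> K < length (Y (k, l))" using K Y(1)[OF that(1)] that(2) by auto
      then show ?thesis by (simp add: Y(2)[OF that(1)])
    qed
    then have "{p \<in> A. f (Y p) \<noteq> 0} \<subseteq> {p \<in> A. fst p \<le> K}" by auto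
    then have fin: "finite {p \<in> A. f (Y p) \<noteq> 0}" using finA finite_subset by blast
    have "(\<integral>x. f x \<partial>\<nu>) = (\<integral>p. f (Y p) \<partial>count_space A)"
      unfolding \<nu>_def by (rule integral_distr[OF Y_meas test_function_measurable[OF f]])
    also have "\<dots> = (\<Sum>p | p \<in> A \<and> f (Y p) \<noteq> 0. f (Y p))"
      by (rule lebesgue_integral_count_space_finite_support[OF fin])
    \<comment> \<open>The index set no longer depends on which slots are used, so that termwise
      limits suffice.\<close>
    also have "\<dots> = (\<Sum>p\<in>(SIGMA k:{1..K}. {..<a k}). if p \<in> A then f (Y p) else 0)"
    proof (rule sum.mono_neutral_cong_left)
      show "{p \<in> A. f (Y p) \<noteq> 0} \<subseteq> (SIGMA k:{1..K}. {..<a k})"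
        using A_bound supp by auto
    qed auto
    also have "\<dots> = (\<Sum>k=1..K. \<Sum>l<a k. if (k, l) \<in> A then f (Y (k, l)) else 0)"
      by (subst sum.Sigma) auto
    finally have int: "(\<integral>x. f x \<partial>\<nu>) = (\<Sum>k=1..K. \<Sum>l<a k. if (k, l) \<in> A then f (Y (k, l)) else 0)" .
    have "(\<Sum>k=1..K. \<Sum>y\<leftarrow>ys (r j) k. \<phi> j y) =
        (\<Sum>k=1..K. \<Sum>l<a k. if used (r j) k l then \<phi> j (ys (r j) k ! l) else 0)" for j
      using len by (intro sum.cong) (auto simp: sum_list_nth_bounded used_def)
    moreover have "(\<lambda>j. if used (r j) k l then \<phi> j (ys (r j) k ! l) else 0) \<longlonglongrightarrow>
        (if (k, l) \<in> A then f (Y (k, l)) else 0)" if k: "k \<ge> 1" for k l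
    proof (cases "(k, l) \<in> A")
      case True
      have "(\<lambda>j. \<phi> j (ys (r j) k ! l)) \<longlonglongrightarrow> f (Y (k, l))"
      proof (rule \<phi>[unfolded continuously_convergent_def, rule_format], intro conjI allI impI)
        show "Y (k, l) \<in> cycle_space" using Y True by blast
        show "\<forall>\<^sub>F j in sequentially. ys (r j) k ! l \<in> cycle_space \<and> length (ys (r j) k ! l) = length (Y (k, l))"
          using A_used[OF True]
        proof eventually_elim
          case (elim j)
          then show ?case using used_cell[OF elim] cycle_cell_subset_space[OF k] coord(1)[OF elim] Y(2)[OF True] by auto
        qed
        show "(\<lambda>j. ys (r j) k ! l ! i) \<longlonglongrightarrow> Y (k, l) ! i" if "i < length (Y (k, l))" for i
          using Y_lim[OF True] Y(2)[OF True] that by auto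
      qed
      moreover have "\<forall>\<^sub>F j in sequentially. \<phi> j (ys (r j) k ! l) = (if used (r j) k l then \<phi> j (ys (r j) k ! l) else 0)"
        using A_used[OF True] by eventually_elim simp
      ultimately show ?thesis using True by (simp add: Lim_transform_eventually)
    next
      case False
      have "\<forall>\<^sub>F j in sequentially. (if used (r j) k l then \<phi> j (ys (r j) k ! l) else 0) = 0"
        using not_A_unused[OF False k] by eventually_elim simp
      then show ?thesis using False by (simp add: tendsto_eventually)
    qed
    ultimately show ?thesis unfolding int by (simp only:) (intro tendsto_sum, simp)
  qed
  ultimately show ?thesis using r(1) by (intro exI[of _ r] exI[of _ \<nu>] conjI allI impI) blast+
qed

section \<open>Cycle configurations of permutations and their uniform discretization\<close>

lemma scaled_cycle_tuple:
  assumes "t \<in> cycle_tuples n \<pi>"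
  shows "rescale n t \<in> cycle_space"
proof -
  have t: "t \<noteq> []" "set t \<subseteq> {1..n}" "Min (set t) = hd t"
    using assms by (auto simp: cycle_tuples_def)
  have nth: "t ! i \<in> {1..n}" "t ! 0 \<le> t ! i" if "i < length t" for i
  proof -
    show "t ! i \<in> {1..n}" using t(2) nth_mem[OF that] by blast
    show "t ! 0 \<le> t ! i" using t(1,3) that Min_le[of "set t" "t ! i"] by (simp add: hd_conv_nth)
  qed
  then show ?thesis
    using t(1) by (fastforce simp: cycle_space_iff nth_map[of 0] divide_le_eq intro!: divide_right_mono)
qed

lemma cycle_cell_iff_length: "xs \<in> cycle_space \<Longrightarrow> xs \<in> cycle_cell k \<longleftrightarrow> length xs = k"
  by (auto simp: cycle_space_def cycle_cell_def)

lemma scaled_measurable: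
  "rescale n \<in> count_space (cycle_tuples n \<pi>) \<rightarrow>\<^sub>M cycle_borel"
  using scaled_cycle_tuple by auto

lemma cycle_point_measure_locally_finite: "cycle_point_measure n \<pi> \<in> locally_finite_measures"
proof -
  have "emeasure (cycle_point_measure n \<pi>) B < \<infinity>" if "B \<in> sets cycle_borel" for B
    unfolding emeasure_cycle_point_measure[OF that]
    by (simp add: finite_cycle_tuples indicator_def of_nat_less_top split: if_splits)
  then show ?thesis by (auto simp: locally_finite_measures_def cycle_point_measure_def)
qed

lemma integral_cycle_point_measure:
  fixes f :: "real list \<Rightarrow> real"
  assumes "f \<in> borel_measurable cycle_borel"
  shows "(\<integral>x. f x \<partial>cycle_point_measure n \<pi>) = (\<Sum>t\<in>cycle_tuples n \<pi>. f (rescale n t))"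
  unfolding cycle_point_measure_def integral_distr[OF scaled_measurable assms]
  by (simp add: lebesgue_integral_count_space_finite finite_cycle_tuples)

lemma measure_cycle_point_measure:
  assumes "B \<in> sets cycle_borel"
  shows "measure (cycle_point_measure n \<pi>) B = real (cell_count n B \<pi>)"
proof -
  have "emeasure (cycle_point_measure n \<pi>) B = of_nat (cell_count n B \<pi>)"
    unfolding emeasure_cycle_point_measure[OF assms] cell_count_def
    by (simp add: finite_cycle_tuples sum.If_cases indicator_def Int_def)
  then show ?thesis by (simp add: measure_def)
qed

text \<open>By contradiction: along a subsequence the offending configurations and their
  discretizations converge to the same \<open>\<nu>\<close>, so the values of \<open>g\<close> at
  both approach \<open>g \<nu>\<close>. The offending \<open>n\<close> and \<open>\<pi>\<close> may
  vary freely along the sequence, whence the uniformity.\<close>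

lemma uniform_discretization:
  assumes g: "continuous_map vague_topology euclideanreal g" and e: "e > 0"
  shows "\<exists>m0. \<forall>m\<ge>m0. \<forall>n \<pi>. (\<forall>k\<ge>1. cell_count n (cycle_cell k) \<pi> \<le> a k) \<longrightarrow>
    \<bar>g (cycle_point_measure n \<pi>) - g (grid_measure m (grid_counts m (cycle_point_measure n \<pi>)))\<bar> < e"
proof (rule ccontr)
  let ?\<psi> = cycle_point_measure
  assume "\<not> ?thesis"
  then have "\<forall>m0. \<exists>m n \<pi>. m \<ge> m0 \<and> (\<forall>k\<ge>1. cell_count n (cycle_cell k) \<pi> \<le> a k) \<and>
      \<not> \<bar>g (?\<psi> n \<pi>) - g (grid_measure m (grid_counts m (?\<psi> n \<pi>)))\<bar> < e"
    by blast
  then obtain m n \<pi> where m: "\<And>j. m j \<ge> j" and count: "\<And>j k. k \<ge> 1 \<Longrightarrow> cell_count (n j) (cycle_cell k) (\<pi> j) \<le> a k"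
    and far: "\<And>j. \<not> \<bar>g (?\<psi> (n j) (\<pi> j)) - g (grid_measure (m j) (grid_counts (m j) (?\<psi> (n j) (\<pi> j))))\<bar> < e"
    by metis
  define T where "T j k = {t \<in> cycle_tuples (n j) (\<pi> j). length t = k}" for j k
  have finT: "finite (T j k)" for j k by (simp add: T_def finite_cycle_tuples)
  define ts where "ts j k = (SOME xs. set xs = T j k \<and> distinct xs)" for j k
  have ts: "set (ts j k) = T j k" "distinct (ts j k)" for j k
    using someI_ex[OF finite_distinct_list[OF finT[of j k]]] by (simp_all add: ts_def)
  define ys where "ys j k = map (rescale (n j)) (ts j k)" for j k
  have T_cell: "T j k = {t \<in> cycle_tuples (n j) (\<pi> j). rescale (n j) t \<in> cycle_cell k}" for j k
    using cycle_cell_iff_length[OF scaled_cycle_tuple] by (auto simp: T_def)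
  have sum_ys: "(\<Sum>k=1..K. \<Sum>y\<leftarrow>ys j k. h y) = (\<integral>x. h x \<partial>?\<psi> (n j) (\<pi> j))"
    if h: "h \<in> borel_measurable cycle_borel" "\<And>xs. xs \<in> cycle_space \<Longrightarrow> length xs > K \<Longrightarrow> h xs = 0" for h :: "real list \<Rightarrow> real" and K j
  proof -
    let ?h = "\<lambda>t. h (rescale (n j) t)"
    have "(\<Sum>k=1..K. \<Sum>y\<leftarrow>ys j k. h y) = (\<Sum>k=1..K. \<Sum>t\<in>T j k. ?h t)"
      by (simp add: ys_def o_def sum_list_distinct_conv_sum_set ts)
    also have "\<dots> = (\<Sum>t\<in>(\<Union>k\<in>{1..K}. T j k). ?h t)"
      using finT by (intro sum.UNION_disjoint[symmetric]) (auto simp: T_def)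
    also have "\<dots> = (\<Sum>t\<in>cycle_tuples (n j) (\<pi> j). ?h t)"
    proof (rule sum.mono_neutral_left)
      show "\<forall>t\<in>cycle_tuples (n j) (\<pi> j) - (\<Union>k\<in>{1..K}. T j k). ?h t = 0"
      proof
        fix t assume t: "t \<in> cycle_tuples (n j) (\<pi> j) - (\<Union>k\<in>{1..K}. T j k)"
        then have "t \<noteq> []" by (simp add: cycle_tuples_def)
        then have "1 \<le> length t" by (cases t) auto
        then have "length t > K" using t by (auto simp: T_def)
        then show "?h t = 0" using t scaled_cycle_tuple by (intro h(2)) auto
      qed
    qed (auto simp: T_def finite_cycle_tuples)
    finally show ?thesis by (simp add: integral_cycle_point_measure h(1))
  qed
  obtain r \<nu> where r: "strict_mono r" and \<nu>: "\<nu> \<in> locally_finite_measures"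
    and conv: "(\<forall>f K \<phi>. f \<in> vague_test_functions \<and> (\<forall>xs\<in>cycle_space. length xs > K \<longrightarrow> f xs = 0) \<and>
      continuously_convergent \<phi> f \<longrightarrow>
      (\<lambda>j. \<Sum>k=1..K. \<Sum>y\<leftarrow>ys (r j) k. \<phi> j y) \<longlonglongrightarrow> (\<integral>x. f x \<partial>\<nu>))"
  proof (rule configurations_subsequence[of ys a, THEN exE])
    show "y \<in> cycle_cell k" if "k \<ge> 1" "y \<in> set (ys j k)" for j k y
      using that by (auto simp: ys_def ts T_cell)
    show "length (ys j k) \<le> a k" if "k \<ge> 1" for j k
      using count[OF that, of j] distinct_card[OF ts(2)[of j k]]
      by (simp add: ys_def ts T_cell cell_count_def)
  qed (elim exE conjE, rule that)
  let ?N = "\<lambda>j. ?\<psi> (n (r j)) (\<pi> (r j))"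
  let ?D = "\<lambda>j. grid_measure (m (r j)) (grid_counts (m (r j)) (?N j))"
  have mr: "filterlim (\<lambda>j. m (r j)) sequentially sequentially"
  proof (rule filterlim_at_top_mono[OF filterlim_subseq[OF r]])
    show "\<forall>\<^sub>F j in sequentially. r j \<le> m (r j)" using m by simp
  qed
  have "limitin vague_topology ?N \<nu> sequentially"
  proof (rule limitin_vague_topology[OF \<nu>])
    fix f assume f: "f \<in> vague_test_functions"
    obtain K where K: "\<forall>xs\<in>cycle_space. length xs > K \<longrightarrow> f xs = 0" using test_function_support[OF f] by blast
    have "(\<lambda>j. \<Sum>k=1..K. \<Sum>y\<leftarrow>ys (r j) k. f y) \<longlonglongrightarrow> (\<integral>x. f x \<partial>\<nu>)"
    proof (rule conv[rule_format], intro conjI)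
      show "continuously_convergent (\<lambda>_. f) f"
        unfolding continuously_convergent_def by (intro allI impI test_function_tendsto[OF f]) auto
    qed (use f K in auto)
    show "(\<lambda>j. \<integral>x. f x \<partial>?N j) \<longlonglongrightarrow> (\<integral>x. f x \<partial>\<nu>)"
    proof -
      have "(\<Sum>k=1..K. \<Sum>y\<leftarrow>ys (r j) k. f y) = (\<integral>x. f x \<partial>?N j)" for j
        by (rule sum_ys[OF test_function_measurable[OF f]]) (use K in blast)
      then show ?thesis using \<open>(\<lambda>j. \<Sum>k=1..K. \<Sum>y\<leftarrow>ys (r j) k. f y) \<longlonglongrightarrow> (\<integral>x. f x \<partial>\<nu>)\<close>
        by (simp only:)
    qed
  qed (simp add: cycle_point_measure_locally_finite)
  moreover have "limitin vague_topology ?D \<nu> sequentially"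
  proof (rule limitin_vague_topology[OF \<nu>])
    fix f assume f: "f \<in> vague_test_functions"
    obtain K where K: "\<forall>xs\<in>cycle_space. length xs > K \<longrightarrow> f xs = 0" using test_function_support[OF f] by blast
    \<comment> \<open>The discretized measures need no subsequence of their own: their integrals are
      those of the coarsened function over the original configurations, so \<open>conv\<close>
      applies again with the same \<open>r\<close> and \<open>\<nu>\<close>.\<close>
    have "(\<lambda>j. \<Sum>k=1..K. \<Sum>y\<leftarrow>ys (r j) k. coarsen f (m (r j)) y) \<longlonglongrightarrow> (\<integral>x. f x \<partial>\<nu>)"
    proof (rule conv[rule_format], intro conjI)
      show "continuously_convergent (\<lambda>j. coarsen f (m (r j))) f"
        unfolding continuously_convergent_def by (intro allI impI coarsen_tendsto[OF f _ _ _ mr]) auto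
    qed (use f K in auto)
    have "(\<lambda>j. \<integral>x. coarsen f (m (r j)) x \<partial>?N j) \<longlonglongrightarrow> (\<integral>x. f x \<partial>\<nu>)"
    proof -
      have "(\<Sum>k=1..K. \<Sum>y\<leftarrow>ys (r j) k. coarsen f (m (r j)) y) =
          (\<integral>x. coarsen f (m (r j)) x \<partial>?N j)" for j
        by (rule sum_ys[OF coarsen_measurable]) (rule coarsen_eq_0[OF K])
      then show ?thesis
        using \<open>(\<lambda>j. \<Sum>k=1..K. \<Sum>y\<leftarrow>ys (r j) k. coarsen f (m (r j)) y) \<longlonglongrightarrow> (\<integral>x. f x \<partial>\<nu>)\<close>
        by (simp only:)
    qed
    then show "(\<lambda>j. \<integral>x. f x \<partial>?D j) \<longlonglongrightarrow> (\<integral>x. f x \<partial>\<nu>)"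
      by (simp add: integral_grid_measure_counts cycle_point_measure_locally_finite measure_cycle_point_measure
          grid_cell_sets test_function_measurable[OF f])
  qed (simp add: grid_measure_locally_finite)
  ultimately have "(\<lambda>j. g (?N j)) \<longlonglongrightarrow> g \<nu>"
    "(\<lambda>j. g (?D j)) \<longlonglongrightarrow> g \<nu>"
    using continuous_map_limit[OF g] by (auto simp: o_def)
  from tendsto_diff[OF this]
  have "(\<lambda>j. \<bar>g (?N j) - g (?D j)\<bar>) \<longlonglongrightarrow> 0"
    by (simp add: tendsto_rabs_zero)
  from order_tendstoD(2)[OF this e] far show False
    using eventually_happens'[OF sequentially_bot] by blast
qed


section \<open>Convergence in distribution\<close>

lemma (in prob_space) expectation_truncation:
  fixes G :: "'c::countable \<Rightarrow> real"
  assumes X: "X \<in> M \<rightarrow>\<^sub>M count_space UNIV" and b: "\<And>c. \<bar>G c\<bar> \<le> b" and F: "finite F"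
  shows "\<bar>(\<integral>\<omega>. G (X \<omega>) \<partial>M) - (\<Sum>c\<in>F. G c * prob {\<omega> \<in> space M. X \<omega> = c})\<bar>
    \<le> b * (1 - (\<Sum>c\<in>F. prob {\<omega> \<in> space M. X \<omega> = c}))"
proof -
  define E where "E c = {\<omega> \<in> space M. X \<omega> = c}" for c
  have E: "E c \<in> events" for c
  proof -
    have "E c = X -` {c} \<inter> space M" by (auto simp: E_def)
    then show ?thesis using X by (simp add: measurable_sets)
  qed
  have G: "(\<lambda>\<omega>. G (X \<omega>)) \<in> borel_measurable M"
    by (rule measurable_compose[OF X]) simp
  have intG: "integrable M (\<lambda>\<omega>. G (X \<omega>))"
    by (rule integrable_const_bound[where B = b]) (use b G in auto)
  have intE: "integrable M (\<lambda>\<omega>. \<Sum>c\<in>F. h c * indicat_real (E c) \<omega>)" for h :: "'c \<Rightarrow> real"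
    using E by (intro Bochner_Integration.integrable_sum integrable_mult_right) (auto simp: less_top[symmetric])
  have int_sum: "(\<integral>\<omega>. (\<Sum>c\<in>F. h c * indicat_real (E c) \<omega>) \<partial>M) = (\<Sum>c\<in>F. h c * prob (E c))" for h :: "'c \<Rightarrow> real"
  proof -
    have "(\<integral>\<omega>. (\<Sum>c\<in>F. h c * indicat_real (E c) \<omega>) \<partial>M) = (\<Sum>c\<in>F. \<integral>\<omega>. h c * indicat_real (E c) \<omega> \<partial>M)"
      using E by (intro Bochner_Integration.integral_sum integrable_mult_right) (auto simp: less_top[symmetric])
    also have "\<dots> = (\<Sum>c\<in>F. h c * prob (E c))"
      using sets.sets_into_space[OF E] by (intro sum.cong) (auto simp: Int_absorb2)
    finally show ?thesis .
  qed
  have sum_ind: "(\<Sum>c\<in>F. h c * indicat_real (E c) \<omega>) = (if X \<omega> \<in> F then h (X \<omega>) else 0)"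
    if "\<omega> \<in> space M" for \<omega> and h :: "'c \<Rightarrow> real"
  proof -
    have "(\<Sum>c\<in>F. h c * indicat_real (E c) \<omega>) = (\<Sum>c\<in>F. if X \<omega> = c then h c else 0)"
      using that by (intro sum.cong) (auto simp: E_def)
    then show ?thesis using F by simp
  qed
  have "(\<integral>\<omega>. G (X \<omega>) \<partial>M) - (\<Sum>c\<in>F. G c * prob (E c)) =
      (\<integral>\<omega>. G (X \<omega>) - (\<Sum>c\<in>F. G c * indicat_real (E c) \<omega>) \<partial>M)"
    by (subst Bochner_Integration.integral_diff[OF intG intE]) (simp add: int_sum)
  \<comment> \<open>The integrand vanishes where \<open>X\<close> lies in \<open>F\<close>;
    elsewhere it is bounded by \<open>b\<close>, and the difference on the right is the indicator of
    this event.\<close>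
  also have "\<bar>\<dots>\<bar> \<le> (\<integral>\<omega>. b * (1 - (\<Sum>c\<in>F. 1 * indicat_real (E c) \<omega>)) \<partial>M)"
  proof (rule integral_abs_bound[THEN order_trans], rule integral_mono)
    show "integrable M (\<lambda>\<omega>. \<bar>G (X \<omega>) - (\<Sum>c\<in>F. G c * indicat_real (E c) \<omega>)\<bar>)"
      using intG intE by (intro integrable_abs Bochner_Integration.integrable_diff)
    show "integrable M (\<lambda>\<omega>. b * (1 - (\<Sum>c\<in>F. 1 * indicat_real (E c) \<omega>)))"
      using intE[of "\<lambda>_. 1"] by (intro integrable_mult_right Bochner_Integration.integrable_diff integrable_const)
    fix \<omega> assume "\<omega> \<in> space M"
    then show "\<bar>G (X \<omega>) - (\<Sum>c\<in>F. G c * indicat_real (E c) \<omega>)\<bar> \<le> b * (1 - (\<Sum>c\<in>F. 1 * indicat_real (E c) \<omega>))"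
      using b[of "X \<omega>"] sum_ind[of \<omega> G] sum_ind[of \<omega> "\<lambda>_. 1"] by simp
  qed
  also have "\<dots> = b * (1 - (\<Sum>c\<in>F. prob (E c)))"
    using intE[of "\<lambda>_. 1"] int_sum[of "\<lambda>_. 1"] by (subst integral_mult_right_zero) (simp add: prob_space)
  finally show ?thesis by (simp add: E_def)
qed

lemma (in prob_space) countable_tight:
  fixes Y :: "'a \<Rightarrow> 'c::countable"
  assumes Y: "Y \<in> M \<rightarrow>\<^sub>M count_space UNIV" and e: "e > 0"
  shows "\<exists>F. finite F \<and> 1 - e < (\<Sum>c\<in>F. prob {\<omega> \<in> space M. Y \<omega> = c})"
proof -
  define A where "A N = {\<omega> \<in> space M. to_nat (Y \<omega>) < N}" for N :: nat
  have meas: "{\<omega> \<in> space M. Y \<omega> \<in> S} \<in> events" for S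
  proof -
    have "{\<omega> \<in> space M. Y \<omega> \<in> S} = Y -` S \<inter> space M" by auto
    then show ?thesis using Y by (simp add: measurable_sets)
  qed
  have "range A \<subseteq> events"
    using meas[of "{c. to_nat c < N}" for N] by (auto simp: A_def)
  moreover have "incseq A" by (auto simp: A_def incseq_def)
  moreover have "(\<Union>N. A N) = space M" by (auto simp: A_def)
  ultimately have "(\<lambda>N. prob (A N)) \<longlonglongrightarrow> 1"
    using finite_Lim_measure_incseq[of A] by (simp add: prob_space)
  from order_tendstoD(1)[OF this, of "1 - e"] e obtain N where N: "1 - e < prob (A N)"
    using eventually_happens'[OF sequentially_bot] by force
  let ?F = "{c :: 'c. to_nat c < N}"
  have fin: "finite ?F" by (rule finite_vimageI[of "{..<N}" to_nat, unfolded vimage_def, simplified])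
  have "A N = (\<Union>c\<in>?F. {\<omega> \<in> space M. Y \<omega> = c})" by (auto simp: A_def)
  also have "prob \<dots> = (\<Sum>c\<in>?F. prob {\<omega> \<in> space M. Y \<omega> = c})"
    using meas[of "{c}" for c] fin by (intro finite_measure_finite_Union) (auto simp: disjoint_family_on_def)
  finally show ?thesis using N fin by auto
qed

text \<open>No mass escapes, because the limit is again a probability: a finite set that carries
  mass above \<open>1 - d\<close> in the limit does so for all large \<open>n\<close>, and on a
  finite set pointwise convergence suffices.\<close>

lemma countable_weak_convergence:
  fixes G :: "'c::countable \<Rightarrow> real" and X :: "nat \<Rightarrow> 'a \<Rightarrow> 'c" and Y :: "'b \<Rightarrow> 'c"
  assumes X: "\<forall>\<^sub>F n in sequentially. prob_space (M n) \<and> X n \<in> M n \<rightarrow>\<^sub>M count_space UNIV"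
    and P: "prob_space P" and Y: "Y \<in> P \<rightarrow>\<^sub>M count_space UNIV"
    and lim: "\<And>c. (\<lambda>n. measure (M n) {\<omega> \<in> space (M n). X n \<omega> = c}) \<longlonglongrightarrow> measure P {\<omega> \<in> space P. Y \<omega> = c}"
    and b: "\<And>c. \<bar>G c\<bar> \<le> b"
  shows "(\<lambda>n. \<integral>\<omega>. G (X n \<omega>) \<partial>M n) \<longlonglongrightarrow> (\<integral>\<omega>. G (Y \<omega>) \<partial>P)"
proof (rule LIMSEQ_I)
  interpret P: prob_space P by (rule P)
  fix e :: real assume e: "e > 0"
  have b0: "b \<ge> 0" using b[of undefined] by simp
  \<comment> \<open>Each of the two truncations costs at most \<open>b * d\<close>, and
    \<open>e - 2 * b * d\<close> is left for the finite sums. The summand 4 avoids division by zero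
    for \<open>b = 0\<close>.\<close>
  define d where "d = e / (4 * b + 4)"
  have d: "d > 0" "4 * b * d < e"
  proof -
    show "d > 0" using e b0 by (simp add: d_def)
    have "d * (4 * b + 4) = e" using b0 by (simp add: d_def)
    then have "4 * b * d + 4 * d = e" by (simp add: algebra_simps)
    then show "4 * b * d < e" using \<open>d > 0\<close> by linarith
  qed
  define u where "u n c = measure (M n) {\<omega> \<in> space (M n). X n \<omega> = c}" for n c
  define v where "v c = measure P {\<omega> \<in> space P. Y \<omega> = c}" for c
  have uv: "(\<lambda>n. u n c) \<longlonglongrightarrow> v c" for c unfolding u_def v_def by (rule lim)
  obtain F where F: "finite F" "1 - d < (\<Sum>c\<in>F. v c)"
    using P.countable_tight[OF Y d(1)] by (auto simp: v_def)
  have "(\<lambda>n. \<Sum>c\<in>F. u n c) \<longlonglongrightarrow> (\<Sum>c\<in>F. v c)" by (intro tendsto_sum uv)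
  from order_tendstoD(1)[OF this F(2)] have ev1: "\<forall>\<^sub>F n in sequentially. 1 - d < (\<Sum>c\<in>F. u n c)" .
  have "(\<lambda>n. \<bar>(\<Sum>c\<in>F. G c * u n c) - (\<Sum>c\<in>F. G c * v c)\<bar>) \<longlonglongrightarrow> 0"
    by (intro tendsto_rabs_zero LIM_zero tendsto_sum tendsto_mult_left uv)
  moreover have "0 < e - 2 * b * d"
    using d mult_nonneg_nonneg[OF b0 less_imp_le[OF d(1)]] by linarith
  ultimately have ev2: "\<forall>\<^sub>F n in sequentially. \<bar>(\<Sum>c\<in>F. G c * u n c) - (\<Sum>c\<in>F. G c * v c)\<bar> < e - 2 * b * d"
    by (rule order_tendstoD(2))
  have *: "\<bar>(\<integral>\<omega>. G (Y \<omega>) \<partial>P) - (\<Sum>c\<in>F. G c * v c)\<bar> \<le> b * d"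
  proof -
    have "\<bar>(\<integral>\<omega>. G (Y \<omega>) \<partial>P) - (\<Sum>c\<in>F. G c * v c)\<bar> \<le> b * (1 - (\<Sum>c\<in>F. v c))"
      unfolding v_def by (rule P.expectation_truncation[OF Y b F(1)])
    also have "\<dots> \<le> b * d" using F(2) b0 by (intro mult_left_mono) auto
    finally show ?thesis .
  qed
  have "\<forall>\<^sub>F n in sequentially. norm ((\<integral>\<omega>. G (X n \<omega>) \<partial>M n) - (\<integral>\<omega>. G (Y \<omega>) \<partial>P)) < e"
    using X ev1 ev2
  proof eventually_elim
    case (elim n)
    interpret Mn: prob_space "M n" using elim(1) by simp
    have "\<bar>(\<integral>\<omega>. G (X n \<omega>) \<partial>M n) - (\<Sum>c\<in>F. G c * u n c)\<bar> \<le> b * (1 - (\<Sum>c\<in>F. u n c))"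
      unfolding u_def using elim(1) by (intro Mn.expectation_truncation b F(1)) simp
    also have "\<dots> \<le> b * d" using elim(2) b0 by (intro mult_left_mono) auto
    finally show ?case using * elim(3) unfolding real_norm_def by linarith
  qed
  then show "\<exists>N. \<forall>n\<ge>N. norm ((\<integral>\<omega>. G (X n \<omega>) \<partial>M n) - (\<integral>\<omega>. G (Y \<omega>) \<partial>P)) < e"
    by (simp add: eventually_sequentially)
qed

lemma expectation_weighted_random_permutation:
  fixes F :: "(nat \<Rightarrow> nat) \<Rightarrow> real"
  assumes "weighted_random_permutation \<theta> n M \<sigma>"
  shows "(\<integral>\<omega>. F (\<sigma> \<omega>) \<partial>M) = (\<Sum>\<pi> | \<pi> permutes {1..n}. permutation_prob \<theta> n \<pi> * F \<pi>)"
proof -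
  interpret prob_space M using assms by (simp add: weighted_random_permutation_def)
  let ?P = "{\<pi>. \<pi> permutes {1..n}}"
  define E where "E \<pi> = {\<omega> \<in> space M. \<sigma> \<omega> = \<pi>}" for \<pi>
  have \<sigma>: "\<sigma> \<in> M \<rightarrow>\<^sub>M count_space ?P" using assms by (simp add: weighted_random_permutation_def)
  have fin: "finite ?P" by (simp add: finite_permutations)
  have E: "E \<pi> \<in> events" if "\<pi> \<in> ?P" for \<pi>
  proof -
    have "E \<pi> = \<sigma> -` {\<pi>} \<inter> space M" by (auto simp: E_def)
    then show ?thesis using measurable_sets[OF \<sigma>, of "{\<pi>}"] that by simp
  qed
  have "F (\<sigma> \<omega>) = (\<Sum>\<pi>\<in>?P. F \<pi> * indicat_real (E \<pi>) \<omega>)" if "\<omega> \<in> space M" for \<omega>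
  proof -
    have "(\<Sum>\<pi>\<in>?P. F \<pi> * indicat_real (E \<pi>) \<omega>) = (\<Sum>\<pi>\<in>?P. if \<sigma> \<omega> = \<pi> then F \<pi> else 0)"
      using that by (intro sum.cong) (auto simp: E_def)
    then show ?thesis using fin measurable_space[OF \<sigma> that] by simp
  qed
  then have "(\<integral>\<omega>. F (\<sigma> \<omega>) \<partial>M) = (\<integral>\<omega>. (\<Sum>\<pi>\<in>?P. F \<pi> * indicat_real (E \<pi>) \<omega>) \<partial>M)"
    by (intro Bochner_Integration.integral_cong) auto
  also have "\<dots> = (\<Sum>\<pi>\<in>?P. \<integral>\<omega>. F \<pi> * indicat_real (E \<pi>) \<omega> \<partial>M)"
    using E by (intro Bochner_Integration.integral_sum integrable_mult_right) (auto simp: less_top[symmetric])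
  also have "\<dots> = (\<Sum>\<pi>\<in>?P. permutation_prob \<theta> n \<pi> * F \<pi>)"
  proof (rule sum.cong[OF refl])
    fix \<pi> assume \<pi>: "\<pi> \<in> ?P"
    have "prob (E \<pi>) = permutation_prob \<theta> n \<pi>"
      using assms \<pi> by (simp add: weighted_random_permutation_def E_def permutation_prob_def)
    then show "(\<integral>\<omega>. F \<pi> * indicat_real (E \<pi>) \<omega> \<partial>M) = permutation_prob \<theta> n \<pi> * F \<pi>"
      using sets.sets_into_space[OF E[OF \<pi>]] by (simp add: Int_absorb2)
  qed
  finally show ?thesis .
qed

section \<open>Tightness of the cycle counts\<close>

context stable_weights
begin

lemma sum_permutation_prob:
  "cycle_norm \<theta> n > 0 \<Longrightarrow> (\<Sum>\<pi> | \<pi> permutes {1..n}. permutation_prob \<theta> n \<pi>) = 1"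
  by (simp add: permutation_prob_def sum_divide_distrib[symmetric]) (simp add: cycle_norm_def)

lemma cell_count_eq_0: "n < k \<Longrightarrow> cell_count n (cycle_cell k) \<pi> = 0"
proof -
  assume "n < k"
  have "length t \<le> n" if "t \<in> cycle_tuples n \<pi>" for t
    using that distinct_card[of t] card_mono[of "{1..n}" "set t"] by (auto simp: cycle_tuples_def)
  then have "{t \<in> cycle_tuples n \<pi>. rescale n t \<in> cycle_cell k} = {}"
    using \<open>n < k\<close> by (force simp: cycle_cell_def)
  then show ?thesis by (simp only: cell_count_def card.empty)
qed

text \<open>Markov's inequality for every length, with levels \<open>a k\<close> whose bounds sum to
  at most \<open>d\<close>. The means come from \<open>binomial_moment_bound\<close> with the single
  cell \<open>cycle_cell k\<close> and exponent 1.\<close>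

lemma cycle_counts_tight:
  assumes d: "d > 0"
  shows "\<exists>a n0. \<forall>n\<ge>n0. (\<Sum>\<pi> | \<pi> permutes {1..n}. permutation_prob \<theta> n \<pi> *
    of_bool (\<exists>k\<ge>1. a k < cell_count n (cycle_cell k) \<pi>)) \<le> d"
proof -
  obtain n0 C where n0: "n0 \<ge> 1" "C \<ge> 0"
    and bound: "\<forall>n\<ge>n0. \<forall>L B k r. disjoint_cells L B k \<longrightarrow>
      binomial_mean \<theta> n L B r \<le> C * (\<Prod>i<L. (\<theta> (k i) * 2 ^ k i) ^ r i / fact (r i))"
    using binomial_moment_bound by blast
  have mean: "(\<Sum>\<pi> | \<pi> permutes {1..n}. permutation_prob \<theta> n \<pi> * real (cell_count n (cycle_cell k) \<pi>)) \<le> C * (\<theta> k * 2 ^ k)"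
    if "n \<ge> n0" "k \<ge> 1" for n k
    using bound[rule_format, of n "1::nat" "\<lambda>_. cycle_cell k" "\<lambda>_. k" "\<lambda>_. 1"] that by (simp add: disjoint_family_on_def)
  \<comment> \<open>One power of 2 comes from the moment bound; the other makes the error for length
    \<open>k\<close> at most \<open>d * (1 / 2) ^ k\<close>.\<close>
  define a where "a k = nat \<lceil>C * (\<theta> k * 2 ^ k) * 2 ^ k / d\<rceil>" for k
  have a: "C * (\<theta> k * 2 ^ k) / real (Suc (a k)) \<le> d * (1 / 2) ^ k" if k: "k \<ge> 1" for k
  proof -
    have "C * (\<theta> k * 2 ^ k) * 2 ^ k / d \<le> real (Suc (a k))" unfolding a_def by linarith
    then show ?thesis using d by (simp add: field_simps del: of_nat_Suc)
  qed
  have "(\<Sum>\<pi> | \<pi> permutes {1..n}. permutation_prob \<theta> n \<pi> *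
      of_bool (\<exists>k\<ge>1. a k < cell_count n (cycle_cell k) \<pi>)) \<le> d" if n: "n \<ge> n0" for n
  proof -
    let ?bad = "\<lambda>\<pi>. \<exists>k\<ge>1. a k < cell_count n (cycle_cell k) \<pi>"
    let ?S = "\<lambda>\<pi>. \<Sum>k=1..n. real (cell_count n (cycle_cell k) \<pi>) / real (Suc (a k))"
    have le: "of_bool (?bad \<pi>) \<le> ?S \<pi>" for \<pi>
    proof (cases "?bad \<pi>")
      case True
      then obtain k where k: "k \<ge> 1" "a k < cell_count n (cycle_cell k) \<pi>" by blast
      then have "k \<in> {1..n}" using cell_count_eq_0[of n k \<pi>] by (cases "n < k") auto
      then have "real (cell_count n (cycle_cell k) \<pi>) / real (Suc (a k)) \<le> ?S \<pi>"
        by (intro member_le_sum) auto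
      moreover have "1 \<le> real (cell_count n (cycle_cell k) \<pi>) / real (Suc (a k))"
        using k(2) by (simp add: le_divide_eq del: of_nat_Suc)
      ultimately have "1 \<le> ?S \<pi>" by (rule order_trans[rotated])
      then show ?thesis using True by (simp del: of_nat_Suc)
    next
      case False
      have "0 \<le> ?S \<pi>"
        by (intro sum_nonneg) auto
      then show ?thesis by (simp only: False of_bool_eq)
    qed
    have "(\<Sum>\<pi> | \<pi> permutes {1..n}. permutation_prob \<theta> n \<pi> *
        of_bool (?bad \<pi>)) \<le>
      (\<Sum>\<pi> | \<pi> permutes {1..n}. permutation_prob \<theta> n \<pi> * ?S \<pi>)"
      using le permutation_prob_nonneg by (intro sum_mono mult_left_mono) auto
    also have "\<dots> = (\<Sum>k=1..n. (\<Sum>\<pi> | \<pi> permutes {1..n}. permutation_prob \<theta> n \<pi> *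
        real (cell_count n (cycle_cell k) \<pi>)) / real (Suc (a k)))"
      unfolding sum_distrib_left sum_divide_distrib by (subst sum.swap) simp
    also have "\<dots> \<le> (\<Sum>k=1..n. C * (\<theta> k * 2 ^ k) / real (Suc (a k)))"
      using mean[OF n] by (intro sum_mono divide_right_mono) auto
    also have "\<dots> \<le> (\<Sum>k=1..n. d * (1 / 2) ^ k)" using a by (intro sum_mono) auto
    also have "\<dots> = d * (\<Sum>k=1..n. (1 / 2) ^ k)" by (simp add: sum_distrib_left)
    also have "(\<Sum>k=1..n. (1 / 2 :: real) ^ k) = 1 - (1 / 2) ^ n"
      by (induction n) auto
    also have "d * (1 - (1 / 2) ^ n) \<le> d" using d by (simp add: mult_left_le)
    finally show ?thesis .
  qed
  then show ?thesis by blast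
qed

end

section \<open>Grid cells under the intensity and the Poisson random measure\<close>

definition grid_volume :: "nat \<Rightarrow> real list \<Rightarrow> real" where
  "grid_volume m q = measure (product_lborel (length q))
     (cell_section (length q) (grid_cell m q))"

lemma card_grid_points_grid_cell:
  assumes q: "q \<in> grid m"
  shows "(\<lambda>n. real (card (grid_points n (grid_cell m q))) / real n ^ length q) \<longlonglongrightarrow> grid_volume m q"
proof -
  have k: "length q \<ge> 1" using grid_subset[OF q] by simp
  show ?thesis unfolding grid_volume_def
    by (rule card_grid_points_tendsto(1)[OF k grid_cell_sets grid_cell_subset_cell])
       (rule grid_cell_stable[OF refl k], blast)
qed

lemma intensity_grid_cell:
  assumes q: "q \<in> grid m" and \<theta>: "\<And>k. k \<ge> 1 \<Longrightarrow> \<theta> k \<ge> 0"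
  shows "measure (cycle_intensity \<theta>) (grid_cell m q) = \<theta> (length q) * grid_volume m q"
    and "emeasure (cycle_intensity \<theta>) (grid_cell m q) \<noteq> \<infinity>"
proof -
  have k: "length q \<ge> 1" using grid_subset[OF q] by simp
  note intensity = measure_cycle_intensity_cell[where \<theta> = \<theta> and k = "length q" and B = "grid_cell m q",
      OF k grid_cell_sets grid_cell_subset_cell \<theta>[OF k]]
  show "measure (cycle_intensity \<theta>) (grid_cell m q) = \<theta> (length q) * grid_volume m q"
    unfolding grid_volume_def by (rule intensity(2))
  have "emeasure (product_lborel (length q))
      (cell_section (length q) (grid_cell m q)) < \<infinity>"
    by (rule card_grid_points_tendsto(2)[OF k grid_cell_sets grid_cell_subset_cell])
       (rule grid_cell_stable[OF refl k], blast)
  then show "emeasure (cycle_intensity \<theta>) (grid_cell m q) \<noteq> \<infinity>"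
    unfolding intensity(1) by (simp add: ennreal_mult_eq_top_iff)
qed

context
  fixes \<Lambda> :: "real list measure" and P :: "'b measure" and \<Psi> :: "'b \<Rightarrow> real list measure"
  assumes poisson: "poisson_random_measure \<Lambda> P \<Psi>"
begin

lemma poisson_prob_space: "prob_space P"
  using poisson by (simp add: poisson_random_measure_def random_element_def)

lemma poisson_locally_finite: "\<omega> \<in> space P \<Longrightarrow> \<Psi> \<omega> \<in> locally_finite_measures"
  using poisson measurable_space[of \<Psi> P "borel_measure_of vague_topology" \<omega>]
  by (simp add: poisson_random_measure_def random_element_def topspace_vague_topology)

lemma poisson_prob:
  assumes "B \<in> sets cycle_borel" "emeasure \<Lambda> B \<noteq> \<infinity>"
  shows "measure P {\<omega> \<in> space P. emeasure (\<Psi> \<omega>) B = of_nat j} = measure \<Lambda> B ^ j / fact j * exp (- measure \<Lambda> B)"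
  using poisson assms by (auto simp: poisson_random_measure_def)

lemma poisson_indep_vars:
  assumes "\<And>i. i < (L::nat) \<Longrightarrow> B i \<in> sets cycle_borel" "disjoint_family_on B {..<L}"
  shows "prob_space.indep_vars P (\<lambda>_. borel) (\<lambda>i \<omega>. emeasure (\<Psi> \<omega>) (B i)) {..<L}"
  using poisson assms unfolding poisson_random_measure_def by blast

text \<open>Independence of a family with a single member contains the measurability of that
  member.\<close>

lemma poisson_emeasure_measurable:
  assumes "B \<in> sets cycle_borel"
  shows "(\<lambda>\<omega>. emeasure (\<Psi> \<omega>) B) \<in> borel_measurable P"
proof -
  interpret prob_space P by (rule poisson_prob_space)
  have "indep_vars (\<lambda>_. borel) (\<lambda>i \<omega>. emeasure (\<Psi> \<omega>) B) {..<1::nat}"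
    by (rule poisson_indep_vars) (use assms in \<open>auto simp: disjoint_family_on_def\<close>)
  then show ?thesis unfolding indep_vars_def2 by auto
qed

lemma poisson_event:
  "B \<in> sets cycle_borel \<Longrightarrow> {\<omega> \<in> space P. emeasure (\<Psi> \<omega>) B = x} \<in> sets P"
  using measurable_sets[OF poisson_emeasure_measurable, of B "{x}"] by (simp add: vimage_def Int_def conj_commute)

text \<open>The Poisson probabilities of the natural numbers already sum to 1.\<close>

lemma poisson_AE_nat:
  assumes B: "B \<in> sets cycle_borel" "emeasure \<Lambda> B \<noteq> \<infinity>"
  shows "AE \<omega> in P. \<exists>j::nat. emeasure (\<Psi> \<omega>) B = of_nat j"
proof -
  interpret prob_space P by (rule poisson_prob_space)
  let ?E = "\<lambda>j::nat. {\<omega> \<in> space P. emeasure (\<Psi> \<omega>) B = of_nat j}"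
  have E: "range ?E \<subseteq> events" using poisson_event[OF B(1)] by blast
  have "disjoint_family ?E" by (auto simp: disjoint_family_on_def)
  from finite_measure_UNION[OF E this]
  have 1: "(\<lambda>j. measure \<Lambda> B ^ j / fact j * exp (- measure \<Lambda> B)) sums prob (\<Union>j. ?E j)"
    by (simp add: poisson_prob[OF B])
  have "(\<lambda>j. measure \<Lambda> B ^ j /\<^sub>R fact j * exp (- measure \<Lambda> B)) sums (exp (measure \<Lambda> B) * exp (- measure \<Lambda> B))"
    by (intro sums_mult2 exp_converges)
  then have 2: "(\<lambda>j. measure \<Lambda> B ^ j / fact j * exp (- measure \<Lambda> B)) sums 1"
    by (simp add: exp_minus divide_inverse mult.commute)
  have "prob (\<Union>j. ?E j) = 1" using sums_unique2[OF 1 2] .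
  then have "AE \<omega> in P. \<omega> \<in> (\<Union>j. ?E j)"
    using E by (intro AE_in_set_eq_1[THEN iffD2]) auto
  then show ?thesis by (rule AE_mp) auto
qed

lemma grid_counts_poisson_measurable:
  "(\<lambda>\<omega>. grid_counts m (\<Psi> \<omega>)) \<in> P \<rightarrow>\<^sub>M count_space UNIV"
  unfolding measurable_count_space_eq2_countable
proof (intro conjI ballI)
  fix c :: "nat list"
  let ?qs = "grid_list m"
  let ?N = "\<lambda>i \<omega>. nat \<lfloor>measure (\<Psi> \<omega>) (grid_cell m (?qs ! i))\<rfloor>"
  have meas: "?N i \<in> P \<rightarrow>\<^sub>M count_space UNIV" for i
    using poisson_emeasure_measurable[OF grid_cell_sets] unfolding measure_def by measurable
  have ev: "{\<omega> \<in> space P. ?N i \<omega> = c ! i} \<in> sets P" for i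
    using measurable_sets[OF meas, of "{c ! i}" i] by (simp add: vimage_def Int_def conj_commute)
  have "(\<lambda>\<omega>. grid_counts m (\<Psi> \<omega>)) -` {c} \<inter> space P =
      (if length c = length ?qs then {\<omega> \<in> space P. \<forall>i\<in>{..<length ?qs}. ?N i \<omega> = c ! i} else {})"
    by (auto simp: grid_counts_def list_eq_iff_nth_eq)
  also have "\<dots> \<in> sets P" using ev by (auto intro: sets.sets_Collect_finite_All)
  finally show "(\<lambda>\<omega>. grid_counts m (\<Psi> \<omega>)) -` {c} \<inter> space P \<in> sets P" .
qed auto

lemma poisson_AE_grid:
  assumes "\<forall>m. \<forall>q\<in>grid m. emeasure \<Lambda> (grid_cell m q) \<noteq> \<infinity>"
  shows "AE \<omega> in P. \<forall>m. \<forall>q\<in>grid m. \<exists>j::nat. emeasure (\<Psi> \<omega>) (grid_cell m q) = of_nat j"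
  unfolding AE_all_countable
proof
  fix m
  show "AE \<omega> in P. \<forall>q\<in>grid m. \<exists>j::nat. emeasure (\<Psi> \<omega>) (grid_cell m q) = of_nat j"
    by (rule AE_finite_allI[OF finite_grid]) (use assms in \<open>intro poisson_AE_nat grid_cell_sets; blast\<close>)
qed

text \<open>Independence over disjoint cells gives the product for the \<open>emeasure\<close>
  values. These are almost surely natural numbers, so the rounding in \<open>grid_counts\<close>
  changes the event by a null set only.\<close>

lemma poisson_grid_counts_prob:
  assumes fin: "\<forall>m. \<forall>q\<in>grid m. emeasure \<Lambda> (grid_cell m q) \<noteq> \<infinity>"
    and c: "length c = length (grid_list m)"
  shows "measure P {\<omega> \<in> space P. grid_counts m (\<Psi> \<omega>) = c} =
    (\<Prod>i<length (grid_list m). measure \<Lambda> (grid_cell m (grid_list m ! i)) ^ (c ! i) / fact (c ! i) *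
      exp (- measure \<Lambda> (grid_cell m (grid_list m ! i))))"
proof -
  interpret prob_space P by (rule poisson_prob_space)
  define L where "L = length (grid_list m)"
  define B where "B i = grid_cell m (grid_list m ! i)" for i
  have B: "B i \<in> sets cycle_borel" for i by (simp add: B_def grid_cell_sets)
  have finB: "emeasure \<Lambda> (B i) \<noteq> \<infinity>" if "i < L" for i
    using fin grid_list_nth that by (simp add: B_def L_def)
  have disj: "disjoint_family_on B {..<L}"
    using grid_cell_disjoint grid_list(2)[of m] by (auto simp: disjoint_family_on_def B_def L_def nth_eq_iff_index_eq)
  let ?D = "{\<omega> \<in> space P. \<forall>i<L. emeasure (\<Psi> \<omega>) (B i) = of_nat (c ! i)}" and ?C = "{\<omega> \<in> space P. grid_counts m (\<Psi> \<omega>) = c}"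
  let ?E = "\<lambda>i. {\<omega> \<in> space P. emeasure (\<Psi> \<omega>) (B i) = of_nat (c ! i)}"
  have ind: "indep_vars (\<lambda>_. borel) (\<lambda>i \<omega>. emeasure (\<Psi> \<omega>) (B i)) {..<L}"
    by (rule poisson_indep_vars[OF B disj])
  have "prob ?D = (\<Prod>i<L. prob (?E i))"
  \<comment> \<open>Without cells, as for \<open>m = 0\<close>, the empty intersection would be
    \<open>UNIV\<close> and not the sample space.\<close>
  proof (cases "L = 0")
    case True
    then show ?thesis by (simp add: prob_space)
  next
    case False
    have "prob (\<Inter>i\<in>{..<L}. ?E i) = (\<Prod>i<L. prob (?E i))"
    proof (rule indep_setsD[OF ind[unfolded indep_vars_def2, THEN conjunct2]])
      show "\<forall>i\<in>{..<L}. ?E i \<in> {(\<lambda>\<omega>. emeasure (\<Psi> \<omega>) (B i)) -` A \<inter> space P |A. A \<in> sets borel}"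
      proof
        fix i
        show "?E i \<in> {(\<lambda>\<omega>. emeasure (\<Psi> \<omega>) (B i)) -` A \<inter> space P |A. A \<in> sets borel}"
          by (rule CollectI, rule exI[of _ "{of_nat (c ! i)}"]) auto
      qed
    qed (use False in auto)
    moreover have "(\<Inter>i\<in>{..<L}. ?E i) = ?D"
      using False by auto
    ultimately show ?thesis by simp
  qed
  also have "\<dots> = (\<Prod>i<L. measure \<Lambda> (B i) ^ (c ! i) / fact (c ! i) * exp (- measure \<Lambda> (B i)))"
    by (rule prod.cong[OF refl]) (simp add: poisson_prob[OF B finB])
  also have "prob ?D =
      prob ?C"
  proof (rule finite_measure_eq_AE)
    show "AE \<omega> in P. \<omega> \<in> ?D \<longleftrightarrow>
        \<omega> \<in> ?C"
      using poisson_AE_grid[OF fin]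
    proof (rule AE_mp, intro AE_I2 impI)
      fix \<omega> assume \<omega>: "\<forall>m. \<forall>q\<in>grid m. \<exists>j::nat. emeasure (\<Psi> \<omega>) (grid_cell m q) = of_nat j"
      have "emeasure (\<Psi> \<omega>) (B i) = of_nat (c ! i) \<longleftrightarrow> nat \<lfloor>measure (\<Psi> \<omega>) (B i)\<rfloor> = c ! i" if "i < L" for i
      proof -
        have "grid_list m ! i \<in> grid m" using grid_list_nth that by (simp add: L_def)
        then obtain j :: nat where "emeasure (\<Psi> \<omega>) (B i) = of_nat j" using \<omega> unfolding B_def by blast
        then show ?thesis by (simp add: measure_def)
      qed
      then show "\<omega> \<in> ?D \<longleftrightarrow>
        \<omega> \<in> ?C"
        using c by (auto simp: grid_counts_def list_eq_iff_nth_eq B_def L_def)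
    qed
    have "{\<omega> \<in> space P. \<forall>i\<in>{..<L}. emeasure (\<Psi> \<omega>) (B i) = of_nat (c ! i)} \<in> events"
      using poisson_event[OF B] by (intro sets.sets_Collect_finite_All) auto
    then show "?D \<in> events"
      by (simp only: Ball_def lessThan_iff)
    show "?C \<in> events"
      using measurable_sets[OF grid_counts_poisson_measurable, of "{c}" m]
      by (simp add: vimage_def Int_def conj_commute)
  qed
  finally show ?thesis by (simp add: B_def L_def)
qed

text \<open>Almost every realization has natural masses on all grid cells, so
  \<open>grid_measure_limitin\<close> and the continuity of \<open>g\<close> give pointwise
  convergence, dominated by the constant \<open>b\<close>.\<close>

lemma poisson_discretization:
  assumes fin: "\<forall>m. \<forall>q\<in>grid m. emeasure \<Lambda> (grid_cell m q) \<noteq> \<infinity>"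
    and g: "continuous_map vague_topology euclideanreal g" "\<forall>\<nu>\<in>locally_finite_measures. \<bar>g \<nu>\<bar> \<le> b"
  shows "(\<lambda>m. \<integral>\<omega>. g (grid_measure m (grid_counts m (\<Psi> \<omega>))) \<partial>P) \<longlonglongrightarrow> (\<integral>\<omega>. g (\<Psi> \<omega>) \<partial>P)"
proof (rule integral_dominated_convergence[where w = "\<lambda>_. b"])
  interpret prob_space P by (rule poisson_prob_space)
  have "\<Psi> \<in> P \<rightarrow>\<^sub>M borel_measure_of vague_topology"
    using poisson by (simp add: poisson_random_measure_def random_element_def)
  from measurable_compose[OF this continuous_map_borel_measurable[OF g(1)]]
  show "(\<lambda>\<omega>. g (\<Psi> \<omega>)) \<in> borel_measurable P" .
  show "(\<lambda>\<omega>. g (grid_measure m (grid_counts m (\<Psi> \<omega>)))) \<in> borel_measurable P" for m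
    by (rule measurable_compose[OF grid_counts_poisson_measurable]) simp
  show "integrable P (\<lambda>_. b)" by simp
  show "AE \<omega> in P. (\<lambda>m. g (grid_measure m (grid_counts m (\<Psi> \<omega>)))) \<longlonglongrightarrow> g (\<Psi> \<omega>)"
    using poisson_AE_grid[OF fin]
  proof (rule AE_mp, intro AE_I2 impI)
    fix \<omega> assume \<omega>: "\<omega> \<in> space P" "\<forall>m. \<forall>q\<in>grid m. \<exists>j::nat. emeasure (\<Psi> \<omega>) (grid_cell m q) = of_nat j"
    have "measure (\<Psi> \<omega>) (grid_cell m q) \<in> \<nat>" if "q \<in> grid m" for m q
    proof -
      obtain j :: nat where "emeasure (\<Psi> \<omega>) (grid_cell m q) = of_nat j" using \<omega>(2) \<open>q \<in> grid m\<close> by blast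
      then show ?thesis by (simp add: measure_def)
    qed
    from grid_measure_limitin[OF poisson_locally_finite[OF \<omega>(1)] this]
    show "(\<lambda>m. g (grid_measure m (grid_counts m (\<Psi> \<omega>)))) \<longlonglongrightarrow> g (\<Psi> \<omega>)"
      using continuous_map_limit[OF g(1)] by (force simp: o_def)
  qed
  show "AE \<omega> in P. norm (g (grid_measure m (grid_counts m (\<Psi> \<omega>)))) \<le> b" for m
    using g(2) grid_measure_locally_finite by simp
qed

end

lemma grid_counts_cycle_point_measure:
  "grid_counts m (cycle_point_measure n \<pi>) = c \<longleftrightarrow> length c = length (grid_list m) \<and>
    (\<forall>i<length (grid_list m). cell_count n (grid_cell m (grid_list m ! i)) \<pi> = c ! i)"
  by (auto simp: grid_counts_def list_eq_iff_nth_eq measure_cycle_point_measure[OF grid_cell_sets])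

theorem theorem1:
  fixes \<theta> :: "nat \<Rightarrow> real"
    and M :: "nat \<Rightarrow> 'a measure" and \<sigma> :: "nat \<Rightarrow> 'a \<Rightarrow> nat \<Rightarrow> nat"
    and P :: "'b measure" and \<Psi> :: "'b \<Rightarrow> real list measure"
  assumes "\<And>k. k \<ge> 1 \<Longrightarrow> \<theta> k \<ge> 0"
    and "\<And>n. cycle_norm \<theta> n > 0 \<Longrightarrow> weighted_random_permutation \<theta> n (M n) (\<sigma> n)"
    and "(\<lambda>n. cycle_norm \<theta> (n - 1) / cycle_norm \<theta> n) \<longlonglongrightarrow> 1"
    and "poisson_random_measure (cycle_intensity \<theta>) P \<Psi>"
  shows "converges_in_distribution vague_topology
           M (\<lambda>n \<omega>. cycle_point_measure n (\<sigma> n \<omega>)) P \<Psi>"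
proof -
  interpret stable_weights \<theta> using assms(1,3) by unfold_locales
  note poisson = assms(4)
  let ?perms = "\<lambda>n. {\<pi>. \<pi> permutes {1..n}}" and ?\<psi> = cycle_point_measure
  have wrp: "weighted_random_permutation \<theta> n (M n) (\<sigma> n)" if "cycle_norm \<theta> n > 0" for n
    using assms(2) that .
  have space_n: "prob_space (M n)" "\<sigma> n \<in> M n \<rightarrow>\<^sub>M count_space (?perms n)" if "cycle_norm \<theta> n > 0" for n
    using wrp[OF that] by (simp_all add: weighted_random_permutation_def)
  have expectation: "(\<integral>\<omega>. F (\<sigma> n \<omega>) \<partial>M n) = (\<Sum>\<pi> | \<pi> permutes {1..n}. permutation_prob \<theta> n \<pi> * F \<pi>)"
    if "cycle_norm \<theta> n > 0" for n and F :: "(nat \<Rightarrow> nat) \<Rightarrow> real"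
    by (rule expectation_weighted_random_permutation[OF wrp[OF that]])
  have fin: "\<forall>m. \<forall>q\<in>grid m. emeasure (cycle_intensity \<theta>) (grid_cell m q) \<noteq> \<infinity>"
    using intensity_grid_cell(2)[where \<theta> = \<theta>, OF _ assms(1)] by blast

  have elt: "\<forall>\<^sub>F n in sequentially. random_element (M n) vague_topology (\<lambda>\<omega>. ?\<psi> n (\<sigma> n \<omega>))"
    using norm_pos_eventually
  proof eventually_elim
    case (elim n)
    have "?\<psi> n \<in> count_space (?perms n) \<rightarrow>\<^sub>M borel_measure_of vague_topology"
      using cycle_point_measure_locally_finite by (auto simp: topspace_vague_topology)
    from measurable_compose[OF space_n(2)[OF elim] this] space_n(1)[OF elim]
    show ?case by (simp add: random_element_def)
  qed

  have "(\<lambda>n. \<integral>\<omega>. g (?\<psi> n (\<sigma> n \<omega>)) \<partial>M n) \<longlonglongrightarrow> (\<integral>\<omega>. g (\<Psi> \<omega>) \<partial>P)"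
    if g: "continuous_map vague_topology euclideanreal g" and bnd: "bounded (g ` topspace vague_topology)" for g
  proof (rule LIMSEQ_I)
    obtain b0 where b0: "\<And>\<nu>. \<nu> \<in> locally_finite_measures \<Longrightarrow> \<bar>g \<nu>\<bar> \<le> b0"
      using bnd by (auto simp: bounded_iff topspace_vague_topology)
    \<comment> \<open>The maximum with 1 makes \<open>b\<close> positive, as it is going to be a
      divisor.\<close>
    define b where "b = max b0 1"
    have b: "\<forall>\<nu>\<in>locally_finite_measures. \<bar>g \<nu>\<bar> \<le> b" using b0 by (force simp: b_def)
    have b_pos: "b > 0" by (simp add: b_def)
    let ?G = "\<lambda>m \<nu>. g (grid_measure m (grid_counts m \<nu>))"
    \<comment> \<open>For a fixed mesh both sides are expectations of a bounded function of the
      count list, whose point probabilities converge.\<close>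
    have discrete: "(\<lambda>n. \<integral>\<omega>. ?G m (?\<psi> n (\<sigma> n \<omega>)) \<partial>M n) \<longlonglongrightarrow> (\<integral>\<omega>. ?G m (\<Psi> \<omega>) \<partial>P)" for m
    proof (rule countable_weak_convergence[where X = "\<lambda>n \<omega>. grid_counts m (?\<psi> n (\<sigma> n \<omega>))"])
      show "\<forall>\<^sub>F n in sequentially. prob_space (M n) \<and> (\<lambda>\<omega>. grid_counts m (?\<psi> n (\<sigma> n \<omega>))) \<in> M n \<rightarrow>\<^sub>M count_space UNIV"
        using norm_pos_eventually
      proof eventually_elim
        case (elim n)
        from measurable_compose[OF space_n(2)[OF elim], of "\<lambda>\<pi>. grid_counts m (?\<psi> n \<pi>)" "count_space UNIV"] space_n(1)[OF elim]
        show ?case by simp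
      qed
      show "prob_space P" by (rule poisson_prob_space[OF poisson])
      show "(\<lambda>\<omega>. grid_counts m (\<Psi> \<omega>)) \<in> P \<rightarrow>\<^sub>M count_space UNIV" by (rule grid_counts_poisson_measurable[OF poisson])
      show "\<bar>g (grid_measure m c)\<bar> \<le> b" for c using b grid_measure_locally_finite by blast
      fix c
      let ?L = "length (grid_list m)" and ?B = "\<lambda>i. grid_cell m (grid_list m ! i)"
      have prob_n: "measure (M n) {\<omega> \<in> space (M n). grid_counts m (?\<psi> n (\<sigma> n \<omega>)) = c} =
          (\<Sum>\<pi> | \<pi> permutes {1..n}. permutation_prob \<theta> n \<pi> * of_bool (grid_counts m (?\<psi> n \<pi>) = c))"
        if "cycle_norm \<theta> n > 0" for n
      proof -
        have "measure (M n) {\<omega> \<in> space (M n). grid_counts m (?\<psi> n (\<sigma> n \<omega>)) = c} =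
            (\<integral>\<omega>. indicat_real {\<omega> \<in> space (M n). grid_counts m (?\<psi> n (\<sigma> n \<omega>)) = c} \<omega> \<partial>M n)"
          by simp (intro arg_cong[of _ _ "measure (M n)"], auto)
        also have "\<dots> = (\<integral>\<omega>. of_bool (grid_counts m (?\<psi> n (\<sigma> n \<omega>)) = c) \<partial>M n)"
          by (intro Bochner_Integration.integral_cong) auto
        finally show ?thesis
          using expectation[OF that, of "\<lambda>\<pi>. of_bool (grid_counts m (?\<psi> n \<pi>) = c)"] by simp
      qed
      show "(\<lambda>n. measure (M n) {\<omega> \<in> space (M n). grid_counts m (?\<psi> n (\<sigma> n \<omega>)) = c}) \<longlonglongrightarrow>
          measure P {\<omega> \<in> space P. grid_counts m (\<Psi> \<omega>) = c}"
      proof (cases "length c = ?L")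
        case False
        \<comment> \<open>Count lists have the length of \<open>grid_list m\<close>, so any other
          \<open>c\<close> has probability 0 on both sides.\<close>
        then have "grid_counts m \<nu> \<noteq> c" for \<nu> by (auto simp: grid_counts_def)
        then show ?thesis by simp
      next
        case True
        let ?k = "\<lambda>i. length (grid_list m ! i)" and ?v = "\<lambda>i. grid_volume m (grid_list m ! i)"
        let ?p = "\<Prod>i<?L. (\<theta> (?k i) * ?v i) ^ (c ! i) / fact (c ! i) * exp (- (\<theta> (?k i) * ?v i))"
        have lim: "(\<lambda>n. \<Sum>\<pi> | \<pi> permutes {1..n}. permutation_prob \<theta> n \<pi> * of_bool (\<forall>i<?L. cell_count n (?B i) \<pi> = c ! i)) \<longlonglongrightarrow> ?p"
        proof (rule cell_count_poisson_limit)
          show "?B i \<subseteq> cycle_cell (?k i)" for i by (rule grid_cell_subset_cell)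
          show "1 \<le> ?k i" if "i < ?L" for i using grid_subset[OF grid_list_nth[OF that]] by simp
          show "?B i \<inter> ?B j = {}" if "i < ?L" "j < ?L" "i \<noteq> j" for i j
            using that grid_list(2)[of m] by (intro grid_cell_disjoint) (simp add: nth_eq_iff_index_eq)
          show "(\<lambda>n. real (card (grid_points n (?B i))) / real n ^ ?k i) \<longlonglongrightarrow> ?v i" if "i < ?L" for i
            by (rule card_grid_points_grid_cell[OF grid_list_nth[OF that]])
        qed
        have ev: "\<forall>\<^sub>F n in sequentially.
            (\<Sum>\<pi> | \<pi> permutes {1..n}. permutation_prob \<theta> n \<pi> * of_bool (\<forall>i<?L. cell_count n (?B i) \<pi> = c ! i)) =
            measure (M n) {\<omega> \<in> space (M n). grid_counts m (?\<psi> n (\<sigma> n \<omega>)) = c}"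
          using norm_pos_eventually
        proof eventually_elim
          case (elim n)
          show ?case
            unfolding prob_n[OF elim] by (simp only: grid_counts_cycle_point_measure True simp_thms)
        qed
        have limit: "measure P {\<omega> \<in> space P. grid_counts m (\<Psi> \<omega>) = c} = ?p"
          unfolding poisson_grid_counts_prob[OF poisson fin True] 
          by (rule prod.cong) (auto simp: intensity_grid_cell(1)[where \<theta> = \<theta>, OF grid_list_nth assms(1)])
        show ?thesis unfolding limit by (rule Lim_transform_eventually[OF lim ev])
      qed
    qed

    fix e :: real assume e: "e > 0"
    \<comment> \<open>This gives \<open>2 * b * d = e / 4\<close>: the exceptional configurations
      cost no more than the error \<open>e / 4\<close> allowed for the others.\<close>
    define d where "d = e / (8 * b)"
    have d: "d > 0" using e b_pos by (simp add: d_def)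
    obtain a n0 where tight: "\<And>n. n \<ge> n0 \<Longrightarrow> (\<Sum>\<pi> | \<pi> permutes {1..n}. permutation_prob \<theta> n \<pi> *
        of_bool (\<exists>k\<ge>1. a k < cell_count n (cycle_cell k) \<pi>)) \<le> d"
      using cycle_counts_tight[OF d] by blast
    have e4: "e / 4 > 0" using e by simp
    obtain m0 where m0: "\<forall>m\<ge>m0. \<forall>n \<pi>. (\<forall>k\<ge>1. cell_count n (cycle_cell k) \<pi> \<le> a k) \<longrightarrow>
        \<bar>g (?\<psi> n \<pi>) - ?G m (?\<psi> n \<pi>)\<bar> < e / 4"
      using uniform_discretization[OF g e4] by blast
    have "\<forall>\<^sub>F m in sequentially. \<bar>(\<integral>\<omega>. ?G m (\<Psi> \<omega>) \<partial>P) - (\<integral>\<omega>. g (\<Psi> \<omega>) \<partial>P)\<bar> < e / 4"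
      using tendstoD[OF poisson_discretization[OF poisson fin g b] e4] by (simp add: dist_real_def)
    \<comment> \<open>The mesh is fixed after the bounds \<open>a\<close> and before
      \<open>n\<close>. It is fine enough for all configurations within \<open>a\<close> and for the
      Poisson measure; then \<open>n\<close> grows with \<open>m\<close> fixed. The errors are
      \<open>e / 2\<close> for \<Psi>_n, \<open>e / 4\<close> for the discrete limit and
      \<open>e / 4\<close> for \<Psi>.\<close>
    then obtain m where m: "m \<ge> m0" "\<bar>(\<integral>\<omega>. ?G m (\<Psi> \<omega>) \<partial>P) - (\<integral>\<omega>. g (\<Psi> \<omega>) \<partial>P)\<bar> < e / 4"
      using eventually_happens'[OF sequentially_bot eventually_conj[OF _ eventually_ge_at_top[of m0]]] by blast
    have close: "\<bar>(\<integral>\<omega>. g (?\<psi> n (\<sigma> n \<omega>)) \<partial>M n) - (\<integral>\<omega>. ?G m (?\<psi> n (\<sigma> n \<omega>)) \<partial>M n)\<bar> \<le> e / 2"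
      if n: "n \<ge> n0" "cycle_norm \<theta> n > 0" for n
    proof -
      let ?p = "permutation_prob \<theta> n" and ?bad = "\<lambda>\<pi>. \<exists>k\<ge>1. a k < cell_count n (cycle_cell k) \<pi>"
      \<comment> \<open>Within the bounds \<open>a\<close> the uniform discretization error applies,
        outside them the crude bound \<open>2 * b\<close>.\<close>
      have diff: "\<bar>g (?\<psi> n \<pi>) - ?G m (?\<psi> n \<pi>)\<bar> \<le> e / 4 + 2 * b * of_bool (?bad \<pi>)" for \<pi>
      proof (cases "?bad \<pi>")
        case True
        have "\<bar>g (?\<psi> n \<pi>)\<bar> \<le> b" "\<bar>?G m (?\<psi> n \<pi>)\<bar> \<le> b"
          using b cycle_point_measure_locally_finite grid_measure_locally_finite by blast+
        then have "\<bar>g (?\<psi> n \<pi>) - ?G m (?\<psi> n \<pi>)\<bar> \<le> e / 4 + 2 * b" using e by linarith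
        moreover have "of_bool (?bad \<pi>) = (1::real)" using True by (simp only: of_bool_eq)
        ultimately show ?thesis by (simp only: mult_1_right)
      next
        case False
        then have few: "cell_count n (cycle_cell k) \<pi> \<le> a k" if "k \<ge> 1" for k
          using that not_less by blast
        have "\<bar>g (?\<psi> n \<pi>) - ?G m (?\<psi> n \<pi>)\<bar> < e / 4" by (rule m0[rule_format, OF m(1) few])
        moreover have "of_bool (?bad \<pi>) = (0::real)" using False by (simp only: of_bool_eq)
        ultimately show ?thesis by (simp only: mult_zero_right add_0_right less_imp_le)
      qed
      have "\<bar>(\<integral>\<omega>. g (?\<psi> n (\<sigma> n \<omega>)) \<partial>M n) - (\<integral>\<omega>. ?G m (?\<psi> n (\<sigma> n \<omega>)) \<partial>M n)\<bar> =
          \<bar>\<Sum>\<pi>\<in>?perms n. ?p \<pi> * (g (?\<psi> n \<pi>) - ?G m (?\<psi> n \<pi>))\<bar>"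
        unfolding expectation[OF n(2), of "\<lambda>\<pi>. g (?\<psi> n \<pi>)"] expectation[OF n(2), of "\<lambda>\<pi>. ?G m (?\<psi> n \<pi>)"]
        by (simp add: right_diff_distrib sum_subtractf)
      also have "\<dots> \<le> (\<Sum>\<pi>\<in>?perms n. \<bar>?p \<pi> * (g (?\<psi> n \<pi>) - ?G m (?\<psi> n \<pi>))\<bar>)" by (rule sum_abs)
      also have "\<dots> \<le> (\<Sum>\<pi>\<in>?perms n. ?p \<pi> * (e / 4 + 2 * b * of_bool (?bad \<pi>)))"
        unfolding abs_mult abs_of_nonneg[OF permutation_prob_nonneg]
        using diff permutation_prob_nonneg by (intro sum_mono mult_left_mono) auto
      also have "\<dots> = e / 4 * (\<Sum>\<pi>\<in>?perms n. ?p \<pi>) + 2 * b * (\<Sum>\<pi>\<in>?perms n. ?p \<pi> * of_bool (?bad \<pi>))"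
        unfolding sum_distrib_left sum.distrib[symmetric] by (rule sum.cong) (simp_all add: algebra_simps)
      also have "\<dots> \<le> e / 4 * 1 + 2 * b * d"
        unfolding sum_permutation_prob[OF n(2)] using tight[OF n(1)] b_pos by (intro add_left_mono mult_left_mono) auto
      also have "\<dots> = e / 2" using b_pos by (simp add: d_def)
      finally show ?thesis .
    qed
    have "\<forall>\<^sub>F n in sequentially. \<bar>(\<integral>\<omega>. ?G m (?\<psi> n (\<sigma> n \<omega>)) \<partial>M n) - (\<integral>\<omega>. ?G m (\<Psi> \<omega>) \<partial>P)\<bar> < e / 4"
      using tendstoD[OF discrete e4] by (simp add: dist_real_def)
    then have "\<forall>\<^sub>F n in sequentially. norm ((\<integral>\<omega>. g (?\<psi> n (\<sigma> n \<omega>)) \<partial>M n) - (\<integral>\<omega>. g (\<Psi> \<omega>) \<partial>P)) < e"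
      using norm_pos_eventually eventually_ge_at_top[of n0]
    proof eventually_elim
      case (elim n)
      then show ?case using close[OF elim(3,2)] m(2) unfolding real_norm_def by linarith
    qed
    then show "\<exists>N. \<forall>n\<ge>N. norm ((\<integral>\<omega>. g (?\<psi> n (\<sigma> n \<omega>)) \<partial>M n) - (\<integral>\<omega>. g (\<Psi> \<omega>) \<partial>P)) < e"
      by (simp add: eventually_sequentially)
  qed
  moreover have "random_element P vague_topology \<Psi>"
    using poisson unfolding poisson_random_measure_def by (rule conjunct1)
  ultimately show ?thesis
    using elt unfolding converges_in_distribution_def by blast
qed

end
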